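(* Let $Q=\{(a,b,c)\in\mathbb R^3: a>0,\ b>c>0\}$. For an initial condition in $Q$, let $(A(t),B(t),C(t))$, $t\in(-T_b,T_f)$, denote the maximal solution with $(A(0),B(0),C(0))$ equal to that initial condition of the system (the normalized Ricci flow for left-invariant metrics on $\mathrm{SL}(2,\mathbb R)$) $$\frac{dA}{dt}=\frac23\left[-A^2(2A+B+C)+A(B-C)^2\right],$$ $$\frac{dB}{dt}=\frac23\left[-B^2(2B+A-C)+B(A+C)^2\right],$$ $$\frac{dC}{dt}=\frac23\left[-C^2(2C+A-B)+C(A+B)^2\right].$$ There is an open dense subset $Q_0$ of $Q$ such that, for any maximal solution with $(A(0),B(0),C(0))\in Q_0$, as $t$ tends to $-T_b$, (1) either $A(t)\sim \frac{\sqrt6}{4}(t+T_b)^{-1/2}$, $B(t)\sim\eta_2(t+T_b)^{1/4}$, $C(t)\sim\eta_3(t+T_b)^{1/4}$ for some constants $\eta_2,\eta_3\in(0,\infty)$; (2) or $A(t)\sim\eta_1(t+T_b)^{1/4}$, $B(t)\sim\frac{\sqrt6}{4}(t+T_b)^{-1/2}$, $C(t)\sim\eta_3(t+T_b)^{1/4}$ for some constants $\eta_1,\eta_3\in(0,\infty)$. In fact, let $Q_1$ (resp. $Q_2$) be the set of initial conditions in $Q$ such that case (1) (resp. case (2)) occurs. Then there exists a smooth embedded hypersurface $S_0\subset Q$ such that $Q_1,Q_2$ are the two connected components of $Q\setminus S_0$. Moreover, for initial conditions on $S_0$, as $t$ tends to $-T_b$, $$A(t)\sim B(t)\sim\frac{\sqrt6}{4}(t+T_b)^{-1/2},$$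 and, when $A(0)B(0)C(0)=4$, $C(t)\sim\frac{32}{3}(t+T_b)$.
   Context: Given a left-invariant metric $g_0$ on $\mathrm{SL}(2,\mathbb R)$ there is a left-invariant frame $(f_1,f_2,f_3)$ (Milnor frame) with $[f_2,f_3]=-2f_1$, $[f_3,f_1]=2f_2$, $[f_1,f_2]=2f_3$ in which $g_0=A_0f^1\otimes f^1+B_0f^2\otimes f^2+C_0f^3\otimes f^3$, where $(f^i)$ is the dual frame. The normalized Ricci flow $\partial_t g=-2Rc+\frac23Rg$, $g(0)=g_0$, has the form $g(t)=A(t)f^1\otimes f^1+B(t)f^2\otimes f^2+C(t)f^3\otimes f^3$; the product $ABC$ is constant along it, and under the normalization $A_0B_0C_0=4$ the functions $A,B,C$ satisfy exactly the displayed ODE system with initial condition $(A_0,B_0,C_0)$. By the symmetry exchanging $B$ and $C$, one considers $B_0\ge C_0$. $(-T_b,T_f)$ is the maximal interval of existence containing $0$; it is known that $T_b\in(0,\infty)$. The notation $f(t)\sim k(t)$ as $t\to -T_b$ means $f(t)/k(t)\to1$. *)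

theory Defs
  imports "HOL-Analysis.Analysis" "HOL-Library.Landau_Symbols"
begin

section \<open>Smooth embedded hypersurfaces\<close>

text \<open>
  \<open>C_k_on k S f\<close> is meant for open \<open>S\<close>. In finite dimension, \<open>f\<close> is of class $C^{k+1}$ on \<open>S\<close> iff it
  is differentiable on \<open>S\<close> and all its directional derivatives are of class $C^k$ on \<open>S\<close>.
\<close>

primrec C_k_on ::
  "nat \<Rightarrow> 'a::euclidean_space set \<Rightarrow> ('a \<Rightarrow> 'b::euclidean_space) \<Rightarrow> bool" where
  "C_k_on 0 S f \<longleftrightarrow> continuous_on S f"
| "C_k_on (Suc k) S f \<longleftrightarrow>
     (\<forall>x\<in>S. f differentiable (at x)) \<and>
     (\<forall>v. C_k_on k S (\<lambda>x. frechet_derivative f (at x) v))"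

definition smooth_on ::
  "'a::euclidean_space set \<Rightarrow> ('a \<Rightarrow> 'b::euclidean_space) \<Rightarrow> bool" where
  "smooth_on S f \<longleftrightarrow> (\<forall>k. C_k_on k S f)"

text \<open>
  Local slice condition: around each of its points, \<open>S\<close> is mapped to a piece of a coordinate
  hyperplane by a smooth diffeomorphism between open subsets of the ambient space.
\<close>

definition smooth_embedded_hypersurface :: "'a::euclidean_space set \<Rightarrow> bool" where
  "smooth_embedded_hypersurface S \<longleftrightarrow>
     (\<forall>p\<in>S. \<exists>U V \<phi> \<psi>. \<exists>e\<in>Basis.
        open U \<and> p \<in> U \<and> open V \<and> homeomorphism U V \<phi> \<psi> \<and>
        smooth_on U \<phi> \<and> smooth_on V \<psi> \<and>
        \<phi> ` (S \<inter> U) = {y \<in> V. y \<bullet> (e :: 'a) = 0})"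

section \<open>The normalized Ricci flow of left-invariant metrics on SL(2,R)\<close>

definition Q :: "(real \<times> real \<times> real) set" where
  "Q = {(a, b, c). a > 0 \<and> b > c \<and> c > 0}"

definition flow_solution_on ::
  "real set \<Rightarrow> (real \<Rightarrow> real) \<Rightarrow> (real \<Rightarrow> real) \<Rightarrow> (real \<Rightarrow> real) \<Rightarrow> bool" where
  "flow_solution_on I A B C \<longleftrightarrow> (\<forall>t\<in>I.
     (A has_real_derivative
        2/3 * (- ((A t)^2 * (2 * A t + B t + C t)) + A t * (B t - C t)^2)) (at t) \<and>
     (B has_real_derivative
        2/3 * (- ((B t)^2 * (2 * B t + A t - C t)) + B t * (A t + C t)^2)) (at t) \<and>
     (C has_real_derivative
        2/3 * (- ((C t)^2 * (2 * C t + A t - B t)) + C t * (A t + B t)^2)) (at t))"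

text \<open>
  The endpoints are extended reals, so finiteness of \<open>Tb\<close> is not presupposed. Values of
  \<open>A\<close>, \<open>B\<close>, \<open>C\<close> outside the interval are irrelevant.
\<close>

definition time_interval :: "ereal \<Rightarrow> ereal \<Rightarrow> real set" where
  "time_interval Tb Tf = {t. - Tb < ereal t \<and> ereal t < Tf}"

definition maximal_solution ::
  "ereal \<Rightarrow> ereal \<Rightarrow> (real \<Rightarrow> real) \<Rightarrow> (real \<Rightarrow> real) \<Rightarrow> (real \<Rightarrow> real) \<Rightarrow> bool" where
  "maximal_solution Tb Tf A B C \<longleftrightarrow>
     0 < Tb \<and> 0 < Tf \<and> flow_solution_on (time_interval Tb Tf) A B C \<and>
     (\<forall>Tb' Tf' A' B' C'.
        Tb \<le> Tb' \<and> Tf \<le> Tf' \<and> flow_solution_on (time_interval Tb' Tf') A' B' C' \<and>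
        (\<forall>t \<in> time_interval Tb Tf. A' t = A t \<and> B' t = B t \<and> C' t = C t)
        \<longrightarrow> Tb' = Tb \<and> Tf' = Tf)"

text \<open>
  The comparison functions below are positive to the right of \<open>-T\<close>, so there the library relation
  of asymptotic equivalence says exactly that the quotient tends to 1.
\<close>

definition behavior1 ::
  "real \<Rightarrow> (real \<Rightarrow> real) \<Rightarrow> (real \<Rightarrow> real) \<Rightarrow> (real \<Rightarrow> real) \<Rightarrow> bool" where
  "behavior1 T A B C \<longleftrightarrow>
     A \<sim>[at_right (- T)] (\<lambda>t. sqrt 6 / 4 * (t + T) powr (- 1/2)) \<and>
     (\<exists>\<eta>2 \<eta>3. \<eta>2 > 0 \<and> \<eta>3 > 0 \<and>
        B \<sim>[at_right (- T)] (\<lambda>t. \<eta>2 * (t + T) powr (1/4)) \<and>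
        C \<sim>[at_right (- T)] (\<lambda>t. \<eta>3 * (t + T) powr (1/4)))"

definition behavior2 ::
  "real \<Rightarrow> (real \<Rightarrow> real) \<Rightarrow> (real \<Rightarrow> real) \<Rightarrow> (real \<Rightarrow> real) \<Rightarrow> bool" where
  "behavior2 T A B C \<longleftrightarrow>
     B \<sim>[at_right (- T)] (\<lambda>t. sqrt 6 / 4 * (t + T) powr (- 1/2)) \<and>
     (\<exists>\<eta>1 \<eta>3. \<eta>1 > 0 \<and> \<eta>3 > 0 \<and>
        A \<sim>[at_right (- T)] (\<lambda>t. \<eta>1 * (t + T) powr (1/4)) \<and>
        C \<sim>[at_right (- T)] (\<lambda>t. \<eta>3 * (t + T) powr (1/4)))"

definition Q1 :: "(real \<times> real \<times> real) set" where
  "Q1 = {x \<in> Q. \<exists>T Tf A B C. maximal_solution (ereal T) Tf A B C \<and>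
           (A 0, B 0, C 0) = x \<and> behavior1 T A B C}"

definition Q2 :: "(real \<times> real \<times> real) set" where
  "Q2 = {x \<in> Q. \<exists>T Tf A B C. maximal_solution (ereal T) Tf A B C \<and>
           (A 0, B 0, C 0) = x \<and> behavior2 T A B C}"

end

theory Submission
  imports Defs
begin

text \<open>
  Run the flow backwards and divide by \<open>B\<close>. The shape \<open>x = A/B\<close>, \<open>y = C/B\<close> follows a planar system in
  which \<open>y\<close> decreases to a limit. The regions \<open>x > 1\<close> and \<open>x < 1 - y\<close> are invariant; in the first \<open>A\<close>
  dominates, in the second \<open>B\<close> does, and since \<open>ABC\<close> is constant both the dominant coefficient and
  the other two have explicit rates. The wedge \<open>1 - y \<le> x \<le> 1\<close> between them contains exactly one
  orbit that never leaves it, the separatrix, because inside the wedge two orbits move apart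
  backwards in time while the wedge closes up at \<open>(1, 0)\<close>. The exceptional set is the cone over this
  single orbit, and an orbit is a graph over \<open>y\<close> that is smooth because it solves a rational
  differential equation; no invariant manifold theorem is needed.
\<close>

section \<open>Ordinary differential equations\<close>

text \<open>The constants come from one computation. Along a dominant coefficient \<open>X\<close>
  the backward equation is \<open>X' = 4/3 * X ^ 3\<close> to leading order, so
  \<open>1 / X ^ 2\<close> behaves like \<open>8/3 * (T - s)\<close>, and sqrt (3/8) is sqrt 6 / 4.
  If a single coefficient dominates, the ratio of the other two converges while their product is
  \<open>K / X\<close> for the constant \<open>K = A * B * C\<close>, which forces the exponent 1/4
  on both. If \<open>A\<close> and \<open>B\<close> blow up together, \<open>C = K / (A * B)\<close>
  behaves like \<open>8/3 * K * (T - s)\<close>, hence 32/3 for \<open>K = 4\<close>. The point (1,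
  0) is a saddle of the rescaled backward shape flow, with eigenvalues 1 and -1, and the exceptional
  orbit is its stable manifold. For the surface to cut \<open>Q\<close> in two, this orbit must be
  known over the whole range \<open>0 < y < 1\<close>; with the logit of \<open>y\<close> as
  independent variable it becomes a solution on the whole real line. A single function
  \<open>surface_offset\<close> decides the fate of every initial condition. The three behaviours
  exclude each other by their rates, so \<open>Q1\<close> and \<open>Q2\<close> are exactly its sign
  sets and the topological claims become statements about a graph.\<close>

lemma integral_exp_le:
  fixes g :: "real \<Rightarrow> 'a::euclidean_space"
  assumes "a \<le> t" "continuous_on {a..t} g" "k > 0"
    and bd: "\<And>s. s \<in> {a..t} \<Longrightarrow> norm (g s) \<le> M * exp (k * (s - a))" and "M \<ge> 0"
  shows "norm (integral {a..t} g) \<le> M / k * exp (k * (t - a))"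
proof -
  have FTC: "((\<lambda>s. M * exp (k * (s - a))) has_integral
      (M / k * exp (k * (t - a)) - M / k * exp (k * (a - a)))) {a..t}"
  proof (rule fundamental_theorem_of_calculus[OF assms(1)])
    fix s assume "s \<in> {a..t}"
    have "((\<lambda>s. M / k * exp (k * (s - a))) has_real_derivative M * exp (k * (s - a))) (at s within {a..t})"
      by (rule derivative_eq_intros refl | use \<open>k > 0\<close> in simp)+
    then show "((\<lambda>s. M / k * exp (k * (s - a))) has_vector_derivative M * exp (k * (s - a))) (at s within {a..t})"
      by (simp add: has_real_derivative_iff_has_vector_derivative)
  qed
  have "norm (integral {a..t} g) \<le> integral {a..t} (\<lambda>s. M * exp (k * (s - a)))"
    by (rule integral_norm_bound_integral)
       (use assms FTC in \<open>auto intro: integrable_continuous_real has_integral_integrable\<close>)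
  also have "\<dots> = M / k * exp (k * (t - a)) - M / k * exp (k * (a - a))"
    using FTC by (rule integral_unique)
  also have "\<dots> \<le> M / k * exp (k * (t - a))"
    using assms by simp
  finally show ?thesis .
qed

theorem picard_lindeloef_global:
  fixes f :: "real \<Rightarrow> 'a::euclidean_space \<Rightarrow> 'a"
  assumes ab: "a \<le> b" and cont: "continuous_on ({a..b} \<times> UNIV) (\<lambda>(t, x). f t x)"
    and L: "L \<ge> 0" "\<And>t x y. t \<in> {a..b} \<Longrightarrow> norm (f t x - f t y) \<le> L * norm (x - y)"
  obtains u where "u a = x0"
    "\<And>t. t \<in> {a..b} \<Longrightarrow> (u has_vector_derivative f t (u t)) (at t within {a..b})"
proof -
  \<comment> \<open>Integrating the weight \<open>exp (k * (s - a))\<close> gains a factor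
    \<open>1 / k\<close>, so the contraction constant will be \<open>L / k\<close>, at most 1/2; the
    summand 1 keeps \<open>k\<close> positive when \<open>L = 0\<close>.\<close>
  define k where "k = 2 * L + 1"
  have k: "k > 0" "L / k \<le> 1/2" using L by (auto simp: k_def field_simps)
  \<comment> \<open>Clamping time to \<open>{a..b}\<close> turns functions on the interval into
    bounded continuous functions on the line, the complete space in which the fixed point is
    sought.\<close>
  define cl where "cl t = max a (min b t)" for t
  have cl: "cl t \<in> {a..b}" "t \<in> {a..b} \<Longrightarrow> cl t = t" for t using ab by (auto simp: cl_def)
  have cl_cont: "continuous_on S cl" for S unfolding cl_def by (intro continuous_intros)
  define F where "F v s = f s (exp (k * (s - a)) *\<^sub>R v s)" for v :: "real \<Rightarrow> 'a" and s
  have F_cont: "continuous_on {a..b} (F v)" if "continuous_on UNIV v" for v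
  proof -
    have "continuous_on {a..b} (\<lambda>s. (s, exp (k * (s - a)) *\<^sub>R v s))"
      by (intro continuous_intros continuous_on_subset[OF that]) auto
    from continuous_on_compose2[OF cont this] show ?thesis by (auto simp: F_def[abs_def])
  qed
  define J where "J v t = x0 + integral {a..t} (F v)" for v t
  define P where "P v t = exp (- k * (cl t - a)) *\<^sub>R J v (cl t)" for v t
  have P_b: "P v \<in> bcontfun" if v: "continuous_on UNIV v" for v
  proof -
    have "continuous_on {a..b} (\<lambda>t. exp (- k * (t - a)) *\<^sub>R J v t)"
      unfolding J_def
      by (intro continuous_intros indefinite_integral_continuous_1 integrable_continuous_real F_cont v)
    then have c: "continuous_on {a..b} (\<lambda>t. exp (- k * (t - a)) *\<^sub>R J v t)" (is "continuous_on _ ?h") .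
    have "continuous_on UNIV (\<lambda>t. ?h (cl t))"
      by (rule continuous_on_compose2[OF c cl_cont]) (use cl in auto)
    moreover have "bounded (range (\<lambda>t. ?h (cl t)))"
    proof (rule bounded_subset)
      show "bounded (?h ` {a..b})" by (intro compact_imp_bounded compact_continuous_image c) auto
      show "range (\<lambda>t. ?h (cl t)) \<subseteq> ?h ` {a..b}" using cl by auto
    qed
    ultimately show ?thesis by (simp add: bcontfun_def P_def[abs_def])
  qed
  \<comment> \<open>\<open>v\<close> stands for the solution times \<open>exp (- k (t - a))\<close>; this weight turns the Picard operator
    into a contraction on the whole interval.\<close>
  define T where "T v = Bcontfun (P (apply_bcontfun v))" for v
  have T: "apply_bcontfun (T v) = P (apply_bcontfun v)" for v
    unfolding T_def by (rule Bcontfun_inverse[OF P_b]) auto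
  have lip: "dist (T v) (T w) \<le> 1/2 * dist v w" for v w
  proof (rule dist_bound)
    fix t
    let ?t = "cl t"
    have t: "a \<le> ?t" "{a..?t} \<subseteq> {a..b}" using cl(1)[of t] by auto
    have Fv: "continuous_on {a..?t} (F (apply_bcontfun v))" for v
      by (rule continuous_on_subset[OF F_cont t(2)]) auto
    have "norm (J v ?t - J w ?t) = norm (integral {a..?t} (\<lambda>s. F v s - F w s))"
      unfolding J_def by (subst integral_diff) (auto intro: integrable_continuous_real Fv)
    also have "\<dots> \<le> (L * dist v w) / k * exp (k * (?t - a))"
    proof (rule integral_exp_le)
      fix s assume s: "s \<in> {a..?t}"
      have "norm (F v s - F w s) \<le> L * norm (exp (k * (s - a)) *\<^sub>R v s - exp (k * (s - a)) *\<^sub>R w s)"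
        unfolding F_def using s t by (intro L) auto
      also have "\<dots> = L * (exp (k * (s - a)) * dist (v s) (w s))"
        by (simp add: scaleR_diff_right[symmetric] dist_norm)
      also have "\<dots> \<le> L * (exp (k * (s - a)) * dist v w)"
        by (intro mult_left_mono dist_bounded L) auto
      finally show "norm (F v s - F w s) \<le> L * dist v w * exp (k * (s - a))" by (simp add: mult_ac)
    qed (use t k L Fv in \<open>auto intro!: continuous_intros\<close>)
    finally have *: "norm (J v ?t - J w ?t) \<le> (L * dist v w) / k * exp (k * (?t - a))" .
    have "dist (T v t) (T w t) = exp (- k * (?t - a)) * norm (J v ?t - J w ?t)"
      unfolding T P_def dist_norm by (simp add: scaleR_diff_right[symmetric])
    also have "\<dots> \<le> exp (- k * (?t - a)) * ((L * dist v w) / k * exp (k * (?t - a)))"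
      by (intro mult_left_mono *) auto
    also have "\<dots> = L / k * dist v w * (exp (- k * (?t - a)) * exp (k * (?t - a)))"
      by (simp add: mult_ac)
    also have "exp (- k * (?t - a)) * exp (k * (?t - a)) = 1" by (simp add: mult_exp_exp)
    finally have "dist (T v t) (T w t) \<le> L / k * dist v w" by simp
    also have "\<dots> \<le> 1/2 * dist v w" by (intro mult_right_mono k) auto
    finally show "dist (T v t) (T w t) \<le> 1/2 * dist v w" .
  qed
  then obtain v where v: "T v = v"
    using banach_fix_type[of "1/2" T] by auto
  define u where "u t = exp (k * (t - a)) *\<^sub>R v t" for t
  have u: "u t = J v t" if "t \<in> {a..b}" for t
  proof -
    have "v t = P v t" using v T by metis
    then show ?thesis using cl that by (simp add: u_def P_def exp_minus)
  qed
  have "u a = x0" using u[of a] ab by (simp add: J_def)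
  moreover have "(u has_vector_derivative f t (u t)) (at t within {a..b})" if t: "t \<in> {a..b}" for t
  proof -
    have "((\<lambda>t. integral {a..t} (F v)) has_vector_derivative F v t) (at t within {a..b})"
      by (rule integral_has_vector_derivative[OF F_cont t]) auto
    then have "(J v has_vector_derivative F v t) (at t within {a..b})"
      unfolding J_def[abs_def] by (auto intro!: derivative_eq_intros)
    then have "(u has_vector_derivative F v t) (at t within {a..b})"
      by (rule has_vector_derivative_transform[OF t u, rotated])
    then show ?thesis by (simp add: F_def u_def)
  qed
  ultimately show ?thesis using that by blast
qed

section \<open>Local existence and uniqueness for autonomous equations\<close>

definition lipschitz_on_balls :: "('a::euclidean_space \<Rightarrow> 'b::real_normed_vector) \<Rightarrow> bool" where
  "lipschitz_on_balls f \<longleftrightarrow>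
     (\<forall>R. \<exists>L\<ge>0. \<forall>x\<in>cball 0 R. \<forall>y\<in>cball 0 R. norm (f x - f y) \<le> L * norm (x - y))"

definition ode_solution ::
  "('a::euclidean_space \<Rightarrow> 'a) \<Rightarrow> ereal \<Rightarrow> ereal \<Rightarrow> (real \<Rightarrow> 'a) \<Rightarrow> bool" where
  "ode_solution f Tb Tf u \<longleftrightarrow>
     (\<forall>t\<in>time_interval Tb Tf. (u has_vector_derivative f (u t)) (at t))"

lemma within_nonneg_imp_le:
  fixes f :: "real \<Rightarrow> real"
  assumes "\<And>t. t \<in> {a..b} \<Longrightarrow> (f has_real_derivative f' t) (at t within {a..b})"
    and "\<And>t. t \<in> {a..b} \<Longrightarrow> f' t \<ge> 0" and "a \<le> s" "s \<le> t" "t \<le> b"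
  shows "f s \<le> f t"
proof (rule DERIV_nonneg_imp_increasing_open[of s t f])
  have "continuous_on {a..b} f"
    unfolding continuous_on_eq_continuous_within using assms(1) DERIV_continuous by blast
  then show "continuous_on {s..t} f"
    by (rule continuous_on_subset) (use assms in auto)
  fix x assume "s < x" "x < t"
  then have x: "a < x" "x < b" "x \<in> {a..b}" using assms(3-5) by auto
  then show "\<exists>y. DERIV f x :> y \<and> y \<ge> 0"
    using assms(1,2)[OF x(3)] at_within_Icc_at[OF x(1,2)] by auto
qed (use assms(4) in auto)

text \<open>The bound on the displacement will keep the solution of a truncated field inside the
  ball on which truncation changes nothing.\<close>

lemma picard_one_sided:
  fixes f :: "'a::euclidean_space \<Rightarrow> 'a"
  assumes L: "L \<ge> 0" "\<And>x y. norm (f x - f y) \<le> L * norm (x - y)" and M: "\<And>x. norm (f x) \<le> M"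
  obtains u where "u 0 = x0"
    "\<And>t. t \<in> {0..1} \<Longrightarrow> (u has_vector_derivative f (u t)) (at t within {0..1})"
    "\<And>t. t \<in> {0..1} \<Longrightarrow> norm (u t - x0) \<le> M * t"
proof -
  have "L-lipschitz_on UNIV f"
    using L by (auto simp: lipschitz_on_def dist_norm)
  then have "continuous_on UNIV f" by (rule lipschitz_on_continuous_on)
  then have c: "continuous_on ({0..1::real} \<times> UNIV) (\<lambda>(t, x). f x)"
    unfolding case_prod_beta by (rule continuous_on_compose2) (auto intro: continuous_intros)
  obtain u where u: "u 0 = x0" "\<And>t. t \<in> {0..1} \<Longrightarrow> (u has_vector_derivative f (u t)) (at t within {0..1})"
  proof (rule picard_lindeloef_global[of 0 1 "\<lambda>t. f" L x0])
  qed (use c L in auto)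
  have "norm (u t - u 0) \<le> M * norm (t - 0)" if "t \<in> {0..1}" for t
  proof (rule differentiable_bound)
    show "(u has_derivative (\<lambda>h. h *\<^sub>R f (u s))) (at s within {0..1})" if "s \<in> {0..1}" for s
      using u(2)[OF that] by (simp add: has_vector_derivative_def)
    have "M \<ge> 0" using M norm_ge_zero order_trans by blast
    then show "onorm (\<lambda>h. h *\<^sub>R f (u s)) \<le> M" for s
      by (intro onorm_bound) (auto simp: mult.commute[of M] intro!: mult_left_mono M)
  qed (use that in auto)
  with u that show ?thesis by auto
qed

text \<open>Composing the field with the projection onto the ball of radius \<open>R + 1\<close>
  makes it bounded and globally Lipschitz, and a solution of speed at most \<open>M\<close> that
  starts in the ball of radius \<open>R\<close> stays in the larger ball up to time
  \<open>1 / M\<close>. The step \<open>e\<close> depends on \<open>R\<close> alone; this uniformity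
  is what makes continuation of bounded solutions possible.\<close>

theorem picard_lindeloef_local:
  fixes f :: "'a::euclidean_space \<Rightarrow> 'a"
  assumes "lipschitz_on_balls f"
  obtains e where "e > 0"
    "\<And>x0 t0. norm x0 \<le> R \<Longrightarrow>
       \<exists>u. u t0 = x0 \<and> (\<forall>t\<in>{t0 - e<..<t0 + e}. (u has_vector_derivative f (u t)) (at t))"
proof (cases "R \<ge> 0")
  case False
  then have "\<not> norm x \<le> R" for x :: 'a using norm_ge_zero order_trans by blast
  then show ?thesis using that[of 1] by auto
next
  case R: True
  define B where "B = cball (0::'a) (R + 1)"
  have B: "convex B" "closed B" "B \<noteq> {}" using R by (auto simp: B_def)
  obtain L where L: "L \<ge> 0" "\<And>x y. x \<in> B \<Longrightarrow> y \<in> B \<Longrightarrow> norm (f x - f y) \<le> L * norm (x - y)"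
    using assms unfolding lipschitz_on_balls_def B_def by meson
  define M where "M = norm (f 0) + L * (R + 1) + 1"
  have M: "M > 0" using L R by (auto simp: M_def intro!: add_nonneg_pos add_nonneg_nonneg)
  define g where "g x = f (closest_point B x)" for x
  have g_lip: "norm (g x - g y) \<le> L * norm (x - y)" for x y
  proof -
    have "norm (g x - g y) \<le> L * norm (closest_point B x - closest_point B y)"
      unfolding g_def by (intro L closest_point_in_set B)
    also have "\<dots> \<le> L * norm (x - y)"
      using closest_point_lipschitz[OF B(1,2,3), of x y] by (intro mult_left_mono L) (auto simp: dist_norm)
    finally show ?thesis .
  qed
  have g_bd: "norm (g x) \<le> M" for x
  proof -
    have "closest_point B x \<in> B" by (intro closest_point_in_set B)
    moreover have "0 \<in> B" using R by (simp add: B_def)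
    ultimately have "norm (g x - f 0) \<le> L * norm (closest_point B x - 0)"
      unfolding g_def by (intro L)
    also have "\<dots> \<le> L * (R + 1)"
      using \<open>closest_point B x \<in> B\<close> by (intro mult_left_mono L) (auto simp: B_def)
    finally show ?thesis using norm_triangle_ineq2[of "g x" "f 0"] by (simp add: M_def)
  qed
  define e where "e = min 1 (1 / M)"
  have e: "e > 0" "e \<le> 1" "\<And>t. t \<le> e \<Longrightarrow> M * t \<le> 1" using M
    by (auto simp: e_def le_divide_eq mult.commute)
  have "\<exists>w. w t0 = x0 \<and> (\<forall>t\<in>{t0 - e<..<t0 + e}. (w has_vector_derivative f (w t)) (at t))"
    if x0: "norm x0 \<le> R" for x0 t0
  proof -
    obtain u where u: "u 0 = x0"
      "\<And>t. t \<in> {0..1} \<Longrightarrow> (u has_vector_derivative g (u t)) (at t within {0..1})"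
      "\<And>t. t \<in> {0..1} \<Longrightarrow> norm (u t - x0) \<le> M * t"
      using picard_one_sided[of L g M x0] L(1) g_lip g_bd by blast
    obtain v where v: "v 0 = x0"
      "\<And>t. t \<in> {0..1} \<Longrightarrow> (v has_vector_derivative - g (v t)) (at t within {0..1})"
      "\<And>t. t \<in> {0..1} \<Longrightarrow> norm (v t - x0) \<le> M * t"
      using picard_one_sided[of L "\<lambda>x. - g x" M x0] L(1) g_lip g_bd
      by (smt (verit) norm_minus_cancel norm_minus_commute uminus_add_conv_diff diff_minus_eq_add)
    have gf: "g y = f y" if "norm (y - x0) \<le> M * t" "t \<le> e" for y t
    proof -
      have "norm y \<le> R + 1"
        using norm_triangle_ineq2[of y x0] that e(3)[of t] x0 by linarith
      then show ?thesis by (simp add: g_def closest_point_self B_def)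
    qed
    \<comment> \<open>The past is the forward solution of the reversed field \<open>- g\<close>,
      reflected. Both halves meet at 0 with the same value and the same one-sided
      derivative.\<close>
    define w where "w t = (if t \<in> {-1..0} then v (- t) else u t)" for t
    have vm: "((\<lambda>t. v (- t)) has_vector_derivative g (v (- t))) (at t within {-1..0})"
      if "t \<in> {-1..0}" for t
    proof -
      have "(v has_vector_derivative - g (v (- t))) (at (- t) within uminus ` {-1..0})"
        using v(2)[of "- t"] that by simp
      then have "((v \<circ> uminus) has_vector_derivative (-1) *\<^sub>R (- g (v (- t)))) (at t within {-1..0})"
        by (intro vector_diff_chain_within) (auto intro!: derivative_eq_intros)
      then show ?thesis by (simp add: o_def)
    qed
    have w: "(w has_vector_derivative g (w t)) (at t within {-1..1})" if "t \<in> {-1..1}" for t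
    proof -
      have "((\<lambda>t. if t \<in> {-1..0} then v (- t) else u t) has_vector_derivative
              (if t \<in> {-1..0} then g (v (- t)) else g (u t))) (at t within {-1..1})"
      proof (rule has_vector_derivative_If_within_closures[where T = "{0..1}"])
        show "t \<in> {- 1..0} \<union> (closure {- 1..0} \<inter> closure {0..1}) \<Longrightarrow>
          ((\<lambda>x. v (- x)) has_vector_derivative g (v (- t))) (at t within {- 1..0} \<union> (closure {- 1..0} \<inter> closure {0..1}))"
          using vm[of t] by (auto simp: insert_absorb Un_absorb2)
        show "t \<in> {0..1} \<union> (closure {- 1..0} \<inter> closure {0..1}) \<Longrightarrow>
          (u has_vector_derivative g (u t)) (at t within {0..1} \<union> (closure {- 1..0} \<inter> closure {0..1}))"
          using u(2)[of t] by (auto simp: insert_absorb Un_absorb2)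
      qed (use that u(1) v(1) in auto)
      moreover have "(if t \<in> {-1..0} then g (v (- t)) else g (u t)) = g (w t)" by (simp add: w_def)
      ultimately show ?thesis unfolding w_def[abs_def, symmetric] by simp
    qed
    have w_f: "(w has_vector_derivative f (w t)) (at t)" if t: "t \<in> {-e<..<e}" for t
    proof -
      have "g (w t) = f (w t)"
      proof (cases "t \<le> 0")
        case True then show ?thesis using gf[of "v (-t)" "-t"] v(3)[of "-t"] e(2) t by (simp add: w_def)
      next
        case False then show ?thesis using gf[of "u t" "t"] u(3)[of "t"] e(2) t by (simp add: w_def)
      qed
      moreover have "(w has_vector_derivative g (w t)) (at t)"
        using w[of t] t e(2) by (simp add: at_within_Icc_at)
      ultimately show ?thesis by simp
    qed
    have "((\<lambda>t. w (t - t0)) has_vector_derivative f (w (t - t0))) (at t)" if "t \<in> {t0 - e<..<t0 + e}" for t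
    proof -
      have "((w \<circ> (\<lambda>t. t - t0)) has_vector_derivative 1 *\<^sub>R f (w (t - t0))) (at t)"
        by (rule vector_diff_chain_at) (use that in \<open>auto intro!: derivative_eq_intros w_f\<close>)
      then show ?thesis by (simp add: o_def)
    qed
    moreover have "w (t0 - t0) = x0" using v(1) by (simp add: w_def)
    ultimately show ?thesis by (intro exI[of _ "\<lambda>t. w (t - t0)"]) auto
  qed
  with e(1) that show ?thesis by blast
qed

text \<open>Gronwall's argument for the squared distance \<open>E\<close>: from
  \<open>\<bar>D s\<bar> \<le> 2 * L * E s\<close> it follows that
  \<open>E s * exp (- 2 * L * s)\<close> is nonincreasing and \<open>E s * exp (2 * L * s)\<close>
  nondecreasing. The first propagates agreement to the right, the second to the left.\<close>

theorem ode_unique: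
  fixes f :: "'a::euclidean_space \<Rightarrow> 'a"
  assumes f: "lipschitz_on_balls f"
    and u: "\<And>t. t \<in> {a..b} \<Longrightarrow> (u has_vector_derivative f (u t)) (at t within {a..b})"
    and v: "\<And>t. t \<in> {a..b} \<Longrightarrow> (v has_vector_derivative f (v t)) (at t within {a..b})"
    and eq: "u a = v a \<or> u b = v b" and t: "t \<in> {a..b}"
  shows "u t = v t"
proof -
  have "continuous_on {a..b} u" "continuous_on {a..b} v"
    unfolding continuous_on_eq_continuous_within
    using has_vector_derivative_continuous u v by blast+
  then have "bounded (u ` {a..b} \<union> v ` {a..b})"
    by (intro compact_imp_bounded compact_Un compact_continuous_image) auto
  then obtain R where R: "\<And>s. s \<in> {a..b} \<Longrightarrow> norm (u s) \<le> R" "\<And>s. s \<in> {a..b} \<Longrightarrow> norm (v s) \<le> R"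
    unfolding bounded_iff ball_Un ball_simps by blast
  obtain L where L: "L \<ge> 0" "\<And>x y. norm x \<le> R \<Longrightarrow> norm y \<le> R \<Longrightarrow> norm (f x - f y) \<le> L * norm (x - y)"
    using f unfolding lipschitz_on_balls_def by (metis mem_cball_0)
  define E where "E s = (u s - v s) \<bullet> (u s - v s)" for s
  define D where "D s = 2 * ((u s - v s) \<bullet> (f (u s) - f (v s)))" for s
  have E': "(E has_real_derivative D s) (at s within {a..b})" if "s \<in> {a..b}" for s
  proof -
    have "((\<lambda>s. (u s - v s) \<bullet> (u s - v s)) has_derivative
        (\<lambda>h. (u s - v s) \<bullet> (h *\<^sub>R (f (u s) - f (v s))) + (h *\<^sub>R (f (u s) - f (v s))) \<bullet> (u s - v s)))
        (at s within {a..b})"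
      using u[OF that] v[OF that] unfolding has_vector_derivative_def
      by (auto intro!: derivative_eq_intros simp: scaleR_diff_right)
    moreover have "(\<lambda>h. (u s - v s) \<bullet> (h *\<^sub>R (f (u s) - f (v s))) + (h *\<^sub>R (f (u s) - f (v s))) \<bullet> (u s - v s))
        = (*) (D s)"
      by (rule ext) (simp add: D_def inner_commute)
    ultimately show ?thesis by (simp only: E_def[abs_def] has_field_derivative_def)
  qed
  have D: "\<bar>D s\<bar> \<le> 2 * L * E s" if "s \<in> {a..b}" for s
  proof -
    have "\<bar>D s\<bar> \<le> 2 * (norm (u s - v s) * norm (f (u s) - f (v s)))"
      unfolding D_def using Cauchy_Schwarz_ineq2[of "u s - v s" "f (u s) - f (v s)"] by simp
    also have "\<dots> \<le> 2 * (norm (u s - v s) * (L * norm (u s - v s)))"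
      by (intro mult_left_mono L R that) auto
    also have "\<dots> = 2 * L * E s" by (simp add: E_def dot_square_norm power2_eq_square)
    finally show ?thesis .
  qed
  have E0: "E s \<ge> 0" for s by (simp add: E_def)
  have "E t \<le> 0" using eq
  proof
    assume "u a = v a"
    have "- E a * exp (- 2 * L * a) \<le> - E t * exp (- 2 * L * t)"
    proof (rule within_nonneg_imp_le[where f = "\<lambda>s. - E s * exp (- 2 * L * s)" and
          f' = "\<lambda>s. - D s * exp (- 2 * L * s) + - E s * (exp (- 2 * L * s) * (- 2 * L))"])
      fix s assume s: "s \<in> {a..b}"
      show "((\<lambda>s. - E s * exp (- 2 * L * s)) has_real_derivative
          - D s * exp (- 2 * L * s) + - E s * (exp (- 2 * L * s) * (- 2 * L))) (at s within {a..b})"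
        by (rule derivative_eq_intros E'[OF s] refl | simp)+
      have "(2 * L * E s - D s) * exp (- 2 * L * s) \<ge> 0"
        using D[OF s] by (intro mult_nonneg_nonneg) auto
      then show "- D s * exp (- 2 * L * s) + - E s * (exp (- 2 * L * s) * (- 2 * L)) \<ge> 0"
        by (simp add: algebra_simps)
    qed (use t in auto)
    then show ?thesis using \<open>u a = v a\<close> by (simp add: E_def[of a] zero_le_mult_iff mult_le_0_iff)
  next
    assume "u b = v b"
    have "E t * exp (2 * L * t) \<le> E b * exp (2 * L * b)"
    proof (rule within_nonneg_imp_le[where f = "\<lambda>s. E s * exp (2 * L * s)" and
          f' = "\<lambda>s. D s * exp (2 * L * s) + E s * (exp (2 * L * s) * (2 * L))"])
      fix s assume s: "s \<in> {a..b}"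
      show "((\<lambda>s. E s * exp (2 * L * s)) has_real_derivative
          D s * exp (2 * L * s) + E s * (exp (2 * L * s) * (2 * L))) (at s within {a..b})"
        by (rule derivative_eq_intros E'[OF s] refl | simp)+
      have "(2 * L * E s + D s) * exp (2 * L * s) \<ge> 0"
        using D[OF s] by (intro mult_nonneg_nonneg) auto
      then show "D s * exp (2 * L * s) + E s * (exp (2 * L * s) * (2 * L)) \<ge> 0"
        by (simp add: algebra_simps)
    qed (use t in auto)
    then show ?thesis using \<open>u b = v b\<close> by (simp add: E_def[of b] mult_le_0_iff)
  qed
  with E0[of t] have "E t = 0" by simp
  then show ?thesis by (simp add: E_def)
qed

section \<open>Maximal solutions and their continuation\<close>

lemma time_interval_iff: "t \<in> time_interval Tb Tf \<longleftrightarrow> - Tb < ereal t \<and> ereal t < Tf"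
  by (simp add: time_interval_def)

lemma open_time_interval: "open (time_interval Tb Tf)"
proof -
  have "time_interval Tb Tf = ereal -` {- Tb<..<Tf}" by (auto simp: time_interval_def)
  then show ?thesis by (simp add: open_ereal_vimage)
qed

lemma time_interval_convex:
  "s \<in> time_interval Tb Tf \<Longrightarrow> t \<in> time_interval Tb Tf \<Longrightarrow> {s..t} \<subseteq> time_interval Tb Tf"
  by (cases Tb; cases Tf) (auto simp: time_interval_iff)

lemma zero_in_time_interval: "0 \<in> time_interval Tb Tf \<longleftrightarrow> 0 < Tb \<and> 0 < Tf"
  by (cases Tb; cases Tf) (auto simp: time_interval_iff)

lemma ode_solution_unique:
  assumes f: "lipschitz_on_balls f" and "ode_solution f Tb Tf u" "ode_solution f Tb' Tf' v"
    and eq: "u t0 = v t0" and "t0 \<in> time_interval Tb Tf" "t0 \<in> time_interval Tb' Tf'"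
    and "t \<in> time_interval Tb Tf" "t \<in> time_interval Tb' Tf'"
  shows "u t = v t"
proof -
  define a b where "a = min t0 t" and "b = max t0 t"
  have "{a..b} \<subseteq> time_interval Tb Tf" "{a..b} \<subseteq> time_interval Tb' Tf'"
    using assms(5-8) time_interval_convex by (auto simp: a_def b_def min_def max_def)
  then have "(u has_vector_derivative f (u s)) (at s within {a..b})"
    "(v has_vector_derivative f (v s)) (at s within {a..b})" if "s \<in> {a..b}" for s
    using assms(2,3) that unfolding ode_solution_def by (blast intro: has_vector_derivative_at_within)+
  then show ?thesis
    by (rule ode_unique[OF f, of a b u v t]) (auto simp: a_def b_def eq min_def max_def)
qed

lemma ode_solution_transform:
  assumes "open S" "t \<in> S" "\<And>s. s \<in> S \<Longrightarrow> u s = v s" "(u has_vector_derivative f (u t)) (at t)"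
  shows "(v has_vector_derivative f (v t)) (at t)"
  using has_vector_derivative_transform_within_open[OF assms(4,1,2,3)] assms(2,3) by simp

text \<open>All solutions through \<open>x0\<close> are glued together; uniqueness makes them agree
  on overlaps. The two endpoints are separate suprema, possibly approached by different solutions,
  but a given \<open>t\<close> only asks for a solution reaching beyond it on its own side of 0. The
  comparison obtained here is endpoint by endpoint, which is stronger than having no proper
  extension.\<close>

theorem maximal_ode_solution_exists:
  fixes f :: "'a::euclidean_space \<Rightarrow> 'a"
  assumes f: "lipschitz_on_balls f"
  obtains Tb Tf u where "0 < Tb" "0 < Tf" "u 0 = x0" "ode_solution f Tb Tf u"
    "\<And>Tb' Tf' v. 0 < Tb' \<Longrightarrow> 0 < Tf' \<Longrightarrow> v 0 = x0 \<Longrightarrow> ode_solution f Tb' Tf' v \<Longrightarrow> Tb' \<le> Tb \<and> Tf' \<le> Tf"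
proof -
  define S where "S = {(Tb, Tf, v). 0 < Tb \<and> 0 < Tf \<and> v 0 = x0 \<and> ode_solution f Tb Tf v}"
  define Tb where "Tb = (SUP p\<in>S. fst p)"
  define Tf where "Tf = (SUP p\<in>S. fst (snd p))"
  have le: "Tb' \<le> Tb" "Tf' \<le> Tf" if "(Tb', Tf', v) \<in> S" for Tb' Tf' v
    using that by (auto simp: Tb_def Tf_def intro!: SUP_upper2)
  obtain e where e: "e > 0" and
    "\<exists>u. u 0 = x0 \<and> (\<forall>t\<in>{0 - e<..<0 + e}. (u has_vector_derivative f (u t)) (at t))"
    by (rule picard_lindeloef_local[OF f, of "norm x0"]) blast
  then obtain u0 where "u0 0 = x0" "\<forall>t\<in>{0 - e<..<0 + e}. (u0 has_vector_derivative f (u0 t)) (at t)"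
    by blast
  then have "(ereal e, ereal e, u0) \<in> S"
    using e by (auto simp: S_def ode_solution_def time_interval_iff)
  with e le[of "ereal e" "ereal e" u0] have pos: "0 < Tb" "0 < Tf"
    by (auto simp: less_le_trans[of 0 "ereal e"])
  have ex: "\<exists>p\<in>S. t \<in> time_interval (fst p) (fst (snd p))" if t: "t \<in> time_interval Tb Tf" for t
  proof (cases "t \<ge> 0")
    case True
    from t have "ereal t < Tf" by (simp add: time_interval_iff)
    then obtain p where p: "p \<in> S" "ereal t < fst (snd p)" unfolding Tf_def less_SUP_iff by blast
    moreover from p have "0 < fst p" by (auto simp: S_def)
    then have "- fst p < ereal t" using True by (cases "fst p") auto
    ultimately show ?thesis by (auto simp: time_interval_iff)
  next
    case False
    from t have "ereal (- t) < Tb" by (cases Tb) (auto simp: time_interval_iff)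
    then obtain p where p: "p \<in> S" "ereal (- t) < fst p" unfolding Tb_def less_SUP_iff by blast
    moreover from p have "0 < fst (snd p)" by (auto simp: S_def)
    then have "ereal t < fst (snd p)" using False by (cases "fst (snd p)") auto
    moreover have "- fst p < ereal t" using p(2) by (cases "fst p") auto
    ultimately show ?thesis by (auto simp: time_interval_iff)
  qed
  define P where "P t = (SOME p. p \<in> S \<and> t \<in> time_interval (fst p) (fst (snd p)))" for t
  define u where "u t = snd (snd (P t)) t" for t
  have P: "P t \<in> S \<and> t \<in> time_interval (fst (P t)) (fst (snd (P t)))" if "t \<in> time_interval Tb Tf" for t
    unfolding P_def by (rule someI_ex) (use ex[OF that] in blast)
  have u: "u t = v t" if "(Tb', Tf', v) \<in> S" "t \<in> time_interval Tb' Tf'" for Tb' Tf' v t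
  proof -
    have "t \<in> time_interval Tb Tf" 
      using that(2) le[OF that(1)] unfolding time_interval_iff
      by (meson ereal_minus_le_minus le_less_trans less_le_trans)
    note * = P[OF this]
    obtain Tb1 Tf1 w where w: "P t = (Tb1, Tf1, w)" by (cases "P t") auto
    have "w t = v t"
      by (rule ode_solution_unique[OF f, of Tb1 Tf1 w Tb' Tf' v 0])
         (use * that w in \<open>simp_all add: S_def zero_in_time_interval\<close>)
    then show ?thesis by (simp add: u_def w)
  qed
  have "u 0 = x0" using u[OF \<open>(ereal e, ereal e, u0) \<in> S\<close>, of 0] e \<open>u0 0 = x0\<close>
    by (simp add: zero_in_time_interval)
  moreover have "ode_solution f Tb Tf u" unfolding ode_solution_def
  proof
    fix t assume "t \<in> time_interval Tb Tf"
    from ex[OF this] obtain Tb' Tf' v where p: "(Tb', Tf', v) \<in> S" "t \<in> time_interval Tb' Tf'" by auto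
    show "(u has_vector_derivative f (u t)) (at t)"
      by (rule ode_solution_transform[OF open_time_interval p(2) u[OF p(1), symmetric]])
         (use p in \<open>auto simp: S_def ode_solution_def\<close>)
  qed
  moreover have "Tb' \<le> Tb \<and> Tf' \<le> Tf"
    if "0 < Tb'" "0 < Tf'" "v 0 = x0" "ode_solution f Tb' Tf' v" for Tb' Tf' v
    using le[of Tb' Tf' v] that by (auto simp: S_def)
  ultimately show ?thesis using pos that by blast
qed

text \<open>A bound on the solution makes the existence step \<open>e\<close> uniform, so restarting
  closer than \<open>e\<close> to the left endpoint yields a solution that reaches past it and
  coincides with the old one by uniqueness.\<close>

theorem bounded_ode_solution_extends:
  fixes f :: "'a::euclidean_space \<Rightarrow> 'a"
  assumes f: "lipschitz_on_balls f" and u: "ode_solution f (ereal T) Tf u" and T: "0 < T" "0 < Tf"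
    and bd: "\<And>t. t \<in> {-T<..0} \<Longrightarrow> norm (u t) \<le> R"
  obtains T' v where "T' > T" "ode_solution f (ereal T') Tf v"
    "\<And>t. t \<in> time_interval (ereal T) Tf \<Longrightarrow> v t = u t"
proof -
  obtain e where e: "e > 0" "\<And>x0 t0. norm x0 \<le> R \<Longrightarrow>
       \<exists>u. u t0 = x0 \<and> (\<forall>t\<in>{t0 - e<..<t0 + e}. (u has_vector_derivative f (u t)) (at t))"
    by (rule picard_lindeloef_local[OF f, of R]) blast
  \<comment> \<open>Halving \<open>e\<close> makes the restart reach strictly beyond
    \<open>-T\<close>; the cap at \<open>T\<close> keeps \<open>t0\<close> nonpositive, where the
    bound on \<open>u\<close> is available.\<close>
  define d where "d = min (e / 2) T"
  define t0 where "t0 = d - T"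
  have d: "0 < d" "d < e" "d \<le> T" using e T by (auto simp: d_def)
  then have t0: "t0 \<in> {-T<..0}" by (auto simp: t0_def)
  obtain w where w: "w t0 = u t0"
    "\<And>t. t \<in> {t0 - e<..<t0 + e} \<Longrightarrow> (w has_vector_derivative f (w t)) (at t)"
    using e(2)[OF bd[OF t0], of t0] by blast
  define T' where "T' = e - t0"
  define v where "v t = (if t \<le> t0 then w t else u t)" for t
  have in_I: "t \<in> time_interval (ereal T) Tf" if "-T < t" "t \<le> t0" for t
    using that T t0 by (cases Tf) (auto simp: time_interval_iff)
  have w_sol: "ode_solution f (ereal T') (ereal (t0 + e)) w"
    using w(2) by (auto simp: ode_solution_def time_interval_iff T'_def)
  have vu: "v t = u t" if "-T < t" for t
  proof (cases "t \<le> t0")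
    case True
    have "w t = u t"
      by (rule ode_solution_unique[OF f w_sol u, of t0])
         (use w in_I True that t0 e d in \<open>auto simp: time_interval_iff T'_def t0_def\<close>)
    then show ?thesis using True by (simp add: v_def)
  qed (simp add: v_def)
  have "T' > T" using d by (simp add: T'_def t0_def)
  moreover have "ode_solution f (ereal T') Tf v" unfolding ode_solution_def
  proof
    fix t assume t: "t \<in> time_interval (ereal T') Tf"
    show "(v has_vector_derivative f (v t)) (at t)"
    proof (cases "-T < t")
      case True
      have "(u has_vector_derivative f (u t)) (at t)"
        using u t True by (auto simp: ode_solution_def time_interval_iff)
      then show ?thesis
        by (intro ode_solution_transform[of "{-T<..}" t u v]) (use True vu in auto)
    next
      case False
      then have "t < t0" using d by (auto simp: t0_def)
      have "(w has_vector_derivative f (w t)) (at t)"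
        by (rule w(2)) (use t False d in \<open>auto simp: time_interval_iff T'_def t0_def\<close>)
      then show ?thesis
        by (intro ode_solution_transform[of "{..<t0}" t w v]) (use \<open>t < t0\<close> in \<open>auto simp: v_def\<close>)
    qed
  qed
  moreover have "v t = u t" if "t \<in> time_interval (ereal T) Tf" for t
    using vu that by (auto simp: time_interval_iff)
  ultimately show ?thesis using that by blast
qed

section \<open>Solutions of the flow\<close>

lemma lipschitz_on_ballsI:
  assumes "L \<ge> 0" "\<And>x y. norm (f x - f y) \<le> L * norm (x - y)"
  shows "lipschitz_on_balls f"
  unfolding lipschitz_on_balls_def
  by (rule allI, rule exI[of _ L]) (simp add: assms)

lemma lipschitz_on_balls_linear:
  assumes f: "bounded_linear f"
  shows "lipschitz_on_balls f"
proof -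
  obtain K where "K \<ge> 0" "\<And>x. norm (f x) \<le> norm x * K"
    using bounded_linear.nonneg_bounded[OF f] by blast
  moreover have "f x - f y = f (x - y)" for x y
    by (simp add: linear_diff[OF bounded_linear.linear[OF f]])
  ultimately have "norm (f x - f y) \<le> K * norm (x - y)" for x y
    by (simp add: mult.commute[of K])
  with \<open>K \<ge> 0\<close> show ?thesis by (rule lipschitz_on_ballsI)
qed

lemma lipschitz_on_balls_const: "lipschitz_on_balls (\<lambda>_. c)"
  by (rule lipschitz_on_ballsI[of 0]) simp_all

lemma lipschitz_on_balls_add:
  assumes "lipschitz_on_balls f" "lipschitz_on_balls g"
  shows "lipschitz_on_balls (\<lambda>x. f x + g x)"
  unfolding lipschitz_on_balls_def
proof
  fix R
  obtain L where "L \<ge> 0"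
    and L: "\<forall>x\<in>cball 0 R. \<forall>y\<in>cball 0 R. norm (f x - f y) \<le> L * norm (x - y)"
    using assms(1) unfolding lipschitz_on_balls_def by blast
  obtain M where "M \<ge> 0"
    and M: "\<forall>x\<in>cball 0 R. \<forall>y\<in>cball 0 R. norm (g x - g y) \<le> M * norm (x - y)"
    using assms(2) unfolding lipschitz_on_balls_def by blast
  note LM = \<open>L \<ge> 0\<close> \<open>M \<ge> 0\<close>
  have "norm (f x + g x - (f y + g y)) \<le> (L + M) * norm (x - y)" if "x \<in> cball 0 R" "y \<in> cball 0 R" for x y
  proof -
    have "norm (f x - f y) \<le> L * norm (x - y)" "norm (g x - g y) \<le> M * norm (x - y)"
      using L M that by blast+
    then show ?thesis
      using norm_diff_triangle_ineq[of "f x" "g x" "f y" "g y"] by (simp add: distrib_right)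
  qed
  then show "\<exists>L\<ge>0. \<forall>x\<in>cball 0 R. \<forall>y\<in>cball 0 R. norm (f x + g x - (f y + g y)) \<le> L * norm (x - y)"
    using \<open>L \<ge> 0\<close> \<open>M \<ge> 0\<close> by (intro exI[of _ "L + M"]) auto
qed

lemma lipschitz_on_balls_mult:
  fixes f g :: "'a::euclidean_space \<Rightarrow> real"
  assumes "lipschitz_on_balls f" "lipschitz_on_balls g"
  shows "lipschitz_on_balls (\<lambda>x. f x * g x)"
  unfolding lipschitz_on_balls_def
proof
  fix R
  obtain L where "L \<ge> 0"
    and L: "\<forall>x\<in>cball 0 R. \<forall>y\<in>cball 0 R. norm (f x - f y) \<le> L * norm (x - y)"
    using assms(1) unfolding lipschitz_on_balls_def by blast
  obtain M where "M \<ge> 0"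
    and M: "\<forall>x\<in>cball 0 R. \<forall>y\<in>cball 0 R. norm (g x - g y) \<le> M * norm (x - y)"
    using assms(2) unfolding lipschitz_on_balls_def by blast
  note LM = \<open>L \<ge> 0\<close> \<open>M \<ge> 0\<close>
  define F where "F = \<bar>f 0\<bar> + L * \<bar>R\<bar>"
  define G where "G = \<bar>g 0\<bar> + M * \<bar>R\<bar>"
  have FG: "F \<ge> 0" "G \<ge> 0" using LM by (auto simp: F_def G_def)
  have bd: "\<bar>f x\<bar> \<le> F" "\<bar>g x\<bar> \<le> G" if "x \<in> cball 0 R" for x
  proof -
    have x: "norm x \<le> \<bar>R\<bar>" "0 \<in> cball (0::'a) R"
      using that order_trans[OF norm_ge_zero[of x], of R] by auto
    have "\<bar>f x - f 0\<bar> \<le> L * norm x" "\<bar>g x - g 0\<bar> \<le> M * norm x"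
      using L[rule_format, OF that x(2)] M[rule_format, OF that x(2)] by auto
    moreover have "L * norm x \<le> L * \<bar>R\<bar>" "M * norm x \<le> M * \<bar>R\<bar>" using LM x by (auto intro: mult_left_mono)
    ultimately show "\<bar>f x\<bar> \<le> F" "\<bar>g x\<bar> \<le> G" unfolding F_def G_def by linarith+
  qed
  have "norm (f x * g x - f y * g y) \<le> (F * M + G * L) * norm (x - y)"
    if xy: "x \<in> cball 0 R" "y \<in> cball 0 R" for x y
  proof -
    have "\<bar>f x * g x - f y * g y\<bar> = \<bar>f x * (g x - g y) + g y * (f x - f y)\<bar>" by (simp add: algebra_simps)
    also have "\<dots> \<le> \<bar>f x\<bar> * \<bar>g x - g y\<bar> + \<bar>g y\<bar> * \<bar>f x - f y\<bar>"
      by (metis abs_triangle_ineq abs_mult)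
    also have "\<dots> \<le> F * (M * norm (x - y)) + G * (L * norm (x - y))"
      using L[rule_format, OF xy] M[rule_format, OF xy] bd[OF xy(1)] bd[OF xy(2)] FG
      by (intro add_mono mult_mono) auto
    finally show ?thesis by (simp add: algebra_simps)
  qed
  then show "\<exists>L\<ge>0. \<forall>x\<in>cball 0 R. \<forall>y\<in>cball 0 R. norm (f x * g x - f y * g y) \<le> L * norm (x - y)"
    using LM FG by (intro exI[of _ "F * M + G * L"]) auto
qed

lemma lipschitz_on_balls_minus:
  assumes "lipschitz_on_balls f"
  shows "lipschitz_on_balls (\<lambda>x. - f x)"
proof -
  have "norm (- f x - - f y) = norm (f x - f y)" for x y
    by (metis minus_diff_minus norm_minus_cancel)
  with assms show ?thesis unfolding lipschitz_on_balls_def by simp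
qed

lemma lipschitz_on_balls_diff:
  "lipschitz_on_balls f \<Longrightarrow> lipschitz_on_balls g \<Longrightarrow> lipschitz_on_balls (\<lambda>x. f x - g x)"
  using lipschitz_on_balls_add[of f "\<lambda>x. - g x"] lipschitz_on_balls_minus[of g] by simp

lemma lipschitz_on_balls_Pair:
  assumes "lipschitz_on_balls f" "lipschitz_on_balls g"
  shows "lipschitz_on_balls (\<lambda>x. (f x, g x))"
proof -
  have "lipschitz_on_balls (\<lambda>x. (f x, 0))" "lipschitz_on_balls (\<lambda>x. (0, g x))"
    using assms by (simp_all add: lipschitz_on_balls_def norm_Pair)
  from lipschitz_on_balls_add[OF this] show ?thesis by simp
qed

lemmas lipschitz_on_balls_intros =
  lipschitz_on_balls_const lipschitz_on_balls_add lipschitz_on_balls_mult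
  lipschitz_on_balls_minus lipschitz_on_balls_diff lipschitz_on_balls_Pair

section \<open>The flow as an autonomous equation and its maximal solutions\<close>

definition flow_field :: "real \<times> real \<times> real \<Rightarrow> real \<times> real \<times> real" where
  "flow_field = (\<lambda>(A, B, C).
     (2/3 * (- (A^2 * (2 * A + B + C)) + A * (B - C)^2),
      2/3 * (- (B^2 * (2 * B + A - C)) + B * (A + C)^2),
      2/3 * (- (C^2 * (2 * C + A - B)) + C * (A + B)^2)))"

lemma lipschitz_on_balls_flow_field: "lipschitz_on_balls flow_field"
proof -
  have *: "lipschitz_on_balls (\<lambda>x::real \<times> real \<times> real. fst x)" "lipschitz_on_balls (\<lambda>x::real \<times> real \<times> real. fst (snd x))"
    "lipschitz_on_balls (\<lambda>x::real \<times> real \<times> real. snd (snd x))"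
    by (auto intro!: lipschitz_on_balls_linear bounded_linear_intros)
  show ?thesis unfolding flow_field_def case_prod_beta power2_eq_square
    by (intro lipschitz_on_balls_intros *)
qed

lemma flow_solution_on_iff_ode_solution:
  "flow_solution_on (time_interval Tb Tf) A B C \<longleftrightarrow>
     ode_solution flow_field Tb Tf (\<lambda>t. (A t, B t, C t))"
proof -
  have Pair_iff: "((\<lambda>t. (f t, g t)) has_vector_derivative (x, y)) (at t) \<longleftrightarrow>
      (f has_vector_derivative x) (at t) \<and> (g has_vector_derivative y) (at t)"
    for f :: "real \<Rightarrow> 'a::real_normed_vector" and g :: "real \<Rightarrow> 'b::real_normed_vector" and x y t
    using bounded_linear.has_vector_derivative[OF bounded_linear_fst, of "\<lambda>t. (f t, g t)" "(x, y)" "at t"]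
      bounded_linear.has_vector_derivative[OF bounded_linear_snd, of "\<lambda>t. (f t, g t)" "(x, y)" "at t"]
    by (auto intro: has_vector_derivative_Pair)
  show ?thesis
    unfolding flow_solution_on_def ode_solution_def flow_field_def
    by (simp add: Pair_iff has_real_derivative_iff_has_vector_derivative)
qed

lemma maximal_solution_exists:
  obtains Tb Tf A B C where "maximal_solution Tb Tf A B C" "(A 0, B 0, C 0) = x"
proof -
  obtain Tb Tf u where u: "0 < Tb" "0 < Tf" "u 0 = x" "ode_solution flow_field Tb Tf u"
    "\<And>Tb' Tf' v. 0 < Tb' \<Longrightarrow> 0 < Tf' \<Longrightarrow> v 0 = x \<Longrightarrow> ode_solution flow_field Tb' Tf' v \<Longrightarrow> Tb' \<le> Tb \<and> Tf' \<le> Tf"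
    using maximal_ode_solution_exists[OF lipschitz_on_balls_flow_field] by metis
  define A B C where "A t = fst (u t)" and "B t = fst (snd (u t))" and "C t = snd (snd (u t))" for t
  have ABC: "(A t, B t, C t) = u t" for t by (simp add: A_def B_def C_def)
  have "maximal_solution Tb Tf A B C"
    unfolding maximal_solution_def flow_solution_on_iff_ode_solution ABC
  proof (intro conjI allI impI u(1,2,4))
    fix Tb' Tf' A' B' C'
    assume *: "Tb \<le> Tb' \<and> Tf \<le> Tf' \<and> ode_solution flow_field Tb' Tf' (\<lambda>t. (A' t, B' t, C' t)) \<and>
       (\<forall>t\<in>time_interval Tb Tf. A' t = A t \<and> B' t = B t \<and> C' t = C t)"
    have "0 \<in> time_interval Tb Tf" using u by (simp add: zero_in_time_interval)
    then have "(A' 0, B' 0, C' 0) = x" using * ABC[of 0] u(3) by simp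
    moreover have "0 < Tb'" "0 < Tf'" using * u(1,2) by (auto intro: less_le_trans)
    ultimately have "Tb' \<le> Tb \<and> Tf' \<le> Tf" using * u(5)[of Tb' Tf' "\<lambda>t. (A' t, B' t, C' t)"] by simp
    then show "Tb' = Tb" "Tf' = Tf" using * by auto
  qed
  then show ?thesis using that ABC u(3) by blast
qed

text \<open>Integrating factor: with \<open>G\<close> an antiderivative of \<open>g\<close>, the
  product \<open>z t * exp (- G t)\<close> is nondecreasing. Every invariant region below is
  obtained from this by exhibiting a quantity whose derivative is at least a continuous multiple of
  itself.\<close>

lemma linear_inequality_sign:
  fixes z :: "real \<Rightarrow> real"
  assumes ab: "a \<le> b" and g: "continuous_on {a..b} g"
    and z: "\<And>t. t \<in> {a..b} \<Longrightarrow> (z has_real_derivative z' t) (at t)"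
    and le: "\<And>t. t \<in> {a..b} \<Longrightarrow> g t * z t \<le> z' t"
  shows "z a \<ge> 0 \<Longrightarrow> z b \<ge> 0" "z a > 0 \<Longrightarrow> z b > 0"
proof -
  define G where "G t = integral {a..t} g" for t
  have G: "(G has_real_derivative g t) (at t within {a..b})" if "t \<in> {a..b}" for t
    using integral_has_vector_derivative[OF g that]
    by (simp add: G_def[abs_def] has_real_derivative_iff_has_vector_derivative)
  have *: "z a * exp (- G a) \<le> z b * exp (- G b)"
  proof (rule within_nonneg_imp_le[where f = "\<lambda>t. z t * exp (- G t)" and a = a and b = b
        and f' = "\<lambda>t. (z' t - g t * z t) * exp (- G t)"])
    fix t assume t: "t \<in> {a..b}"
    show "((\<lambda>t. z t * exp (- G t)) has_real_derivative (z' t - g t * z t) * exp (- G t)) (at t within {a..b})"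
      by (rule derivative_eq_intros G[OF t] has_field_derivative_at_within[OF z[OF t]] refl | simp add: algebra_simps)+
    show "(z' t - g t * z t) * exp (- G t) \<ge> 0" using le[OF t] by simp
  qed (use ab in auto)
  show "z b \<ge> 0" if "z a \<ge> 0"
  proof -
    have "0 \<le> z a * exp (- G a)" using that by simp
    with * have "0 \<le> z b * exp (- G b)" by linarith
    then show ?thesis by (simp add: zero_le_mult_iff)
  qed
  show "z b > 0" if "z a > 0"
  proof -
    have "0 < z a * exp (- G a)" using that by simp
    with * have "0 < z b * exp (- G b)" by linarith
    then show ?thesis by (simp add: zero_less_mult_iff)
  qed
qed

lemma deriv_nonneg_imp_le:
  fixes f :: "real \<Rightarrow> real"
  assumes "s \<le> t" "\<And>x. x \<in> {s..t} \<Longrightarrow> DERIV f x :> f' x" "\<And>x. x \<in> {s..t} \<Longrightarrow> f' x \<ge> 0"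
  shows "f s \<le> f t"
  using DERIV_nonneg_imp_nondecreasing[OF assms(1), of f] assms(2,3) by (metis atLeastAtMost_iff)

lemma deriv_nonpos_imp_ge:
  fixes f :: "real \<Rightarrow> real"
  assumes "s \<le> t" "\<And>x. x \<in> {s..t} \<Longrightarrow> DERIV f x :> f' x" "\<And>x. x \<in> {s..t} \<Longrightarrow> f' x \<le> 0"
  shows "f t \<le> f s"
  using DERIV_nonpos_imp_nonincreasing[OF assms(1), of f] assms(2,3) by (metis atLeastAtMost_iff)

section \<open>Rates of blow-up\<close>

lemma eventually_at_leftI_ge:
  fixes s0 T :: real
  assumes "s0 < T" "\<And>s. s \<in> {s0..<T} \<Longrightarrow> P s"
  shows "eventually P (at_left T)"
  unfolding eventually_at_left_field using assms by (intro exI[of _ s0]) auto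

lemma mono_bounded_tendsto_at_left:
  fixes f :: "real \<Rightarrow> real"
  assumes "s0 < T" and mono: "\<And>s t. s0 \<le> s \<Longrightarrow> s \<le> t \<Longrightarrow> t < T \<Longrightarrow> f s \<le> f t"
    and bd: "\<And>s. s0 \<le> s \<Longrightarrow> s < T \<Longrightarrow> f s \<le> M"
  obtains l where "(f \<longlongrightarrow> l) (at_left T)"
proof -
  define l where "l = (SUP s\<in>{s0..<T}. f s)"
  have bdd: "bdd_above (f ` {s0..<T})" using bd by (intro bdd_aboveI[of _ M]) auto
  have "(f \<longlongrightarrow> l) (at_left T)"
  proof (rule increasing_tendsto)
    show "\<forall>\<^sub>F s in at_left T. f s \<le> l"
      by (rule eventually_at_leftI_ge[OF \<open>s0 < T\<close>]) (auto simp: l_def intro!: cSUP_upper bdd)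
    fix x assume "x < l"
    then obtain s where s: "s \<in> {s0..<T}" "x < f s"
      unfolding l_def using \<open>s0 < T\<close> by (subst (asm) less_cSUP_iff) (auto intro: bdd)
    show "\<forall>\<^sub>F s in at_left T. x < f s"
      by (rule eventually_at_leftI_ge[of s]) (use s in \<open>auto intro: less_le_trans[OF s(2) mono]\<close>)
  qed
  then show ?thesis by (rule that)
qed

lemma mono_unbounded_at_top_at_left:
  fixes f :: "real \<Rightarrow> real"
  assumes mono: "\<And>s t. s0 \<le> s \<Longrightarrow> s \<le> t \<Longrightarrow> t < T \<Longrightarrow> f s \<le> f t"
    and unb: "\<And>M. \<exists>s\<in>{s0..<T}. f s > M"
  shows "filterlim f at_top (at_left T)"
  unfolding filterlim_at_top
proof
  fix M
  obtain s where s: "s \<in> {s0..<T}" "f s > M" using unb by blast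
  show "\<forall>\<^sub>F s in at_left T. M \<le> f s"
    by (rule eventually_at_leftI_ge[of s]) (use s in \<open>auto intro: order_trans[OF less_imp_le[OF s(2)] mono]\<close>)
qed

text \<open>L'Hopital's rule for \<open>1 / X ^ 2\<close> against \<open>T - s\<close>: the quotient
  of derivatives is \<open>2 * X' / X ^ 3\<close>, which tends to 8/3. Taking the inverse and the
  root gives sqrt (3/8).\<close>

lemma cubic_growth_rate:
  fixes X X' :: "real \<Rightarrow> real"
  assumes "s0 < T" and X: "\<And>s. s \<in> {s0..<T} \<Longrightarrow> X s > 0"
    and X': "\<And>s. s \<in> {s0..<T} \<Longrightarrow> DERIV X s :> X' s"
    and top: "filterlim X at_top (at_left T)"
    and lim: "((\<lambda>s. X' s / X s ^ 3) \<longlongrightarrow> 4/3) (at_left T)"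
  shows "((\<lambda>s. X s * sqrt (T - s)) \<longlongrightarrow> sqrt 6 / 4) (at_left T)"
proof -
  have "((\<lambda>s. inverse (X s ^ 2) / (T - s)) \<longlongrightarrow> 8/3) (at_left T)"
  proof (rule lhopital_left[where f' = "\<lambda>s. - 2 * (X' s / X s ^ 3)" and g' = "\<lambda>_. -1"])
    show "((\<lambda>s. inverse (X s ^ 2)) \<longlongrightarrow> 0) (at_left T)"
      by (intro tendsto_inverse_0_at_top filterlim_pow_at_top top) simp
    have "((\<lambda>s. T - s) \<longlongrightarrow> T - T) (at_left T)" by (intro tendsto_intros)
    then show "((\<lambda>s. T - s) \<longlongrightarrow> 0) (at_left T)" by simp
    show "\<forall>\<^sub>F s in at_left T. T - s \<noteq> 0" by (rule eventually_at_leftI_ge[OF \<open>s0 < T\<close>]) auto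
    show "\<forall>\<^sub>F s in at_left T. DERIV (\<lambda>s. inverse (X s ^ 2)) s :> - 2 * (X' s / X s ^ 3)"
    proof (rule eventually_at_leftI_ge[OF \<open>s0 < T\<close>])
      fix s assume s: "s \<in> {s0..<T}"
      show "DERIV (\<lambda>s. inverse (X s ^ 2)) s :> - 2 * (X' s / X s ^ 3)"
        by (rule derivative_eq_intros X'[OF s] refl | use X[OF s] in \<open>simp add: field_simps power2_eq_square power3_eq_cube\<close>)+
    qed
    show "\<forall>\<^sub>F s in at_left T. DERIV (\<lambda>s. T - s) s :> -1"
      by (intro always_eventually allI) (auto intro!: derivative_eq_intros)
    have "((\<lambda>s. 2 * (X' s / X s ^ 3)) \<longlongrightarrow> 2 * (4/3)) (at_left T)" by (intro tendsto_intros lim)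
    then show "((\<lambda>s. - 2 * (X' s / X s ^ 3) / -1) \<longlongrightarrow> 8/3) (at_left T)" by simp
  qed auto
  from tendsto_real_sqrt[OF tendsto_inverse[OF this]]
  have "((\<lambda>s. sqrt (inverse (inverse (X s ^ 2) / (T - s)))) \<longlongrightarrow> sqrt (3/8)) (at_left T)" by simp
  moreover have "sqrt (3/8) = sqrt 6 / 4"
    by (rule real_sqrt_unique) (auto simp: power_divide)
  ultimately have "((\<lambda>s. sqrt (inverse (inverse (X s ^ 2) / (T - s)))) \<longlongrightarrow> sqrt 6 / 4) (at_left T)"
    by (simp only:)
  moreover have "\<forall>\<^sub>F s in at_left T. sqrt (inverse (inverse (X s ^ 2) / (T - s))) = X s * sqrt (T - s)"
  proof (rule eventually_at_leftI_ge[OF \<open>s0 < T\<close>])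
    fix s assume s: "s \<in> {s0..<T}"
    have "inverse (inverse (X s ^ 2) / (T - s)) = X s ^ 2 * (T - s)" by (simp add: field_simps)
    then show "sqrt (inverse (inverse (X s ^ 2) / (T - s))) = X s * sqrt (T - s)"
      using X[OF s] by (simp add: real_sqrt_mult)
  qed
  ultimately show ?thesis by (rule Lim_transform_eventually)
qed

text \<open>The logarithm of \<open>V / X\<close> falls at rate at least \<open>k * X ^ 2\<close>,
  while \<open>ln X\<close> grows at rate at most \<open>4 * X ^ 2\<close>. Hence
  \<open>V / X\<close> is bounded by a multiple of \<open>X powr (- k / 4)\<close>, and
  \<open>X\<close> diverges.\<close>

lemma ratio_tendsto_zero:
  fixes X V :: "real \<Rightarrow> real"
  assumes "s0 < T" and X: "\<And>s. s \<in> {s0..<T} \<Longrightarrow> X s > 0" and V: "\<And>s. s \<in> {s0..<T} \<Longrightarrow> V s > 0"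
    and X': "\<And>s. s \<in> {s0..<T} \<Longrightarrow> DERIV X s :> X' s" "\<And>s. s \<in> {s0..<T} \<Longrightarrow> X' s \<le> 4 * X s ^ 3"
    and v': "\<And>s. s \<in> {s0..<T} \<Longrightarrow> DERIV (\<lambda>s. V s / X s) s :> v' s"
      "\<And>s. s \<in> {s0..<T} \<Longrightarrow> v' s \<le> - k * (X s * V s)" and k: "k > 0"
    and top: "filterlim X at_top (at_left T)"
  shows "((\<lambda>s. V s / X s) \<longlongrightarrow> 0) (at_left T)"
proof -
  \<comment> \<open>The weight \<open>k / 4\<close> balances the two rates exactly, so that
    \<open>p\<close> is nonincreasing.\<close>
  define p where "p s = ln (V s / X s) + k / 4 * ln (X s)" for s
  have p: "p s \<le> p s0" if s: "s \<in> {s0..<T}" for s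
  proof (rule deriv_nonpos_imp_ge[where f = p and f' = "\<lambda>s. v' s / (V s / X s) + k / 4 * (X' s / X s)"])
    fix x assume "x \<in> {s0..s}"
    with s have x: "x \<in> {s0..<T}" by auto
    have pos: "V x / X x > 0" "X x > 0" "V x > 0" using X[OF x] V[OF x] by auto
    show "DERIV p x :> v' x / (V x / X x) + k / 4 * (X' x / X x)"
      using DERIV_add[OF DERIV_chain2[OF DERIV_ln_divide[OF pos(1)] v'(1)[OF x]]
        DERIV_cmult[OF DERIV_chain2[OF DERIV_ln_divide[OF pos(2)] X'(1)[OF x]], of "k / 4"]]
      by (simp add: p_def[abs_def] mult.commute)
    have "v' x / (V x / X x) \<le> - k * (X x * V x) / (V x / X x)"
      by (intro divide_right_mono v' x less_imp_le pos)
    also have "\<dots> = - k * X x ^ 2" using pos by (simp add: field_simps power2_eq_square)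
    finally have 1: "v' x / (V x / X x) \<le> - k * X x ^ 2" .
    have "X' x / X x \<le> 4 * X x ^ 3 / X x" by (intro divide_right_mono X' x less_imp_le pos)
    also have "\<dots> = 4 * X x ^ 2" using pos by (simp add: field_simps power2_eq_square power3_eq_cube)
    finally have "k / 4 * (X' x / X x) \<le> k / 4 * (4 * X x ^ 2)" using k by (intro mult_left_mono) auto
    with 1 show "v' x / (V x / X x) + k / 4 * (X' x / X x) \<le> 0" by simp
  qed (use s in auto)
  have up: "V s / X s \<le> exp (p s0) * exp (- (k / 4 * ln (X s)))" if s: "s \<in> {s0..<T}" for s
  proof -
    have "V s / X s = exp (ln (V s / X s))" using X[OF s] V[OF s] by simp
    also have "\<dots> \<le> exp (p s0 - k / 4 * ln (X s))" using p[OF s] by (simp add: p_def)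
    finally show ?thesis unfolding mult_exp_exp by simp
  qed
  have "filterlim (\<lambda>s. k / 4 * ln (X s)) at_top (at_left T)"
    using k filterlim_compose[OF ln_at_top top]
    by (intro filterlim_tendsto_pos_mult_at_top[OF tendsto_const]) simp_all
  then have "filterlim (\<lambda>s. - (k / 4 * ln (X s))) at_bot (at_left T)"
    by (simp add: filterlim_uminus_at_top)
  from filterlim_compose[OF exp_at_bot this]
  have "((\<lambda>s. exp (- (k / 4 * ln (X s)))) \<longlongrightarrow> 0) (at_left T)" .
  from tendsto_mult[OF tendsto_const[of "exp (p s0)"] this]
  have "((\<lambda>s. exp (p s0) * exp (- (k / 4 * ln (X s)))) \<longlongrightarrow> 0) (at_left T)" by simp
  note lim = this
  show ?thesis
    by (rule tendsto_sandwich[OF _ _ tendsto_const lim])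
       (rule eventually_at_leftI_ge[OF \<open>s0 < T\<close>], use X V up in \<open>simp add: less_imp_le\<close>)+
qed

text \<open>\<open>X\<close> stands for the dominant coefficient, so one proof serves both generic
  cases. \<open>E\<close> collects the lower-order terms, which are negligible against
  \<open>X ^ 2\<close> once \<open>Y / X\<close> and \<open>Z / X\<close> tend to 0. Convergence of
  \<open>Y / Z\<close> together with \<open>Y * Z = K / X\<close> then fixes \<open>Y\<close> and
  \<open>Z\<close> separately.\<close>

lemma dominant_asymptotics:
  fixes X Y Z :: "real \<Rightarrow> real"
  assumes s0: "s0 < T"
    and pos: "\<And>s. s \<in> {s0..<T} \<Longrightarrow> X s > 0" "\<And>s. s \<in> {s0..<T} \<Longrightarrow> Y s > 0" "\<And>s. s \<in> {s0..<T} \<Longrightarrow> Z s > 0"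
    and K: "\<And>s. s \<in> {s0..<T} \<Longrightarrow> X s * Y s * Z s = K"
    and X': "\<And>s. s \<in> {s0..<T} \<Longrightarrow> DERIV X s :> 2/3 * X s * (2 * X s ^ 2 + E s)"
    and E: "\<And>s. s \<in> {s0..<T} \<Longrightarrow> \<bar>E s\<bar> \<le> 2 * X s * (Y s + Z s)"
    and YZ: "\<And>s. s \<in> {s0..<T} \<Longrightarrow> Y s + Z s \<le> 2 * X s"
    and k: "k > 0"
    and y': "\<And>s. s \<in> {s0..<T} \<Longrightarrow> DERIV (\<lambda>s. Y s / X s) s :> y' s"
      "\<And>s. s \<in> {s0..<T} \<Longrightarrow> y' s \<le> - k * (X s * Y s)"
    and z': "\<And>s. s \<in> {s0..<T} \<Longrightarrow> DERIV (\<lambda>s. Z s / X s) s :> z' s"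
      "\<And>s. s \<in> {s0..<T} \<Longrightarrow> z' s \<le> - k * (X s * Z s)"
    and r: "\<And>s. s \<in> {s0..<T} \<Longrightarrow> DERIV (\<lambda>s. ln (Y s / Z s)) s :> r s" "\<And>s. s \<in> {s0..<T} \<Longrightarrow> 0 \<le> r s"
      "\<And>s. s \<in> {s0..<T} \<Longrightarrow> r s \<le> M * (X s * (Y s + Z s))" and M: "M > 0"
    and top: "filterlim X at_top (at_left T)"
  shows "((\<lambda>s. X s * sqrt (T - s)) \<longlongrightarrow> sqrt 6 / 4) (at_left T)" (is ?thesis1)
    and "\<exists>\<eta>>0. ((\<lambda>s. Y s / (T - s) powr (1/4)) \<longlongrightarrow> \<eta>) (at_left T)" (is ?thesis2)
    and "\<exists>\<eta>>0. ((\<lambda>s. Z s / (T - s) powr (1/4)) \<longlongrightarrow> \<eta>) (at_left T)" (is ?thesis3)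
proof -
  \<comment> \<open>The hypotheses give \<open>E s \<le> 4 * X s ^ 2\<close>. This crude growth
    bound starts the decay of the ratios; the sharp factor 4/3 follows from that decay.\<close>
  have X'_le: "2/3 * X s * (2 * X s ^ 2 + E s) \<le> 4 * X s ^ 3" if s: "s \<in> {s0..<T}" for s
  proof -
    have "E s \<le> 2 * X s * (2 * X s)"
      using E[OF s] mult_left_mono[OF YZ[OF s], of "2 * X s"] pos(1)[OF s] by linarith
    then have "2 * X s ^ 2 + E s \<le> 6 * X s ^ 2" by (simp add: power2_eq_square)
    from mult_left_mono[OF this, of "2/3 * X s"] pos(1)[OF s]
    show ?thesis by (simp add: power2_eq_square power3_eq_cube)
  qed
  have Y0: "((\<lambda>s. Y s / X s) \<longlongrightarrow> 0) (at_left T)"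
    by (rule ratio_tendsto_zero[OF s0 pos(1) pos(2) X' X'_le y' k top])
  have Z0: "((\<lambda>s. Z s / X s) \<longlongrightarrow> 0) (at_left T)"
    by (rule ratio_tendsto_zero[OF s0 pos(1) pos(3) X' X'_le z' k top])
  have "((\<lambda>s. E s / X s ^ 2) \<longlongrightarrow> 0) (at_left T)"
  proof (rule tendsto_rabs_zero_cancel, rule tendsto_sandwich[OF _ _ tendsto_const])
    have "((\<lambda>s. 2 * (Y s / X s + Z s / X s)) \<longlongrightarrow> 2 * (0 + 0)) (at_left T)" by (intro tendsto_intros Y0 Z0)
    then show "((\<lambda>s. 2 * (Y s / X s + Z s / X s)) \<longlongrightarrow> 0) (at_left T)" by simp
    show "\<forall>\<^sub>F s in at_left T. \<bar>E s / X s ^ 2\<bar> \<le> 2 * (Y s / X s + Z s / X s)"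
    proof (rule eventually_at_leftI_ge[OF s0])
      fix s assume s: "s \<in> {s0..<T}"
      have "\<bar>E s\<bar> / X s ^ 2 \<le> 2 * X s * (Y s + Z s) / X s ^ 2" by (intro divide_right_mono E s) auto
      also have "\<dots> = 2 * (Y s / X s + Z s / X s)"
        using pos(1)[OF s] by (simp add: field_simps power2_eq_square)
      finally show "\<bar>E s / X s ^ 2\<bar> \<le> 2 * (Y s / X s + Z s / X s)" by (simp add: abs_divide)
    qed
  qed auto
  from tendsto_mult[OF tendsto_const[of "2/3"] tendsto_add[OF tendsto_const[of 2] this]]
  have "((\<lambda>s. 2/3 * (2 + E s / X s ^ 2)) \<longlongrightarrow> 4/3) (at_left T)" by simp
  moreover have "\<forall>\<^sub>F s in at_left T. 2/3 * (2 + E s / X s ^ 2) = 2/3 * X s * (2 * X s ^ 2 + E s) / X s ^ 3"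
    by (rule eventually_at_leftI_ge[OF s0])
       (use pos(1) in \<open>force simp: field_simps power2_eq_square power3_eq_cube\<close>)
  ultimately have "((\<lambda>s. 2/3 * X s * (2 * X s ^ 2 + E s) / X s ^ 3) \<longlongrightarrow> 4/3) (at_left T)"
    by (rule Lim_transform_eventually)
  from cubic_growth_rate[OF s0 pos(1) X' top this] show X_lim: ?thesis1 by simp
  have lim: "\<exists>l. ((\<lambda>s. ln (Y s / Z s)) \<longlongrightarrow> l) (at_left T)"
  proof -
    \<comment> \<open>The growth of \<open>ln (Y / Z)\<close> is paid for by the decay of \<open>(Y + Z) / X\<close>.\<close>
    define q where "q s = ln (Y s / Z s) + M / k * (Y s / X s + Z s / X s)" for s
    have q: "q s \<le> q s0" if s: "s \<in> {s0..<T}" for s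
    proof (rule deriv_nonpos_imp_ge[where f = q and f' = "\<lambda>s. r s + M / k * (y' s + z' s)"])
      fix x assume "x \<in> {s0..s}"
      with s have x: "x \<in> {s0..<T}" by auto
      show "DERIV q x :> r x + M / k * (y' x + z' x)"
        unfolding q_def[abs_def] by (intro DERIV_add DERIV_cmult r y' z' x)
      have "M / k * (y' x + z' x) \<le> M / k * (- k * (X x * Y x) + - k * (X x * Z x))"
        using M k by (intro mult_left_mono add_mono y' z' x) auto
      also have "\<dots> = - (M * (X x * (Y x + Z x)))" using k by (simp add: field_simps)
      finally show "r x + M / k * (y' x + z' x) \<le> 0" using r(3)[OF x] by linarith
    qed (use s in auto)
    show ?thesis
    proof (rule mono_bounded_tendsto_at_left[OF s0, of "\<lambda>s. ln (Y s / Z s)" "q s0"])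
      show "ln (Y s / Z s) \<le> ln (Y t / Z t)" if "s0 \<le> s" "s \<le> t" "t < T" for s t
        by (rule deriv_nonneg_imp_le[where f = "\<lambda>s. ln (Y s / Z s)" and f' = r]) (use that in \<open>auto intro!: r\<close>)
      show "ln (Y s / Z s) \<le> q s0" if "s0 \<le> s" "s < T" for s
      proof -
        have s: "s \<in> {s0..<T}" using that by simp
        have "0 \<le> M / k * (Y s / X s + Z s / X s)" using M k pos[OF s] by (simp add: field_simps)
        with q[OF s] show ?thesis by (simp add: q_def)
      qed
    qed blast
  qed
  then obtain l where "((\<lambda>s. ln (Y s / Z s)) \<longlongrightarrow> l) (at_left T)" ..
  from tendsto_exp[OF this] have "((\<lambda>s. exp (ln (Y s / Z s))) \<longlongrightarrow> exp l) (at_left T)" .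
  moreover have "\<forall>\<^sub>F s in at_left T. exp (ln (Y s / Z s)) = Y s / Z s"
    by (rule eventually_at_leftI_ge[OF s0]) (simp add: pos)
  ultimately have rho: "((\<lambda>s. Y s / Z s) \<longlongrightarrow> exp l) (at_left T)" by (rule Lim_transform_eventually)
  from tendsto_inverse[OF this] have rho': "((\<lambda>s. Z s / Y s) \<longlongrightarrow> exp (- l)) (at_left T)"
    by (simp add: exp_minus)
  have K0: "K > 0" using K[of s0] pos[of s0] s0 by (metis atLeastLessThan_iff mult_pos_pos order_refl)
  have sq: "(T - s) powr (1/4) = sqrt (sqrt (T - s))" if "s < T" for s
    using that by (simp add: powr_half_sqrt[symmetric] powr_powr)
  \<comment> \<open>\<open>V\<close> is one of the two small coefficients and \<open>w\<close> its
    quotient by the other, so \<open>V ^ 2 = w * K / X\<close>; since \<open>1 / X\<close> is of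
    order \<open>sqrt (T - s)\<close>, a square root produces the exponent 1/4.\<close>
  have quarter: "\<exists>\<eta>>0. ((\<lambda>s. V s / (T - s) powr (1/4)) \<longlongrightarrow> \<eta>) (at_left T)"
    if V: "\<And>s. s \<in> {s0..<T} \<Longrightarrow> V s > 0" "\<And>s. s \<in> {s0..<T} \<Longrightarrow> V s ^ 2 = w s * (K / X s)"
      and w: "(w \<longlongrightarrow> c) (at_left T)" "c > 0" for V w c
  proof (intro exI conjI)
    show "sqrt (c * (K / (sqrt 6 / 4))) > 0" using w K0 by simp
    have "((\<lambda>s. sqrt (w s * (K / (X s * sqrt (T - s))))) \<longlongrightarrow> sqrt (c * (K / (sqrt 6 / 4)))) (at_left T)"
      by (intro tendsto_intros w X_lim) simp
    moreover have "\<forall>\<^sub>F s in at_left T. sqrt (w s * (K / (X s * sqrt (T - s)))) = V s / (T - s) powr (1/4)"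
    proof (rule eventually_at_leftI_ge[OF s0])
      fix s assume s: "s \<in> {s0..<T}"
      have "w s * (K / (X s * sqrt (T - s))) = V s ^ 2 / sqrt (T - s)" using V(2)[OF s] by simp
      then show "sqrt (w s * (K / (X s * sqrt (T - s)))) = V s / (T - s) powr (1/4)"
        using V(1)[OF s] s sq[of s] by (simp add: real_sqrt_divide)
    qed
    ultimately show "((\<lambda>s. V s / (T - s) powr (1/4)) \<longlongrightarrow> sqrt (c * (K / (sqrt 6 / 4)))) (at_left T)"
      by (rule Lim_transform_eventually)
  qed
  show ?thesis2
  proof (rule quarter[OF pos(2) _ rho])
    show "Y s ^ 2 = Y s / Z s * (K / X s)" if "s \<in> {s0..<T}" for s
      using K[OF that, symmetric] pos[OF that] by (simp add: power2_eq_square)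
  qed auto
  show ?thesis3
  proof (rule quarter[OF pos(3) _ rho'])
    show "Z s ^ 2 = Z s / Y s * (K / X s)" if "s \<in> {s0..<T}" for s
      using K[OF that, symmetric] pos[OF that] by (simp add: power2_eq_square)
  qed auto
qed

section \<open>The backward flow\<close>

text \<open>Time is reversed, \<open>s = - t\<close>, so that the singular end becomes a right
  endpoint \<open>T\<close>. Here \<open>T\<close> may be any time up to which the solution exists
  backwards; blow-up at \<open>T\<close> is added by a later locale, because the bound on
  \<open>T\<close> must first exclude an infinite lifespan.\<close>

locale backward_flow =
  fixes T :: real and a b c :: "real \<Rightarrow> real"
  assumes T_pos: "0 < T"
    and da: "s \<in> {0..<T} \<Longrightarrow>
      DERIV a s :> 2/3 * ((a s)^2 * (2 * a s + b s + c s) - a s * (b s - c s)^2)"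
    and db: "s \<in> {0..<T} \<Longrightarrow>
      DERIV b s :> 2/3 * ((b s)^2 * (2 * b s + a s - c s) - b s * (a s + c s)^2)"
    and dc: "s \<in> {0..<T} \<Longrightarrow>
      DERIV c s :> 2/3 * ((c s)^2 * (2 * c s + a s - b s) - c s * (a s + b s)^2)"
    and inQ: "(a 0, b 0, c 0) \<in> Q"
begin

lemma cont: 
  assumes "0 \<le> r" "s < T"
  shows "continuous_on {r..s} a" "continuous_on {r..s} b" "continuous_on {r..s} c"
proof -
  have "continuous_on {r..s} f" if "\<And>t. t \<in> {0..<T} \<Longrightarrow> DERIV f t :> f' t" for f f' :: "real \<Rightarrow> real"
  proof (rule continuous_at_imp_continuous_on, rule ballI)
    fix t assume "t \<in> {r..s}"
    then show "isCont f t" using that[of t] assms by (auto intro: DERIV_isCont)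
  qed
  from this[OF da] this[OF db] this[OF dc] 
  show "continuous_on {r..s} a" "continuous_on {r..s} b" "continuous_on {r..s} c" by auto
qed

text \<open>Each of \<open>a\<close>, \<open>c\<close> and \<open>b - c\<close> has a derivative
  that is a continuous multiple of itself, so none of them can lose its sign.\<close>

lemma in_Q:
  assumes s: "s \<in> {0..<T}"
  shows "a s > 0" "c s > 0" "b s > c s" "b s > 0"
proof -
  have s': "0 \<le> s" "s < T" using s by auto
  note [continuous_intros] = cont[OF order_refl s'(2)]
  have 0: "a 0 > 0" "c 0 > 0" "b 0 - c 0 > 0" using inQ by (auto simp: Q_def)
  have sub: "t \<in> {0..<T}" if "t \<in> {0..s}" for t using that s by auto
  show "a s > 0"
    by (rule linear_inequality_sign(2)[OF s'(1) _ da[OF sub] _ 0(1), where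
          g = "\<lambda>t. 2/3 * (a t * (2 * a t + b t + c t) - (b t - c t)^2)"])
       (auto intro!: continuous_intros simp: algebra_simps power2_eq_square)
  show "c s > 0"
    by (rule linear_inequality_sign(2)[OF s'(1) _ dc[OF sub] _ 0(2), where
          g = "\<lambda>t. 2/3 * (c t * (2 * c t + a t - b t) - (a t + b t)^2)"])
       (auto intro!: continuous_intros simp: algebra_simps power2_eq_square)
  \<comment> \<open>The system is symmetric under exchange of \<open>b\<close> and \<open>c\<close>,
    so the plane \<open>b = c\<close> is invariant and \<open>b - c\<close> must divide the
    difference of the two equations.\<close>
  have d: "DERIV (\<lambda>t. b t - c t) t :>
      2/3 * ((2 * ((b t)^2 + b t * c t + (c t)^2) + a t * (b t + c t) - (a t)^2) * (b t - c t))"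
    if "t \<in> {0..s}" for t
    by (rule DERIV_cong[OF DERIV_diff[OF db[OF sub[OF that]] dc[OF sub[OF that]]]],
        subst right_diff_distrib[symmetric], rule arg_cong[where f = "\<lambda>x. 2/3 * x"])
       (simp add: algebra_simps power2_eq_square)
  have "b s - c s > 0"
    by (rule linear_inequality_sign(2)[OF s'(1) _ d _ 0(3), where
          g = "\<lambda>t. 2/3 * (2 * ((b t)^2 + b t * c t + (c t)^2) + a t * (b t + c t) - (a t)^2)"])
       (assumption | simp only: mult.assoc order_refl | intro continuous_intros)+
  with \<open>c s > 0\<close> show "b s > c s" "b s > 0" by auto
qed

lemma abc_const:
  assumes s: "s \<in> {0..<T}"
  shows "a s * b s * c s = a 0 * b 0 * c 0"
proof -
  have d: "DERIV (\<lambda>s. a s * b s * c s) t :> 0" if t: "t \<in> {0..s}" for t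
  proof -
    have "t \<in> {0..<T}" using t s by auto
    note d = da[OF this] db[OF this] dc[OF this]
    show ?thesis
      by (rule DERIV_cong[OF DERIV_mult[OF DERIV_mult[OF d(1,2)] d(3)]])
         (simp add: algebra_simps power2_eq_square)
  qed
  have "a s * b s * c s \<le> a 0 * b 0 * c 0" "a 0 * b 0 * c 0 \<le> a s * b s * c s"
    using deriv_nonneg_imp_le[of 0 s "\<lambda>s. a s * b s * c s" "\<lambda>_. 0"]
      deriv_nonpos_imp_ge[of 0 s "\<lambda>s. a s * b s * c s" "\<lambda>_. 0"] d s by auto
  then show ?thesis by simp
qed

text \<open>The derivatives factor, and so monotonicity can be read off: \<open>c / b\<close> and
  \<open>c / a\<close> always decrease, whereas \<open>a / b\<close> moves according to the sign of
  \<open>a + c - b\<close>, which vanishes on the lower edge of the wedge.\<close>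

lemma quotient_derivs:
  assumes s: "s \<in> {0..<T}"
  shows "DERIV (\<lambda>s. a s / b s) s :> 2 * (a s / b s) * ((a s + b s) * (a s + c s - b s))"
    and "DERIV (\<lambda>s. b s / a s) s :> - 2 * (b s / a s) * ((a s + b s) * (a s + c s - b s))"
    and "DERIV (\<lambda>s. c s / b s) s :> - 2 * (c s / b s) * ((b s - c s) * (a s + b s + c s))"
    and "DERIV (\<lambda>s. c s / a s) s :> - 2 * (c s / a s) * ((a s + c s) * (a s + b s - c s))"
    and "DERIV (\<lambda>s. ln (b s / c s)) s :> 2 * ((b s - c s) * (a s + b s + c s))"
    and "DERIV (\<lambda>s. ln (a s / c s)) s :> 2 * ((a s + c s) * (a s + b s - c s))"
proof -
  note d = da[OF s] db[OF s] dc[OF s]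
  have nz: "a s \<noteq> 0" "b s \<noteq> 0" "c s \<noteq> 0" and pos: "b s / c s > 0" "a s / c s > 0"
    using in_Q[OF s] by auto
  show "DERIV (\<lambda>s. a s / b s) s :> 2 * (a s / b s) * ((a s + b s) * (a s + c s - b s))"
    by (rule DERIV_cong[OF DERIV_divide[OF d(1,2) nz(2)]])
       (use nz in \<open>simp add: divide_simps\<close>, simp add: algebra_simps power2_eq_square)
  show "DERIV (\<lambda>s. b s / a s) s :> - 2 * (b s / a s) * ((a s + b s) * (a s + c s - b s))"
    by (rule DERIV_cong[OF DERIV_divide[OF d(2,1) nz(1)]])
       (use nz in \<open>simp add: divide_simps\<close>, simp add: algebra_simps power2_eq_square)
  show "DERIV (\<lambda>s. c s / b s) s :> - 2 * (c s / b s) * ((b s - c s) * (a s + b s + c s))"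
    by (rule DERIV_cong[OF DERIV_divide[OF d(3,2) nz(2)]])
       (use nz in \<open>simp add: divide_simps\<close>, simp add: algebra_simps power2_eq_square)
  show "DERIV (\<lambda>s. c s / a s) s :> - 2 * (c s / a s) * ((a s + c s) * (a s + b s - c s))"
    by (rule DERIV_cong[OF DERIV_divide[OF d(3,1) nz(1)]])
       (use nz in \<open>simp add: divide_simps\<close>, simp add: algebra_simps power2_eq_square)
  show "DERIV (\<lambda>s. ln (b s / c s)) s :> 2 * ((b s - c s) * (a s + b s + c s))"
    by (rule DERIV_cong[OF DERIV_chain2[OF DERIV_ln_divide[OF pos(1)] DERIV_divide[OF d(2,3) nz(3)]]])
       (use nz in \<open>simp add: divide_simps\<close>, simp add: algebra_simps power2_eq_square)
  show "DERIV (\<lambda>s. ln (a s / c s)) s :> 2 * ((a s + c s) * (a s + b s - c s))"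
    by (rule DERIV_cong[OF DERIV_chain2[OF DERIV_ln_divide[OF pos(2)] DERIV_divide[OF d(1,3) nz(3)]]])
       (use nz in \<open>simp add: divide_simps\<close>, simp add: algebra_simps power2_eq_square)
qed

text \<open>A cubic lower bound for the growth of \<open>a + b - c\<close> makes the backward lifespan finite.\<close>

lemma gap_deriv:
  assumes s: "s \<in> {0..<T}"
  shows "DERIV (\<lambda>s. a s + b s - c s) s :>
      4/3 * (a s ^ 3 + (b s ^ 3 - c s ^ 3) + a s ^ 2 * c s + a s * c s * (b s - c s))"
    and "(a s + b s - c s) ^ 3 / 3 \<le> 4/3 * (a s ^ 3 + (b s ^ 3 - c s ^ 3) + a s ^ 2 * c s + a s * c s * (b s - c s))"
proof -
  show "DERIV (\<lambda>s. a s + b s - c s) s :>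
      4/3 * (a s ^ 3 + (b s ^ 3 - c s ^ 3) + a s ^ 2 * c s + a s * c s * (b s - c s))"
    by (rule DERIV_cong[OF DERIV_diff[OF DERIV_add[OF da[OF s] db[OF s]] dc[OF s]]])
       (simp add: algebra_simps power2_eq_square power3_eq_cube)
  define x d where "x = a s" and "d = b s - c s"
  have b: "b s = c s + d" by (simp add: d_def)
  have pos: "x > 0" "d > 0" "c s > 0" using in_Q[OF s] by (auto simp: x_def d_def)
  \<comment> \<open>This product equals \<open>4 * (x ^ 3 + d ^ 3) - (x + d) ^ 3\<close>, the power
    mean inequality for cubes.\<close>
  have "0 \<le> 3 * (x + d) * (x - d)^2" using pos by simp
  then have "(x + d) ^ 3 \<le> 4 * (x ^ 3 + d ^ 3)"
    by (simp add: algebra_simps power2_eq_square power3_eq_cube)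
  moreover have "d ^ 3 \<le> b s ^ 3 - c s ^ 3"
  proof -
    have "b s ^ 3 - c s ^ 3 - d ^ 3 = 3 * c s * d * (c s + d)"
      by (simp add: b algebra_simps power2_eq_square power3_eq_cube)
    moreover have "0 \<le> 3 * c s * d * (c s + d)" using pos by simp
    ultimately show ?thesis by linarith
  qed
  moreover have "0 \<le> x ^ 2 * c s + x * c s * d" using pos by simp
  ultimately have "(x + d) ^ 3 / 3 \<le> 4/3 * (x ^ 3 + (b s ^ 3 - c s ^ 3) + x ^ 2 * c s + x * c s * d)"
    by (simp add: field_simps)
  then show "(a s + b s - c s) ^ 3 / 3 \<le> 4/3 * (a s ^ 3 + (b s ^ 3 - c s ^ 3) + a s ^ 2 * c s + a s * c s * (b s - c s))"
    by (simp add: x_def d_def add_diff_eq)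
qed

lemma gap_pos: "s \<in> {0..<T} \<Longrightarrow> a s + b s - c s > 0"
  using in_Q[of s] by simp

text \<open>For \<open>W = a + b - c\<close> the inequality \<open>W' \<ge> W ^ 3 / 3\<close> makes
  \<open>1 / W ^ 2\<close> fall at rate at least 2/3, but it stays positive.\<close>

lemma lifespan_bound: "T \<le> 3/2 / (a 0 + b 0 - c 0) ^ 2"
proof (rule dense_ge)
  fix s0 :: real assume s0: "3/2 / (a 0 + b 0 - c 0) ^ 2 < s0"
  show "T \<le> s0"
  proof (rule ccontr)
    assume "\<not> T \<le> s0"
    moreover have "0 \<le> s0" by (rule order_trans[OF _ less_imp_le[OF s0]]) simp
    ultimately have s: "s0 \<in> {0..<T}" by simp
    define W where "W t = a t + b t - c t" for t
    define W' where "W' t = 4/3 * (a t ^ 3 + (b t ^ 3 - c t ^ 3) + a t ^ 2 * c t + a t * c t * (b t - c t))" for t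
    have "inverse (W s0 ^ 2) + 2/3 * s0 \<le> inverse (W 0 ^ 2) + 2/3 * 0"
    proof (rule deriv_nonpos_imp_ge[where f = "\<lambda>t. inverse (W t ^ 2) + 2/3 * t"
          and f' = "\<lambda>t. - 2 * (W' t / W t ^ 3) + 2/3"])
      fix t assume "t \<in> {0..s0}"
      then have t: "t \<in> {0..<T}" using s by auto
      have W: "W t > 0" "DERIV W t :> W' t" "W t ^ 3 / 3 \<le> W' t"
        using gap_deriv[OF t] gap_pos[OF t] by (auto simp: W_def[abs_def] W'_def)
      show "DERIV (\<lambda>t. inverse (W t ^ 2) + 2/3 * t) t :> - 2 * (W' t / W t ^ 3) + 2/3"
        by (rule derivative_eq_intros W(2) refl | use W(1) in \<open>simp add: field_simps power2_eq_square power3_eq_cube\<close>)+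
      show "- 2 * (W' t / W t ^ 3) + 2/3 \<le> 0" using W by (simp add: field_simps)
    qed (use s in auto)
    moreover have "inverse (W s0 ^ 2) \<ge> 0" by simp
    ultimately have "2/3 * s0 \<le> inverse (W 0 ^ 2)" by linarith
    then show False using s0 by (simp add: W_def field_simps)
  qed
qed

lemma gap_mono:
  assumes "0 \<le> s" "s \<le> t" "t < T"
  shows "a s + b s - c s \<le> a t + b t - c t"
proof (rule deriv_nonneg_imp_le[where f = "\<lambda>s. a s + b s - c s", OF assms(2)])
  fix x assume "x \<in> {s..t}"
  then have x: "x \<in> {0..<T}" using assms by auto
  show "DERIV (\<lambda>s. a s + b s - c s) x :>
      4/3 * (a x ^ 3 + (b x ^ 3 - c x ^ 3) + a x ^ 2 * c x + a x * c x * (b x - c x))"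
    by (rule gap_deriv[OF x])
  have "0 \<le> (a x + b x - c x) ^ 3 / 3" using gap_pos[OF x] by simp
  with gap_deriv(2)[OF x] show "0 \<le> 4/3 * (a x ^ 3 + (b x ^ 3 - c x ^ 3) + a x ^ 2 * c x + a x * c x * (b x - c x))"
    by linarith
qed

lemma c_decreasing:
  assumes "0 \<le> s" "s \<le> t" "t < T"
  shows "c t \<le> c s"
proof (rule deriv_nonpos_imp_ge[where f = c, OF assms(2)])
  fix x assume "x \<in> {s..t}"
  then have x: "x \<in> {0..<T}" using assms by auto
  show "DERIV c x :> 2/3 * ((c x)^2 * (2 * c x + a x - b x) - c x * (a x + b x)^2)" by (rule dc[OF x])
  \<comment> \<open>Written in terms of the positive quantities \<open>a\<close>, \<open>c\<close>
    and \<open>d\<close>, the bracket becomes minus a sum of positive monomials.\<close>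
  define d where "d = b x - c x"
  have b: "b x = c x + d" by (simp add: d_def)
  have pos: "a x > 0" "d > 0" "c x > 0" using in_Q[OF x] by (auto simp: d_def)
  have "(c x)^2 * (2 * c x + a x - b x) - c x * (a x + b x)^2
      = - (c x * (a x ^ 2 + d ^ 2 + 2 * a x * d + a x * c x + 3 * c x * d))"
    by (simp add: b algebra_simps power2_eq_square)
  also have "\<dots> \<le> 0" using pos by simp
  finally show "2/3 * ((c x)^2 * (2 * c x + a x - b x) - c x * (a x + b x)^2) \<le> 0" by simp
qed

end

section \<open>Behaviour at a blow-up time\<close>

locale blowup_flow = backward_flow +
  assumes unbounded: "\<And>R. \<exists>s\<in>{0..<T}. a s + b s > R"
begin

text \<open>Blow-up only says that \<open>a + b\<close> is unbounded. As \<open>c\<close> never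
  exceeds \<open>c 0\<close>, the gap is unbounded too, and its monotonicity upgrades this to
  divergence.\<close>

lemma gap_at_top: "filterlim (\<lambda>s. a s + b s - c s) at_top (at_left T)"
proof (rule mono_unbounded_at_top_at_left[where ?s0.0 = 0])
  fix M
  obtain s where "s \<in> {0..<T}" "a s + b s > M + c 0" using unbounded by blast
  then show "\<exists>s\<in>{0..<T}. a s + b s - c s > M" using c_decreasing[of 0 s] by (intro bexI[of _ s]) auto
qed (rule gap_mono)

lemma dominant_at_top:
  assumes s0: "s0 < T" "\<And>s. s \<in> {s0..<T} \<Longrightarrow> a s + b s - c s \<le> 2 * X s"
  shows "filterlim X at_top (at_left T)"
proof -
  have "filterlim (\<lambda>s. 1/2 * (a s + b s - c s)) at_top (at_left T)"
    by (intro filterlim_tendsto_pos_mult_at_top[OF tendsto_const] gap_at_top) simp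
  then show ?thesis
  proof (rule filterlim_at_top_mono)
    show "\<forall>\<^sub>F s in at_left T. 1/2 * (a s + b s - c s) \<le> X s"
      by (rule eventually_at_leftI_ge[OF s0(1)]) (use s0(2) in force)
  qed
qed

text \<open>Past \<open>x = 1\<close> the ratio \<open>a / b\<close> can only grow, so
  \<open>a - b\<close> keeps at least a fixed share \<open>k\<close> of \<open>a\<close>. This share
  supplies the decay of \<open>b / a\<close> and \<open>c / a\<close> that
  \<open>dominant_asymptotics\<close> asks for.\<close>

lemma a_dominates:
  assumes s1: "s1 \<in> {0..<T}" "a s1 > b s1"
  shows "((\<lambda>s. a s * sqrt (T - s)) \<longlongrightarrow> sqrt 6 / 4) (at_left T)"
    and "\<exists>\<eta>>0. ((\<lambda>s. b s / (T - s) powr (1/4)) \<longlongrightarrow> \<eta>) (at_left T)"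
    and "\<exists>\<eta>>0. ((\<lambda>s. c s / (T - s) powr (1/4)) \<longlongrightarrow> \<eta>) (at_left T)"
proof -
  have sub: "s \<in> {0..<T}" if "s \<in> {s1..<T}" for s using that s1 by auto
  have ge: "a s / b s - 1 \<ge> 0" if s: "s \<in> {s1..<T}" for s
  proof (rule linear_inequality_sign(1)[where a = s1 and b = s and z = "\<lambda>s. a s / b s - 1" and
        g = "\<lambda>t. 2 * (a t / b t) * ((a t + b t) * b t)" and
        z' = "\<lambda>t. 2 * (a t / b t) * ((a t + b t) * (a t + c t - b t))"])
    have "continuous_on {s1..s} a" "continuous_on {s1..s} b"
      using cont[of s1 s] s s1 by auto
    moreover have "b t \<noteq> 0" if "t \<in> {s1..s}" for t using in_Q(4)[of t] that s s1 by auto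
    ultimately show "continuous_on {s1..s} (\<lambda>t. 2 * (a t / b t) * ((a t + b t) * b t))"
      by (intro continuous_intros) auto
    fix t assume "t \<in> {s1..s}"
    then have t: "t \<in> {0..<T}" using s s1 by auto
    show "DERIV (\<lambda>s. a s / b s - 1) t :> 2 * (a t / b t) * ((a t + b t) * (a t + c t - b t))"
      using DERIV_diff[OF quotient_derivs(1)[OF t] DERIV_const[of 1]] by simp
    have p: "a t > 0" "b t > 0" "c t > 0" using in_Q[OF t] by auto
    have "b t * (a t / b t - 1) \<le> a t + c t - b t" using p by (simp add: field_simps)
    then have "2 * (a t / b t) * ((a t + b t) * (b t * (a t / b t - 1))) \<le> 2 * (a t / b t) * ((a t + b t) * (a t + c t - b t))"
      using p by (intro mult_left_mono) auto
    then show "2 * (a t / b t) * ((a t + b t) * b t) * (a t / b t - 1) \<le> 2 * (a t / b t) * ((a t + b t) * (a t + c t - b t))"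
      by (simp only: mult.assoc)
  next
    show "0 \<le> a s1 / b s1 - 1" using s1(2) in_Q[OF s1(1)] by (simp add: field_simps)
  qed (use s in auto)
  have ab: "a s \<ge> b s" if s: "s \<in> {s1..<T}" for s
    using ge[OF s] in_Q[OF sub[OF s]] by (simp add: field_simps)
  have ratio: "a s1 / b s1 \<le> a s / b s" if s: "s \<in> {s1..<T}" for s
  proof (rule deriv_nonneg_imp_le[where f = "\<lambda>s. a s / b s" and
        f' = "\<lambda>t. 2 * (a t / b t) * ((a t + b t) * (a t + c t - b t))"])
    fix t assume t: "t \<in> {s1..s}"
    then have t': "t \<in> {0..<T}" using s s1 by auto
    show "DERIV (\<lambda>s. a s / b s) t :> 2 * (a t / b t) * ((a t + b t) * (a t + c t - b t))"
      by (rule quotient_derivs[OF t'])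
    show "0 \<le> 2 * (a t / b t) * ((a t + b t) * (a t + c t - b t))"
      using in_Q[OF t'] ab[of t] t s by (intro mult_nonneg_nonneg) auto
  qed (use s in auto)
  \<comment> \<open>From \<open>s1\<close> on, \<open>b / a\<close> never exceeds its value at
    \<open>s1\<close>, that is, \<open>b \<le> (1 - k) * a\<close>.\<close>
  define k where "k = 1 - b s1 / a s1"
  have k: "k > 0" "k < 1" using s1 in_Q[OF s1(1)] by (auto simp: k_def field_simps)
  have kab: "k * a s \<le> a s - b s" if s: "s \<in> {s1..<T}" for s
    using ratio[OF s] in_Q[OF sub[OF s]] in_Q[OF s1(1)] by (simp add: k_def field_simps)
  have y': "- 2 * (b s / a s) * ((a s + b s) * (a s + c s - b s)) \<le> - k * (a s * b s)" if s: "s \<in> {s1..<T}" for s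
  proof -
    have p: "a s > 0" "b s > 0" "c s > 0" using in_Q[OF sub[OF s]] by auto
    have "a s * (k * a s) \<le> (a s + b s) * (a s + c s - b s)"
      using p k kab[OF s] by (intro mult_mono) auto
    then have "b s / a s * (a s * (k * a s)) \<le> b s / a s * ((a s + b s) * (a s + c s - b s))"
      using p by (intro mult_left_mono) auto
    moreover have "b s / a s * (a s * (k * a s)) = k * (a s * b s)" using p by (simp add: field_simps)
    moreover have "0 \<le> k * (a s * b s)" using p k by simp
    ultimately show ?thesis by (simp add: mult.assoc)
  qed
  have z': "- 2 * (c s / a s) * ((a s + c s) * (a s + b s - c s)) \<le> - k * (a s * c s)" if s: "s \<in> {s1..<T}" for s
  proof -
    have p: "a s > 0" "b s > 0" "c s > 0" "b s > c s" using in_Q[OF sub[OF s]] by auto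
    have "a s * (k * a s) \<le> (a s + c s) * (a s + b s - c s)"
    proof (intro mult_mono)
      have "k * a s \<le> a s" using p k by (simp add: mult_le_cancel_right1)
      then show "k * a s \<le> a s + b s - c s" using p by linarith
    qed (use p k in auto)
    then have "c s / a s * (a s * (k * a s)) \<le> c s / a s * ((a s + c s) * (a s + b s - c s))"
      using p by (intro mult_left_mono) auto
    moreover have "c s / a s * (a s * (k * a s)) = k * (a s * c s)" using p by (simp add: field_simps)
    moreover have "0 \<le> k * (a s * c s)" using p k by simp
    ultimately show ?thesis by (simp add: mult.assoc)
  qed
  have E: "\<bar>a s * (b s + c s) - (b s - c s)^2\<bar> \<le> 2 * a s * (b s + c s)" if s: "s \<in> {s1..<T}" for s
  proof -
    have p: "a s > 0" "b s > 0" "c s > 0" "b s > c s" using in_Q[OF sub[OF s]] by auto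
    have "(b s - c s) * (b s - c s) \<le> a s * (b s + c s)"
      using p ab[OF s] by (intro mult_mono) auto
    moreover have "0 \<le> (b s - c s) * (b s - c s)" "0 \<le> a s * (b s + c s)" using p by auto
    ultimately show ?thesis unfolding power2_eq_square mult.assoc by linarith
  qed
  \<comment> \<open>Both \<open>b\<close> and \<open>c\<close> are at most \<open>a\<close>, so
    \<open>a + b + c \<le> 3 * a\<close>; doubling gives the constant \<open>M = 6\<close>.\<close>
  have r: "2 * ((b s - c s) * (a s + b s + c s)) \<le> 6 * (a s * (b s + c s))" if s: "s \<in> {s1..<T}" for s
  proof -
    have p: "a s > 0" "b s > 0" "c s > 0" "b s > c s" using in_Q[OF sub[OF s]] by auto
    have "(b s - c s) * (a s + b s + c s) \<le> (b s + c s) * (3 * a s)"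
      using p ab[OF s] by (intro mult_mono) auto
    moreover have "(b s + c s) * (3 * a s) = 3 * (a s * (b s + c s))" by simp
    ultimately show ?thesis by linarith
  qed
  have top: "filterlim a at_top (at_left T)"
  proof (rule dominant_at_top[of s1])
    show "a s + b s - c s \<le> 2 * a s" if "s \<in> {s1..<T}" for s
      using ab[OF that] in_Q[OF sub[OF that]] by linarith
  qed (use s1 in auto)
  have da': "DERIV a s :> 2/3 * a s * (2 * a s ^ 2 + (a s * (b s + c s) - (b s - c s)^2))" if "s \<in> {s1..<T}" for s
    by (rule DERIV_cong[OF da[OF sub[OF that]]]) (simp add: algebra_simps power2_eq_square)
  have r0: "0 \<le> 2 * ((b s - c s) * (a s + b s + c s))" if "s \<in> {s1..<T}" for s
    using in_Q[OF sub[OF that]] by (intro mult_nonneg_nonneg) auto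
  have YZ: "b s + c s \<le> 2 * a s" if s: "s \<in> {s1..<T}" for s using in_Q[OF sub[OF s]] ab[OF s] by auto
  have "s1 < T" using s1 by simp
  note concl = dominant_asymptotics[where X = a and Y = b and Z = c and k = k and M = 6 and ?s0.0 = s1 and T = T,
      OF \<open>s1 < T\<close> in_Q(1)[OF sub] in_Q(4)[OF sub] in_Q(2)[OF sub] abc_const[OF sub] da' E YZ k(1)
      quotient_derivs(2)[OF sub] y' quotient_derivs(4)[OF sub] z' quotient_derivs(5)[OF sub] r0 r _ top]
  show "((\<lambda>s. a s * sqrt (T - s)) \<longlongrightarrow> sqrt 6 / 4) (at_left T)"
    and "\<exists>\<eta>>0. ((\<lambda>s. b s / (T - s) powr (1/4)) \<longlongrightarrow> \<eta>) (at_left T)"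
    and "\<exists>\<eta>>0. ((\<lambda>s. c s / (T - s) powr (1/4)) \<longlongrightarrow> \<eta>) (at_left T)"
    using concl by auto
qed

end

context blowup_flow
begin

text \<open>The counterpart of \<open>a_dominates\<close>, with \<open>z = 1 - x - y\<close> in the
  role of \<open>x - 1\<close>: below the wedge \<open>z\<close> grows, and
  \<open>b - a - c = b * z\<close> keeps a fixed share of \<open>b\<close>.\<close>

lemma b_dominates:
  assumes s1: "s1 \<in> {0..<T}" "b s1 > a s1 + c s1"
  shows "((\<lambda>s. b s * sqrt (T - s)) \<longlongrightarrow> sqrt 6 / 4) (at_left T)"
    and "\<exists>\<eta>>0. ((\<lambda>s. a s / (T - s) powr (1/4)) \<longlongrightarrow> \<eta>) (at_left T)"
    and "\<exists>\<eta>>0. ((\<lambda>s. c s / (T - s) powr (1/4)) \<longlongrightarrow> \<eta>) (at_left T)"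
proof -
  have sub: "s \<in> {0..<T}" if "s \<in> {s1..<T}" for s using that s1 by auto
  define z where "z s = 1 - a s / b s - c s / b s" for s
  define z' where "z' t = - (2 * (a t / b t) * ((a t + b t) * (a t + c t - b t)))
      - (- 2 * (c t / b t) * ((b t - c t) * (a t + b t + c t)))" for t
  have dz: "DERIV z t :> z' t" if t: "t \<in> {0..<T}" for t
    using DERIV_diff[OF DERIV_diff[OF DERIV_const[of 1] quotient_derivs(1)[OF t]] quotient_derivs(3)[OF t]]
    by (simp add: z_def[abs_def] z'_def)
  have bz: "b t * z t = b t - a t - c t" if "t \<in> {0..<T}" for t
    using in_Q(4)[OF that] by (simp add: z_def field_simps)
  have z1: "z s1 > 0" using bz[OF s1(1)] s1 in_Q(4)[OF s1(1)] zero_less_mult_iff[of "b s1" "z s1"] by simp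
  \<comment> \<open>The decrease of \<open>c / b\<close> contributes a positive term to
    \<open>z'\<close>, which is dropped; the contribution of \<open>a / b\<close> alone is a
    multiple of \<open>z\<close>.\<close>
  have le: "2 * (a t / b t) * ((a t + b t) * b t) * z t \<le> z' t" if t: "t \<in> {0..<T}" for t
  proof -
    have p: "a t > 0" "b t > 0" "c t > 0" "b t > c t" using in_Q[OF t] by auto
    have "2 * (a t / b t) * ((a t + b t) * b t) * z t = 2 * (a t / b t) * ((a t + b t) * (b t * z t))"
      by (simp only: mult.assoc)
    also have "\<dots> = - (2 * (a t / b t) * ((a t + b t) * (a t + c t - b t)))"
      unfolding bz[OF t] by (simp add: algebra_simps)
    also have "\<dots> \<le> z' t" using p by (simp add: z'_def)
    finally show ?thesis .
  qed
  have ge: "z s \<ge> 0" if s: "s \<in> {s1..<T}" for s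
  proof (rule linear_inequality_sign(1)[where a = s1 and b = s and z = z and z' = z' and
        g = "\<lambda>t. 2 * (a t / b t) * ((a t + b t) * b t)"])
    have "continuous_on {s1..s} a" "continuous_on {s1..s} b"
      using cont[of s1 s] s s1 by auto
    moreover have "b t \<noteq> 0" if "t \<in> {s1..s}" for t using in_Q(4)[of t] that s s1 by auto
    ultimately show "continuous_on {s1..s} (\<lambda>t. 2 * (a t / b t) * ((a t + b t) * b t))"
      by (intro continuous_intros) auto
  qed (use s s1 z1 dz le in auto)
  have zz: "z s1 \<le> z s" if s: "s \<in> {s1..<T}" for s
  proof (rule deriv_nonneg_imp_le[where f = z and f' = z'])
    fix t assume t: "t \<in> {s1..s}"
    then have t': "t \<in> {0..<T}" using s s1 by auto
    show "DERIV z t :> z' t" by (rule dz[OF t'])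
    have "0 \<le> 2 * (a t / b t) * ((a t + b t) * b t) * z t"
      using in_Q[OF t'] ge[of t] t s by (intro mult_nonneg_nonneg) auto
    then show "0 \<le> z' t" using le[OF t'] by linarith
  qed (use s in auto)
  define k where "k = z s1"
  have k: "k > 0" using z1 by (simp add: k_def)
  have kb: "k * b s \<le> b s - a s - c s" if s: "s \<in> {s1..<T}" for s
    using mult_left_mono[OF zz[OF s], of "b s"] bz[OF sub[OF s]] in_Q[OF sub[OF s]]
    by (simp add: k_def mult.commute)
  have ba: "a s + c s \<le> b s" if s: "s \<in> {s1..<T}" for s
    using kb[OF s] mult_pos_pos[OF k in_Q(4)[OF sub[OF s]]] by linarith
  have y': "2 * (a s / b s) * ((a s + b s) * (a s + c s - b s)) \<le> - k * (b s * a s)" if s: "s \<in> {s1..<T}" for s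
  proof -
    have p: "a s > 0" "b s > 0" "c s > 0" using in_Q[OF sub[OF s]] by auto
    have "b s * (k * b s) \<le> (a s + b s) * (b s - a s - c s)"
      using p k kb[OF s] by (intro mult_mono) auto
    then have "a s / b s * (b s * (k * b s)) \<le> a s / b s * ((a s + b s) * (b s - a s - c s))"
      using p by (intro mult_left_mono) auto
    moreover have "a s / b s * (b s * (k * b s)) = k * (b s * a s)" using p by (simp add: field_simps)
    moreover have "0 \<le> k * (b s * a s)" using p k by simp
    moreover have "2 * (a s / b s) * ((a s + b s) * (a s + c s - b s)) =
        - (2 * (a s / b s * ((a s + b s) * (b s - a s - c s))))" by (simp add: algebra_simps)
    ultimately show ?thesis by simp
  qed
  have z'': "- 2 * (c s / b s) * ((b s - c s) * (a s + b s + c s)) \<le> - k * (b s * c s)" if s: "s \<in> {s1..<T}" for s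
  proof -
    have p: "a s > 0" "b s > 0" "c s > 0" "b s > c s" using in_Q[OF sub[OF s]] by auto
    have "(k * b s) * b s \<le> (b s - c s) * (a s + b s + c s)"
      using p k kb[OF s] by (intro mult_mono) auto
    then have "c s / b s * ((k * b s) * b s) \<le> c s / b s * ((b s - c s) * (a s + b s + c s))"
      using p by (intro mult_left_mono) auto
    moreover have "c s / b s * ((k * b s) * b s) = k * (b s * c s)" using p by (simp add: field_simps)
    moreover have "0 \<le> k * (b s * c s)" using p k by simp
    ultimately show ?thesis by (simp add: mult.assoc)
  qed
  have E: "\<bar>b s * (a s - c s) - (a s + c s)^2\<bar> \<le> 2 * b s * (a s + c s)" if s: "s \<in> {s1..<T}" for s
  proof -
    have p: "a s > 0" "b s > 0" "c s > 0" "b s > c s" using in_Q[OF sub[OF s]] by auto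
    have 1: "(a s + c s) * (a s + c s) \<le> b s * (a s + c s)"
      using p ba[OF s] by (intro mult_right_mono) auto
    have 2: "0 \<le> (a s + c s) * (a s + c s)" "0 \<le> b s * a s" "0 \<le> b s * c s" using p by auto
    have 3: "b s * (a s - c s) = b s * a s - b s * c s" "b s * (a s + c s) = b s * a s + b s * c s"
      by (simp_all add: algebra_simps)
    have "\<bar>x - y - S\<bar> \<le> 2 * (x + y)" if "S \<le> x + y" "0 \<le> S" "0 \<le> x" "0 \<le> y" for x y S :: real
      using that unfolding abs_le_iff by auto
    from this[OF 1[unfolded 3] 2] show ?thesis unfolding power2_eq_square mult.assoc 3 .
  qed
  have r: "2 * ((a s + c s) * (a s + b s - c s)) \<le> 4 * (b s * (a s + c s))" if s: "s \<in> {s1..<T}" for s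
  proof -
    have p: "a s > 0" "b s > 0" "c s > 0" "b s > c s" using in_Q[OF sub[OF s]] by auto
    have "(a s + c s) * (a s + b s - c s) \<le> (a s + c s) * (2 * b s)"
      using p ba[OF s] by (intro mult_mono) auto
    moreover have "(a s + c s) * (2 * b s) = 2 * (b s * (a s + c s))" by simp
    ultimately show ?thesis by linarith
  qed
  have top: "filterlim b at_top (at_left T)"
  proof (rule dominant_at_top[of s1])
    show "a s + b s - c s \<le> 2 * b s" if "s \<in> {s1..<T}" for s
      using ba[OF that] in_Q[OF sub[OF that]] by linarith
  qed (use s1 in auto)
  have db': "DERIV b s :> 2/3 * b s * (2 * b s ^ 2 + (b s * (a s - c s) - (a s + c s)^2))" if "s \<in> {s1..<T}" for s
    by (rule DERIV_cong[OF db[OF sub[OF that]]]) (simp add: algebra_simps power2_eq_square)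
  have r0: "0 \<le> 2 * ((a s + c s) * (a s + b s - c s))" if "s \<in> {s1..<T}" for s
    using in_Q[OF sub[OF that]] by (intro mult_nonneg_nonneg) auto
  have YZ: "a s + c s \<le> 2 * b s" if s: "s \<in> {s1..<T}" for s using in_Q[OF sub[OF s]] ba[OF s] by auto
  have abc: "b s * a s * c s = a 0 * b 0 * c 0" if "s \<in> {s1..<T}" for s
    using abc_const[OF sub[OF that]] by (simp add: mult_ac)
  have "s1 < T" using s1 by simp
  note concl = dominant_asymptotics[where X = b and Y = a and Z = c and k = k and M = 4 and ?s0.0 = s1 and T = T,
      OF \<open>s1 < T\<close> in_Q(4)[OF sub] in_Q(1)[OF sub] in_Q(2)[OF sub] abc db' E YZ k
      quotient_derivs(1)[OF sub] y' quotient_derivs(3)[OF sub] z'' quotient_derivs(6)[OF sub] r0 r _ top]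
  show "((\<lambda>s. b s * sqrt (T - s)) \<longlongrightarrow> sqrt 6 / 4) (at_left T)"
    and "\<exists>\<eta>>0. ((\<lambda>s. a s / (T - s) powr (1/4)) \<longlongrightarrow> \<eta>) (at_left T)"
    and "\<exists>\<eta>>0. ((\<lambda>s. c s / (T - s) powr (1/4)) \<longlongrightarrow> \<eta>) (at_left T)"
    using concl by auto
qed

text \<open>Inside the wedge \<open>a\<close> and \<open>b\<close> differ by at most
  \<open>c\<close>, which stays below \<open>c 0\<close>. They therefore diverge together,
  \<open>c\<close> is negligible against both, and \<open>a / b\<close> is squeezed between
  \<open>1 - c / b\<close> and 1.\<close>

lemma wedge_ratio_limits:
  assumes wedge: "\<And>s. s \<in> {0..<T} \<Longrightarrow> a s \<le> b s \<and> b s \<le> a s + c s"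
  shows "filterlim a at_top (at_left T)" "filterlim b at_top (at_left T)"
    "((\<lambda>s. c s / a s) \<longlongrightarrow> 0) (at_left T)" "((\<lambda>s. c s / b s) \<longlongrightarrow> 0) (at_left T)"
    "((\<lambda>s. a s / b s) \<longlongrightarrow> 1) (at_left T)"
proof -
  show b: "filterlim b at_top (at_left T)"
    by (rule dominant_at_top[OF T_pos]) (use wedge in_Q in \<open>smt (verit)\<close>)
  have "filterlim (\<lambda>s. - c 0 + b s) at_top (at_left T)"
    by (rule filterlim_tendsto_add_at_top[OF tendsto_const b])
  moreover have "\<forall>\<^sub>F s in at_left T. - c 0 + b s \<le> a s"
    by (rule eventually_at_leftI_ge[OF T_pos]) (use wedge c_decreasing[of 0] in \<open>smt (verit) atLeastLessThan_iff\<close>)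
  ultimately show a: "filterlim a at_top (at_left T)" by (rule filterlim_at_top_mono)
  have lim: "((\<lambda>s. c s / X s) \<longlongrightarrow> 0) (at_left T)"
    if X: "filterlim X at_top (at_left T)" "\<And>s. s \<in> {0..<T} \<Longrightarrow> X s > 0" for X
  proof (rule tendsto_sandwich[OF _ _ tendsto_const])
    show "((\<lambda>s. c 0 / X s) \<longlongrightarrow> 0) (at_left T)"
      by (rule tendsto_divide_0[OF tendsto_const filterlim_at_top_imp_at_infinity[OF X(1)]])
    show "\<forall>\<^sub>F s in at_left T. 0 \<le> c s / X s"
      by (rule eventually_at_leftI_ge[OF T_pos]) (use in_Q X in \<open>auto intro!: divide_nonneg_pos less_imp_le\<close>)
    show "\<forall>\<^sub>F s in at_left T. c s / X s \<le> c 0 / X s"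
      by (rule eventually_at_leftI_ge[OF T_pos]) (use c_decreasing[of 0] X(2) in \<open>simp add: divide_right_mono less_imp_le\<close>)
  qed
  show "((\<lambda>s. c s / a s) \<longlongrightarrow> 0) (at_left T)" by (rule lim[OF a in_Q(1)])
  show cb: "((\<lambda>s. c s / b s) \<longlongrightarrow> 0) (at_left T)" by (rule lim[OF b in_Q(4)])
  show "((\<lambda>s. a s / b s) \<longlongrightarrow> 1) (at_left T)"
  proof (rule tendsto_sandwich[OF _ _ _ tendsto_const])
    from tendsto_diff[OF tendsto_const[of 1] cb] show "((\<lambda>s. 1 - c s / b s) \<longlongrightarrow> 1) (at_left T)" by simp
    show "\<forall>\<^sub>F s in at_left T. 1 - c s / b s \<le> a s / b s"
    proof (rule eventually_at_leftI_ge[OF T_pos])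
      fix s assume s: "s \<in> {0..<T}"
      have "1 - c s / b s = (b s - c s) / b s" using in_Q(4)[OF s] by (simp add: diff_divide_distrib)
      then show "1 - c s / b s \<le> a s / b s" using wedge[OF s] in_Q(4)[OF s] by (simp add: divide_right_mono)
    qed
    show "\<forall>\<^sub>F s in at_left T. a s / b s \<le> 1"
    proof (rule eventually_at_leftI_ge[OF T_pos])
      fix s assume s: "s \<in> {0..<T}"
      show "a s / b s \<le> 1" using wedge[OF s] in_Q(4)[OF s] by (simp add: field_simps)
    qed
  qed
qed

text \<open>With \<open>b / a\<close> tending to 1 and \<open>c / a\<close> to 0, the quotient of
  the derivative of \<open>a\<close> by \<open>a ^ 3\<close> tends to
  \<open>2/3 * (2 + 1 - 1) = 4/3\<close>, the same constant as for a single dominant coefficient.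
  The rate of \<open>c\<close> then comes from the conserved product, as (sqrt 6 / 4)^2 =
  3/8.\<close>

lemma wedge_asymptotics:
  assumes wedge: "\<And>s. s \<in> {0..<T} \<Longrightarrow> a s \<le> b s \<and> b s \<le> a s + c s"
  shows "((\<lambda>s. a s * sqrt (T - s)) \<longlongrightarrow> sqrt 6 / 4) (at_left T)"
    "((\<lambda>s. b s * sqrt (T - s)) \<longlongrightarrow> sqrt 6 / 4) (at_left T)"
    "((\<lambda>s. c s / (T - s)) \<longlongrightarrow> 8/3 * (a 0 * b 0 * c 0)) (at_left T)"
proof -
  note lim = wedge_ratio_limits[OF wedge]
  have nz: "a s > 0" "b s > 0" "c s > 0" if "s \<in> {0..<T}" for s using in_Q[OF that] by auto
  from tendsto_inverse[OF lim(5)] have ba: "((\<lambda>s. b s / a s) \<longlongrightarrow> 1) (at_left T)" by simp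
  have "((\<lambda>s. 2/3 * ((2 + b s / a s + c s / a s) - (b s / a s - c s / a s)^2)) \<longlongrightarrow>
      2/3 * ((2 + 1 + 0) - (1 - 0)^2)) (at_left T)"
    by (intro tendsto_intros ba lim)
  moreover have "\<forall>\<^sub>F s in at_left T. 2/3 * ((2 + b s / a s + c s / a s) - (b s / a s - c s / a s)^2) =
      2/3 * ((a s)^2 * (2 * a s + b s + c s) - a s * (b s - c s)^2) / a s ^ 3"
    by (rule eventually_at_leftI_ge[OF T_pos])
       (use nz in \<open>simp add: divide_simps less_imp_neq[THEN not_sym]\<close>, simp add: algebra_simps power2_eq_square power3_eq_cube)
  ultimately have "((\<lambda>s. 2/3 * ((a s)^2 * (2 * a s + b s + c s) - a s * (b s - c s)^2) / a s ^ 3) \<longlongrightarrow> 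
      2/3 * ((2 + 1 + 0) - (1 - 0)^2)) (at_left T)"
    by (rule Lim_transform_eventually)
  then have "((\<lambda>s. 2/3 * ((a s)^2 * (2 * a s + b s + c s) - a s * (b s - c s)^2) / a s ^ 3) \<longlongrightarrow> 4/3) (at_left T)"
    by simp
  from cubic_growth_rate[OF T_pos nz(1) da lim(1) this]
  show A: "((\<lambda>s. a s * sqrt (T - s)) \<longlongrightarrow> sqrt 6 / 4) (at_left T)" by simp
  from tendsto_mult[OF ba A] have "((\<lambda>s. b s / a s * (a s * sqrt (T - s))) \<longlongrightarrow> sqrt 6 / 4) (at_left T)" by simp
  moreover have "\<forall>\<^sub>F s in at_left T. b s / a s * (a s * sqrt (T - s)) = b s * sqrt (T - s)"
    by (rule eventually_at_leftI_ge[OF T_pos]) (use nz in force)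
  ultimately show B: "((\<lambda>s. b s * sqrt (T - s)) \<longlongrightarrow> sqrt 6 / 4) (at_left T)"
    by (rule Lim_transform_eventually)
  let ?K = "a 0 * b 0 * c 0"
  have "((\<lambda>s. ?K / ((a s * sqrt (T - s)) * (b s * sqrt (T - s)))) \<longlongrightarrow> ?K / ((sqrt 6 / 4) * (sqrt 6 / 4))) (at_left T)"
    by (intro tendsto_intros A B) simp
  moreover have "\<forall>\<^sub>F s in at_left T. ?K / ((a s * sqrt (T - s)) * (b s * sqrt (T - s))) = c s / (T - s)"
  proof (rule eventually_at_leftI_ge[OF T_pos])
    fix s assume s: "s \<in> {0..<T}"
    have "(a s * sqrt (T - s)) * (b s * sqrt (T - s)) = a s * b s * (T - s)" using s by simp
    then show "?K / ((a s * sqrt (T - s)) * (b s * sqrt (T - s))) = c s / (T - s)"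
      using abc_const[OF s, symmetric] nz[OF s] by simp
  qed
  ultimately have "((\<lambda>s. c s / (T - s)) \<longlongrightarrow> ?K / ((sqrt 6 / 4) * (sqrt 6 / 4))) (at_left T)"
    by (rule Lim_transform_eventually)
  then show "((\<lambda>s. c s / (T - s)) \<longlongrightarrow> 8/3 * ?K) (at_left T)" by (simp add: mult_ac)
qed

end

section \<open>The separatrix in the plane of shapes\<close>

text \<open>
  In backward time the shape \<open>x = a/b\<close>, \<open>y = c/b\<close> of a solution satisfies
  \<open>x' = 2 b\<^sup>2 (1 + x + y) * shape_rate x y\<close> and \<open>\<theta>' = - 2 b\<^sup>2 (1 + x + y)\<close>, where
  \<open>\<theta> = ln (y / (1 - y)) = ln (c / (b - c))\<close>. Hence orbits are solutions of
  \<open>dx/d\<theta> = - shape_rate x (logistic \<theta>)\<close>, an equation that is regular up to \<open>y = 1\<close>.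
\<close>

definition shape_rate :: "real \<Rightarrow> real \<Rightarrow> real" where
  "shape_rate x y = x * (1 + x) * (x + y - 1) / (1 + x + y)"

definition logistic :: "real \<Rightarrow> real" where
  "logistic \<theta> = 1 / (1 + exp (- \<theta>))"

lemma logistic_bounds: "0 < logistic \<theta>" "logistic \<theta> < 1"
  using exp_gt_zero[of "- \<theta>"] by (auto simp: logistic_def add_pos_pos)

lemma logistic_deriv: "DERIV logistic \<theta> :> logistic \<theta> * (1 - logistic \<theta>)"
proof -
  have "1 + exp (- \<theta>) \<noteq> 0" using exp_gt_zero[of "- \<theta>"] by linarith
  then show ?thesis unfolding logistic_def[abs_def]
    by (auto intro!: derivative_eq_intros simp: field_simps power2_eq_square)
qed

lemma logistic_at_bot: "(logistic \<longlongrightarrow> 0) at_bot"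
proof (rule tendsto_sandwich[OF _ _ tendsto_const exp_at_bot])
  have "exp (- \<theta>) * exp \<theta> = 1" for \<theta> :: real by (simp add: mult_exp_exp)
  then have "logistic \<theta> \<le> exp \<theta>" for \<theta>
    using exp_gt_zero[of "- \<theta>"] exp_gt_zero[of \<theta>]
    by (simp add: logistic_def divide_le_eq add_pos_pos distrib_left mult.commute)
  then show "\<forall>\<^sub>F \<theta> in at_bot. logistic \<theta> \<le> exp \<theta>" by simp
  show "\<forall>\<^sub>F \<theta> in at_bot. 0 \<le> logistic \<theta>" by (simp add: logistic_bounds less_imp_le)
qed

lemma logistic_ln:
  assumes "0 < c" "c < b"
  shows "logistic (ln (c / (b - c))) = c / b"
proof -
  have "exp (- ln (c / (b - c))) = (b - c) / c" using assms by (simp add: exp_minus)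
  then show ?thesis using assms by (simp only: logistic_def) (simp add: field_simps)
qed

text \<open>Above the line \<open>x = 1 - y\<close> the factors \<open>x\<close>,
  \<open>x + y - 1\<close> and \<open>(1 + x) / (1 + x + y)\<close> are all nonnegative and
  nondecreasing in \<open>x\<close>. This is the reason why two orbits in the wedge move apart
  backwards in time.\<close>

lemma shape_rate_mono:
  assumes "0 < y" "y < 1" "1 - y \<le> x" "x \<le> z"
  shows "shape_rate x y \<le> shape_rate z y"
proof -
  have "(1 + x) / (1 + x + y) \<le> (1 + z) / (1 + z + y)"
    using assms by (simp add: divide_simps) (simp add: algebra_simps)
  then have "x * (x + y - 1) * ((1 + x) / (1 + x + y)) \<le> z * (z + y - 1) * ((1 + z) / (1 + z + y))"
    using assms by (intro mult_mono) auto
  then show ?thesis by (simp add: shape_rate_def mult_ac)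
qed

text \<open>Product rule for \<open>p\<close> and \<open>q\<close>: both are bounded by 1, with
  Lipschitz constants 2 and 1. The constant 3 is uniform in \<open>y\<close>, which gives existence
  on arbitrarily long intervals and uniform convergence of derivatives.\<close>

lemma shape_rate_lipschitz:
  assumes y: "0 < y" "y < 1" and x: "0 \<le> x" "x \<le> 1" and z: "0 \<le> z" "z \<le> 1"
  shows "\<bar>shape_rate x y - shape_rate z y\<bar> \<le> 3 * \<bar>x - z\<bar>"
proof -
  define p q where "p x = x * (x + y - 1)" and "q x = (1 + x) / (1 + x + y)" for x
  have pq: "shape_rate x y = p x * q x" for x by (simp add: shape_rate_def p_def q_def)
  have q: "\<bar>q x\<bar> \<le> 1" using x y by (simp add: q_def divide_simps)
  have p: "\<bar>p z\<bar> \<le> 1"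
  proof -
    have "\<bar>z\<bar> * \<bar>z + y - 1\<bar> \<le> 1 * 1" using y z by (intro mult_mono) auto
    then show ?thesis by (simp add: p_def abs_mult)
  qed
  have dp: "\<bar>p x - p z\<bar> \<le> 2 * \<bar>x - z\<bar>"
  proof -
    have "p x - p z = (x + z + y - 1) * (x - z)" by (simp add: p_def algebra_simps)
    moreover have "\<bar>x + z + y - 1\<bar> \<le> 2" using x y z by auto
    ultimately show ?thesis by (simp add: abs_mult mult_right_mono)
  qed
  have dq: "\<bar>q x - q z\<bar> \<le> 1 * \<bar>x - z\<bar>"
  proof -
    have nz: "1 + x + y > 0" "1 + z + y > 0" using x y z by auto
    have "q x - q z = ((1 + x) * (1 + z + y) - (1 + z) * (1 + x + y)) / ((1 + x + y) * (1 + z + y))"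
      using nz by (simp add: q_def diff_frac_eq)
    also have "(1 + x) * (1 + z + y) - (1 + z) * (1 + x + y) = y * (x - z)" by (simp add: algebra_simps)
    finally have "q x - q z = y / ((1 + x + y) * (1 + z + y)) * (x - z)" by simp
    moreover have "\<bar>y / ((1 + x + y) * (1 + z + y))\<bar> \<le> 1"
    proof -
      have "1 * 1 \<le> (1 + x + y) * (1 + z + y)" using x y z by (intro mult_mono) auto
      then have "y \<le> (1 + x + y) * (1 + z + y)" using y by linarith
      then show ?thesis using nz y by (simp add: abs_mult)
    qed
    ultimately show ?thesis by (simp only: abs_mult) (rule mult_right_mono, auto)
  qed
  have "shape_rate x y - shape_rate z y = q x * (p x - p z) + p z * (q x - q z)"
    unfolding pq by (simp add: algebra_simps)
  also have "\<bar>\<dots>\<bar> \<le> \<bar>q x\<bar> * \<bar>p x - p z\<bar> + \<bar>p z\<bar> * \<bar>q x - q z\<bar>"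
    by (metis abs_mult abs_triangle_ineq)
  also have "\<dots> \<le> 1 * (2 * \<bar>x - z\<bar>) + 1 * (1 * \<bar>x - z\<bar>)"
    by (intro add_mono mult_mono p q dp dq) auto
  finally show ?thesis by simp
qed

text \<open>After the last time at which \<open>e\<close> is nonnegative it would be negative and
  hence nondecreasing, so it could not have dropped below 0. The hypothesis concerns points below
  the barrier because a field truncated outside the wedge has a clear sign there.\<close>

lemma barrier:
  fixes e :: "real \<Rightarrow> real"
  assumes e: "\<And>t. t \<in> {a..b} \<Longrightarrow> (e has_real_derivative e' t) (at t within {a..b})"
    and "e a \<ge> 0" and neg: "\<And>t. t \<in> {a..b} \<Longrightarrow> e t < 0 \<Longrightarrow> e' t \<ge> 0" and t: "t \<in> {a..b}"
  shows "e t \<ge> 0"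
proof (rule ccontr)
  assume et: "\<not> e t \<ge> 0"
  define Z where "Z = {a..t} \<inter> e -` {0..}"
  have cont: "continuous_on {a..b} e"
    unfolding continuous_on_eq_continuous_within using e DERIV_continuous by blast
  have "continuous_on {a..t} e" by (rule continuous_on_subset[OF cont]) (use t in auto)
  then have "closed Z" unfolding Z_def by (intro continuous_closed_preimage closed_atLeastAtMost closed_atLeast)
  moreover have "bdd_above Z" "Z \<noteq> {}" using t assms(2) by (auto simp: Z_def intro: bdd_above_mono[of "{a..t}"])
  ultimately have Sup: "Sup Z \<in> Z" by (intro closed_contains_Sup)
  define s where "s = Sup Z"
  have s: "s \<in> {a..t}" "e s \<ge> 0" using Sup by (auto simp: Z_def s_def)
  then have st: "s < t" using et by (cases "s = t") auto
  have "e s \<le> e t"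
  proof (rule DERIV_nonneg_imp_increasing_open[of s t e])
    show "continuous_on {s..t} e" by (rule continuous_on_subset[OF cont]) (use s t in auto)
    fix x assume x: "s < x" "x < t"
    have "e x < 0"
    proof (rule ccontr)
      assume "\<not> e x < 0"
      then have "x \<in> Z" using x s by (auto simp: Z_def)
      then have "x \<le> s" unfolding s_def by (rule cSup_upper) fact
      then show False using x by simp
    qed
    moreover have xab: "a < x" "x < b" "x \<in> {a..b}" using x s t by auto
    ultimately have "e' x \<ge> 0" by (intro neg)
    moreover have "DERIV e x :> e' x" using e[OF xab(3)] at_within_Icc_at[OF xab(1,2)] by simp
    ultimately show "\<exists>y. DERIV e x :> y \<and> y \<ge> 0" by blast
  qed (use st in auto)
  then show False using s et by simp
qed

text \<open>Clamping \<open>x\<close> to [0, 1] makes the field globally Lipschitz, and two barriers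
  show that the solution never leaves the wedge, where the clamp is inactive. Above
  \<open>x = 1\<close> the field pushes down; below \<open>x = 1 - y\<close> it pushes up, while the
  edge itself falls as \<theta> grows.\<close>

lemma separatrix_approximant:
  fixes n :: real
  assumes n: "n \<ge> 0"
  obtains h where "h (- n) = 1"
    "\<And>\<theta>. \<theta> \<in> {-n..n} \<Longrightarrow> 1 - logistic \<theta> \<le> h \<theta> \<and> h \<theta> \<le> 1"
    "\<And>\<theta>. \<theta> \<in> {-n..n} \<Longrightarrow>
       (h has_real_derivative - shape_rate (h \<theta>) (logistic \<theta>)) (at \<theta> within {-n..n})"
proof -
  define cl where "cl x = max 0 (min 1 x)" for x :: real
  have cl: "0 \<le> cl x" "cl x \<le> 1" "\<bar>cl x - cl y\<bar> \<le> \<bar>x - y\<bar>" for x y by (auto simp: cl_def)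
  define f where "f \<theta> x = - shape_rate (cl x) (logistic \<theta>)" for \<theta> x
  have log_cont: "continuous_on UNIV logistic"
    using logistic_deriv DERIV_isCont continuous_at_imp_continuous_on by blast
  obtain h where h: "h (- n) = 1"
    "\<And>\<theta>. \<theta> \<in> {-n..n} \<Longrightarrow> (h has_vector_derivative f \<theta> (h \<theta>)) (at \<theta> within {-n..n})"
  proof (rule picard_lindeloef_global[of "-n" n f 3 1])
    have "continuous_on ({-n..n} \<times> UNIV) (\<lambda>p. logistic (fst p))"
      by (rule continuous_on_compose2[OF log_cont]) (auto intro: continuous_intros)
    moreover have "1 + cl (snd p) + logistic (fst p) \<noteq> 0" for p
      using cl(1)[of "snd p"] logistic_bounds(1)[of "fst p"] by linarith
    ultimately show "continuous_on ({-n..n} \<times> UNIV) (\<lambda>(t, x). f t x)"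
      unfolding f_def shape_rate_def case_prod_beta
      by (auto intro!: continuous_intros simp: cl_def)
    show "norm (f t x - f t y) \<le> 3 * norm (x - y)" for t x y
    proof -
      have "\<bar>shape_rate (cl y) (logistic t) - shape_rate (cl x) (logistic t)\<bar> \<le> 3 * \<bar>cl y - cl x\<bar>"
        by (intro shape_rate_lipschitz logistic_bounds cl)
      also have "\<dots> \<le> 3 * \<bar>y - x\<bar>" using cl(3)[of y x] by simp
      finally show ?thesis by (simp add: f_def abs_minus_commute)
    qed
  qed (use n in auto)
  have h': "(h has_real_derivative f \<theta> (h \<theta>)) (at \<theta> within {-n..n})" if "\<theta> \<in> {-n..n}" for \<theta>
    using h(2)[OF that] by (simp add: has_real_derivative_iff_has_vector_derivative)
  have le: "h \<theta> \<le> 1" if "\<theta> \<in> {-n..n}" for \<theta>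
  proof -
    have "1 - h \<theta> \<ge> 0"
    proof (rule barrier[of "-n" n "\<lambda>\<theta>. 1 - h \<theta>" "\<lambda>\<theta>. 0 - f \<theta> (h \<theta>)"])
      fix t assume "t \<in> {-n..n}" "1 - h t < 0"
      then have "cl (h t) = 1" by (simp add: cl_def)
      then show "0 - f t (h t) \<ge> 0" using logistic_bounds[of t] by (simp add: f_def shape_rate_def)
    next
      fix t assume t: "t \<in> {-n..n}"
      show "((\<lambda>\<theta>. 1 - h \<theta>) has_real_derivative 0 - f t (h t)) (at t within {-n..n})"
        by (intro DERIV_diff DERIV_const h'[OF t])
    qed (use that h(1) in auto)
    then show ?thesis by simp
  qed
  have ge: "1 - logistic \<theta> \<le> h \<theta>" if "\<theta> \<in> {-n..n}" for \<theta>
  proof -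
    have "h \<theta> - (1 - logistic \<theta>) \<ge> 0"
    proof (rule barrier[of "-n" n "\<lambda>\<theta>. h \<theta> - (1 - logistic \<theta>)" "\<lambda>\<theta>. f \<theta> (h \<theta>) - (0 - logistic \<theta> * (1 - logistic \<theta>))"])
      fix t assume t: "t \<in> {-n..n}" "h t - (1 - logistic t) < 0"
      have l: "0 < logistic t" "logistic t < 1" by (rule logistic_bounds)+
      have c: "cl (h t) + logistic t - 1 \<le> 0" using t l by (simp add: cl_def)
      have "cl (h t) * (1 + cl (h t)) * (cl (h t) + logistic t - 1) \<le> 0"
        using cl(1)[of "h t"] c by (intro mult_nonneg_nonpos) auto
      then have "f t (h t) \<ge> 0" using cl(1)[of "h t"] l by (simp add: f_def shape_rate_def divide_nonpos_pos)
      moreover have "logistic t * (1 - logistic t) \<ge> 0" using l by simp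
      ultimately show "f t (h t) - (0 - logistic t * (1 - logistic t)) \<ge> 0" by linarith
    next
      fix t assume t: "t \<in> {-n..n}"
      show "((\<lambda>\<theta>. h \<theta> - (1 - logistic \<theta>)) has_real_derivative f t (h t) - (0 - logistic t * (1 - logistic t)))
          (at t within {-n..n})"
        by (intro DERIV_diff DERIV_const h'[OF t] has_field_derivative_at_within[OF logistic_deriv])
    qed (use that h logistic_bounds[of "-n"] in auto)
    then show ?thesis by simp
  qed
  have "f \<theta> (h \<theta>) = - shape_rate (h \<theta>) (logistic \<theta>)" if "\<theta> \<in> {-n..n}" for \<theta>
    using le[OF that] ge[OF that] logistic_bounds[of \<theta>] by (simp add: f_def cl_def)
  with h' le ge h(1) that show ?thesis by metis
qed

text \<open>
  The separatrix is the limit of the orbits entering the wedge at \<open>x = 1\<close>, \<open>\<theta> = - n\<close>: orbits in the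
  wedge approach each other as \<open>\<theta>\<close> grows, and the wedge at \<open>- n\<close> has width \<open>logistic (- n)\<close>.
\<close>

theorem separatrix_exists:
  obtains H where
    "\<And>\<theta>. 1 - logistic \<theta> \<le> H \<theta> \<and> H \<theta> \<le> 1"
    "\<And>\<theta>. DERIV H \<theta> :> - shape_rate (H \<theta>) (logistic \<theta>)"
proof -
  have "\<forall>n::nat. \<exists>h. h (- real n) = 1 \<and>
    (\<forall>\<theta>\<in>{-real n..real n}. (1 - logistic \<theta> \<le> h \<theta> \<and> h \<theta> \<le> 1) \<and>
       (h has_real_derivative - shape_rate (h \<theta>) (logistic \<theta>)) (at \<theta> within {-real n..real n}))"
    by (metis separatrix_approximant of_nat_0_le_iff)
  then obtain h where h1: "\<And>n::nat. h n (- real n) = 1"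
    and h: "\<And>n \<theta>. \<theta> \<in> {-real n..real n} \<Longrightarrow> 1 - logistic \<theta> \<le> h n \<theta> \<and> h n \<theta> \<le> 1"
    and h': "\<And>n \<theta>. \<theta> \<in> {-real n..real n} \<Longrightarrow>
       (h n has_real_derivative - shape_rate (h n \<theta>) (logistic \<theta>)) (at \<theta> within {-real n..real n})"
    by metis
  have close: "\<bar>h n \<theta> - h m \<theta>\<bar> \<le> logistic (- real n)" if "n \<le> m" "\<theta> \<in> {-real n..real n}" for n m \<theta>
  proof -
    define d where "d \<theta> = h n \<theta> - h m \<theta>" for \<theta>
    define d' where "d' \<theta> = - shape_rate (h n \<theta>) (logistic \<theta>) - (- shape_rate (h m \<theta>) (logistic \<theta>))" for \<theta>
    have sub: "{-real n..real n} \<subseteq> {-real m..real m}" using that by auto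
    have "- ((d (- real n))^2) \<le> - ((d \<theta>)^2)"
    proof (rule within_nonneg_imp_le[where f = "\<lambda>\<theta>. - ((d \<theta>)^2)" and f' = "\<lambda>\<theta>. - (2 * d \<theta> * d' \<theta>)"
          and a = "- real n" and b = "real n"])
      fix t assume t: "t \<in> {-real n..real n}"
      then have t': "t \<in> {-real m..real m}" using sub by auto
      have "(d has_real_derivative d' t) (at t within {-real n..real n})"
        unfolding d_def[abs_def] d'_def
        by (intro DERIV_diff h' t DERIV_subset[OF h' sub] t')
      from DERIV_minus[OF DERIV_power[OF this, of 2]]
      show "((\<lambda>\<theta>. - ((d \<theta>)^2)) has_real_derivative - (2 * d t * d' t)) (at t within {-real n..real n})"
        by (simp add: mult_ac)
      have "d t * d' t \<le> 0"
      proof (cases "h n t \<le> h m t")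
        case True
        then have "d' t \<ge> 0" "d t \<le> 0"
          using shape_rate_mono[OF logistic_bounds, of t "h n t" "h m t"] h[OF t] by (auto simp: d'_def d_def)
        then show ?thesis by (simp add: mult_nonpos_nonneg)
      next
        case False
        then have "d' t \<le> 0" "d t \<ge> 0"
          using shape_rate_mono[OF logistic_bounds, of t "h m t" "h n t"] h[OF t'] by (auto simp: d'_def d_def)
        then show ?thesis by (simp add: mult_nonneg_nonpos)
      qed
      then show "- (2 * d t * d' t) \<ge> 0" by (simp add: mult.commute)
    qed (use that in auto)
    then have "\<bar>d \<theta>\<bar> \<le> \<bar>d (- real n)\<bar>" by (simp add: abs_le_square_iff)
    also have "\<dots> \<le> logistic (- real n)"
      using h[of "- real n" m] h1[of n] that by (auto simp: d_def)
    finally show ?thesis by (simp add: d_def)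
  qed
  have small: "(\<lambda>n. logistic (- real n)) \<longlonglongrightarrow> 0"
    by (rule filterlim_compose[OF logistic_at_bot])
       (simp add: filterlim_uminus_at_top[symmetric] filterlim_real_sequentially)
  have "convergent (\<lambda>n. h n \<theta>)" for \<theta>
  proof (rule Cauchy_convergent, rule metric_CauchyI)
    fix e :: real assume "e > 0"
    then obtain N where N: "\<And>n. n \<ge> N \<Longrightarrow> logistic (- real n) < e / 2"
      using small logistic_bounds unfolding lim_sequentially by (fastforce simp: dist_norm dest: spec[of _ "e / 2"])
    define M where "M = max N (nat \<lceil>\<bar>\<theta>\<bar>\<rceil>)"
    have M: "\<theta> \<in> {-real M..real M}" "M \<ge> N" unfolding M_def by (auto simp: abs_le_iff) linarith+
    have "dist (h m \<theta>) (h n \<theta>) < e" if "m \<ge> M" "n \<ge> M" for m n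
      using close[OF that(1) M(1)] close[OF that(2) M(1)] N[OF M(2)] by (simp add: dist_norm)
    then show "\<exists>M. \<forall>m\<ge>M. \<forall>n\<ge>M. dist (h m \<theta>) (h n \<theta>) < e" by blast
  qed
  then obtain H where H: "\<And>\<theta>. (\<lambda>n. h n \<theta>) \<longlonglongrightarrow> H \<theta>" unfolding convergent_def by metis
  have in_dom: "\<forall>\<^sub>F n in sequentially. \<theta> \<in> {-real n..real n}" for \<theta>
    using eventually_ge_at_top[of "nat \<lceil>\<bar>\<theta>\<bar>\<rceil>"] 
  proof eventually_elim
    case (elim n)
    then have "\<bar>\<theta>\<bar> \<le> real n" using real_nat_ceiling_ge[of "\<bar>\<theta>\<bar>"] by linarith
    then show ?case by (auto simp: abs_le_iff)
  qed
  have bounds: "1 - logistic \<theta> \<le> H \<theta> \<and> H \<theta> \<le> 1" for \<theta>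
    using tendsto_lowerbound[OF H[of \<theta>], of "1 - logistic \<theta>"] tendsto_upperbound[OF H[of \<theta>], of 1]
      eventually_mono[OF in_dom[of \<theta>] h] by (simp add: eventually_conj_iff)
  have close_H: "\<bar>h n \<theta> - H \<theta>\<bar> \<le> logistic (- real n)" if "\<theta> \<in> {-real n..real n}" for n \<theta>
  proof (rule tendsto_upperbound)
    show "(\<lambda>m. \<bar>h n \<theta> - h m \<theta>\<bar>) \<longlonglongrightarrow> \<bar>h n \<theta> - H \<theta>\<bar>" by (intro tendsto_intros H)
    show "\<forall>\<^sub>F m in sequentially. \<bar>h n \<theta> - h m \<theta>\<bar> \<le> logistic (- real n)"
      using eventually_ge_at_top[of n] by eventually_elim (rule close[OF _ that])
  qed simp
  have "DERIV H \<theta> :> - shape_rate (H \<theta>) (logistic \<theta>)" for \<theta>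
  proof -
    \<comment> \<open>\<open>M\<close> exceeds the absolute value of \<theta>, so the open window
      \<open>S\<close> lies in the domain of every approximant from index \<open>M\<close> on. There
      the derivatives converge uniformly, because the approximants do and \<open>shape_rate\<close>
      is Lipschitz, and the limit may be differentiated termwise.\<close>
    define M where "M = nat \<lceil>\<bar>\<theta>\<bar>\<rceil> + 1"
    define S where "S = {-real M<..<real M}"
    have "\<bar>\<theta>\<bar> < real M" using real_nat_ceiling_ge[of "\<bar>\<theta>\<bar>"] unfolding M_def by linarith
    then have \<theta>: "\<theta> \<in> S" by (auto simp: S_def)
    have sub: "x \<in> {-real (n + M)..real (n + M)}" if "x \<in> S" for x n using that by (auto simp: S_def)
    have "\<exists>g. \<forall>x\<in>S. (\<lambda>n. h (n + M) x) \<longlonglongrightarrow> g x \<and>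
        (g has_derivative (\<lambda>k. - shape_rate (H x) (logistic x) * k)) (at x within S)"
    proof (rule has_derivative_sequence)
      show "convex S" by (simp add: S_def)
      show "(h (n + M) has_derivative (\<lambda>k. - shape_rate (h (n + M) x) (logistic x) * k)) (at x within S)"
        if "x \<in> S" for n x
      proof -
        have "S \<subseteq> {-real (n + M)..real (n + M)}" using sub by blast
        from DERIV_subset[OF h'[OF sub[OF that, of n]] this]
        show ?thesis by (simp only: has_field_derivative_def)
      qed
      show "\<forall>\<^sub>F n in sequentially. \<forall>x\<in>S. \<forall>k. norm (- shape_rate (h (n + M) x) (logistic x) * k
          - (- shape_rate (H x) (logistic x) * k)) \<le> e * norm k" if "e > 0" for e
      proof -
        have "\<forall>\<^sub>F n in sequentially. logistic (- real n) < e / 3"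
          using order_tendstoD(2)[OF small, of "e / 3"] that by simp
        then have "\<forall>\<^sub>F n in sequentially. logistic (- real (n + M)) < e / 3"
          by (subst eventually_sequentially_seg[where P = "\<lambda>n. logistic (- real n) < e / 3"])
        then show ?thesis
        proof eventually_elim
          case (elim n)
          show ?case
          proof (intro ballI allI)
            fix x k assume x: "x \<in> S"
            have "\<bar>shape_rate (h (n + M) x) (logistic x) - shape_rate (H x) (logistic x)\<bar> \<le> 3 * \<bar>h (n + M) x - H x\<bar>"
              using h[OF sub[OF x, of n]] bounds[of x] logistic_bounds[of x]
              by (intro shape_rate_lipschitz) auto
            also have "\<dots> \<le> e" using close_H[OF sub[OF x, of n]] elim by simp
            finally have "\<bar>shape_rate (h (n + M) x) (logistic x) - shape_rate (H x) (logistic x)\<bar> * \<bar>k\<bar> \<le> e * \<bar>k\<bar>"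
              by (intro mult_right_mono) auto
            moreover have "norm (- shape_rate (h (n + M) x) (logistic x) * k - (- shape_rate (H x) (logistic x) * k))
                = \<bar>shape_rate (h (n + M) x) (logistic x) - shape_rate (H x) (logistic x)\<bar> * \<bar>k\<bar>"
              unfolding abs_mult[symmetric] real_norm_def
              by (subst abs_minus_cancel[symmetric]) (simp add: left_diff_distrib)
            ultimately show "norm (- shape_rate (h (n + M) x) (logistic x) * k
                - (- shape_rate (H x) (logistic x) * k)) \<le> e * norm k" by simp
          qed
        qed
      qed
      show "(\<lambda>n. h (n + M) \<theta>) \<longlonglongrightarrow> H \<theta>" by (rule LIMSEQ_ignore_initial_segment[OF H])
    qed (rule \<theta>)
    then obtain g where g: "\<And>x. x \<in> S \<Longrightarrow> (\<lambda>n. h (n + M) x) \<longlonglongrightarrow> g x"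
      "\<And>x. x \<in> S \<Longrightarrow> (g has_derivative (\<lambda>k. - shape_rate (H x) (logistic x) * k)) (at x within S)" by blast
    have gH: "g x = H x" if "x \<in> S" for x
      using LIMSEQ_unique[OF g(1)[OF that] LIMSEQ_ignore_initial_segment[OF H]] .
    have "open S" by (simp add: S_def)
    from g(2)[OF \<theta>] have "(g has_derivative (\<lambda>k. - shape_rate (H \<theta>) (logistic \<theta>) * k)) (at \<theta>)"
      unfolding at_within_open[OF \<theta> \<open>open S\<close>] .
    then have "(H has_derivative (\<lambda>k. - shape_rate (H \<theta>) (logistic \<theta>) * k)) (at \<theta>)"
      by (rule has_derivative_transform_within_open[OF _ \<open>open S\<close> \<theta> gH])
    then show ?thesis unfolding has_field_derivative_def .
  qed
  with bounds show ?thesis by (rule that)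
qed

section \<open>Behaviour relative to the separatrix\<close>

text \<open>Fixed by choice: all later arguments rest on the wedge bounds and the differential
  equation alone.\<close>

definition separatrix :: "real \<Rightarrow> real" where
  "separatrix = (SOME H. \<forall>\<theta>. 1 - logistic \<theta> \<le> H \<theta> \<and> H \<theta> \<le> 1 \<and>
     DERIV H \<theta> :> - shape_rate (H \<theta>) (logistic \<theta>))"

lemma separatrix:
  "1 - logistic \<theta> \<le> separatrix \<theta>" "separatrix \<theta> \<le> 1"
  "DERIV separatrix \<theta> :> - shape_rate (separatrix \<theta>) (logistic \<theta>)"
proof -
  have "\<exists>H. \<forall>\<theta>. 1 - logistic \<theta> \<le> H \<theta> \<and> H \<theta> \<le> 1 \<and> DERIV H \<theta> :> - shape_rate (H \<theta>) (logistic \<theta>)"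
    by (rule separatrix_exists) blast
  then have "\<forall>\<theta>. 1 - logistic \<theta> \<le> separatrix \<theta> \<and> separatrix \<theta> \<le> 1 \<and>
      DERIV separatrix \<theta> :> - shape_rate (separatrix \<theta>) (logistic \<theta>)"
    unfolding separatrix_def by (rule someI_ex)
  then show "1 - logistic \<theta> \<le> separatrix \<theta>" "separatrix \<theta> \<le> 1"
    "DERIV separatrix \<theta> :> - shape_rate (separatrix \<theta>) (logistic \<theta>)" by blast+
qed

lemma separatrix_pos: "separatrix \<theta> > 0"
  using separatrix(1)[of \<theta>] logistic_bounds(2)[of \<theta>] by linarith

text \<open>The height \<open>x = a / b\<close> of the separatrix above \<open>y = c / b\<close>. It
  depends on \<open>b\<close> and \<open>c\<close> through their quotient only, which makes the
  exceptional set a cone.\<close>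

definition threshold :: "real \<Rightarrow> real \<Rightarrow> real" where
  "threshold b c = separatrix (ln (c / (b - c)))"

lemma threshold_bounds:
  assumes "0 < c" "c < b"
  shows "1 - c / b \<le> threshold b c" "threshold b c \<le> 1"
  using separatrix[of "ln (c / (b - c))"] logistic_ln[OF assms] by (auto simp: threshold_def)

lemma threshold_pos: "threshold b c > 0"
  by (simp add: threshold_def separatrix_pos)

text \<open>The divided difference of \<open>shape_rate\<close> in its first argument, with the
  factor \<open>x - z\<close> cancelled by hand so that it remains continuous where
  \<open>x = z\<close>.\<close>

definition shape_slope :: "real \<Rightarrow> real \<Rightarrow> real \<Rightarrow> real" where
  "shape_slope x z y =
     ((x^2 + x * z + z^2 + y * (x + z) + y - 1) * (1 + z + y) - z * (1 + z) * (z + y - 1)) /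
     ((1 + x + y) * (1 + z + y))"

lemma shape_rate_diff:
  assumes "1 + x + y \<noteq> 0" "1 + z + y \<noteq> 0"
  shows "shape_rate x y - shape_rate z y = shape_slope x z y * (x - z)"
proof -
  have "shape_rate x y - shape_rate z y =
      (x * (1 + x) * (x + y - 1) * (1 + z + y) - z * (1 + z) * (z + y - 1) * (1 + x + y)) / ((1 + x + y) * (1 + z + y))"
    using assms unfolding shape_rate_def by (rule diff_frac_eq)
  also have "x * (1 + x) * (x + y - 1) * (1 + z + y) - z * (1 + z) * (z + y - 1) * (1 + x + y) =
      ((x^2 + x * z + z^2 + y * (x + z) + y - 1) * (1 + z + y) - z * (1 + z) * (z + y - 1)) * (x - z)"
    by (simp add: algebra_simps power2_eq_square)
  finally show ?thesis by (simp add: shape_slope_def)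
qed

context backward_flow
begin

definition offset :: "real \<Rightarrow> real" where
  "offset s = a s / b s - threshold (b s) (c s)"

definition offset_rate :: "real \<Rightarrow> real" where
  "offset_rate s = 2 * b s ^ 2 * (1 + a s / b s + c s / b s)"

lemma offset_rate_pos: "s \<in> {0..<T} \<Longrightarrow> offset_rate s > 0"
  unfolding offset_rate_def using in_Q[of s] by (intro mult_pos_pos add_pos_pos) auto

text \<open>The solution and the separatrix above its current shape run on the same clock: \<theta>
  falls at speed \<open>offset_rate\<close> and the separatrix has slope \<open>- shape_rate\<close>
  in \<theta>, so the two minus signs cancel and the threshold moves like a second orbit.\<close>

lemma offset_deriv:
  assumes s: "s \<in> {0..<T}"
  shows "DERIV offset s :> offset_rate s *
      (shape_rate (a s / b s) (c s / b s) - shape_rate (threshold (b s) (c s)) (c s / b s))"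
proof -
  have p: "a s > 0" "c s > 0" "b s - c s > 0" "b s > 0" "c s < b s" using in_Q[OF s] by auto
  have "DERIV (\<lambda>s. c s / (b s - c s)) s :> c s / (b s - c s) * (- 2 * b s * (a s + b s + c s))"
  proof -
    \<comment> \<open>Up to the factor 2/3, \<open>g\<close> and \<open>G\<close> are the
      logarithmic derivatives of \<open>c\<close> and \<open>b - c\<close>, so the logarithmic
      derivative of the quotient is governed by \<open>g - G\<close>.\<close>
    define g where "g = c s * (2 * c s + a s - b s) - (a s + b s)^2"
    define G where "G = 2 * ((b s)^2 + b s * c s + (c s)^2) + a s * (b s + c s) - (a s)^2"
    have c: "DERIV c s :> 2/3 * (c s * g)"
      by (rule DERIV_cong[OF dc[OF s]]) (simp add: g_def algebra_simps power2_eq_square)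
    have bc: "DERIV (\<lambda>s. b s - c s) s :> 2/3 * (G * (b s - c s))"
      by (rule DERIV_cong[OF DERIV_diff[OF db[OF s] dc[OF s]]],
          subst right_diff_distrib[symmetric], rule arg_cong[where f = "\<lambda>x. 2/3 * x"])
         (simp add: G_def algebra_simps power2_eq_square)
    have "b s - c s \<noteq> 0" using p by simp
    from DERIV_divide[OF c bc this]
    have "DERIV (\<lambda>s. c s / (b s - c s)) s :> c s / (b s - c s) * (2/3 * (g - G))"
      by (rule DERIV_cong) (use p in \<open>simp add: divide_simps\<close>, simp add: algebra_simps)
    moreover have "g - G = - 3 * (b s * (a s + b s + c s))"
      by (simp add: g_def G_def algebra_simps power2_eq_square)
    ultimately show ?thesis by (simp add: mult.assoc)
  qed
  from DERIV_chain2[OF DERIV_ln_divide this]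
  have "DERIV (\<lambda>s. ln (c s / (b s - c s))) s :> 1 / (c s / (b s - c s)) * (c s / (b s - c s) * (- 2 * b s * (a s + b s + c s)))"
    using p by simp
  then have "DERIV (\<lambda>s. ln (c s / (b s - c s))) s :> - 2 * b s * (a s + b s + c s)"
    by (rule DERIV_cong) (use p in simp)
  from DERIV_chain2[OF separatrix(3) this]
  have *: "DERIV (\<lambda>s. threshold (b s) (c s)) s :>
      - shape_rate (threshold (b s) (c s)) (c s / b s) * (- 2 * b s * (a s + b s + c s))"
    unfolding logistic_ln[OF p(2,5)] threshold_def .
  have x: "2 * (a s / b s) * ((a s + b s) * (a s + c s - b s)) = offset_rate s * shape_rate (a s / b s) (c s / b s)"
  proof -
    have "1 + a s / b s + c s / b s \<noteq> 0" using p by (intro less_imp_neq[THEN not_sym] add_pos_pos) auto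
    then have "offset_rate s * shape_rate (a s / b s) (c s / b s) =
        2 * b s ^ 2 * (a s / b s * (1 + a s / b s) * (a s / b s + c s / b s - 1))"
      unfolding offset_rate_def shape_rate_def by simp
    also have "\<dots> = 2 * (a s / b s) * ((b s * (1 + a s / b s)) * (b s * (a s / b s + c s / b s - 1)))"
      by (simp add: power2_eq_square)
    also have "b s * (1 + a s / b s) = a s + b s" using p by (simp add: field_simps)
    also have "b s * (a s / b s + c s / b s - 1) = a s + c s - b s" using p by (simp add: field_simps)
    finally show ?thesis by simp
  qed
  have y: "2 * b s * (a s + b s + c s) = offset_rate s"
    using p by (simp add: offset_rate_def field_simps power2_eq_square)
  have y': "- u * (- 2 * b s * (a s + b s + c s)) = offset_rate s * u" for u
    by (simp add: y[symmetric])
  show ?thesis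
    unfolding offset_def[abs_def]
    by (rule DERIV_cong[OF DERIV_diff[OF quotient_derivs(1)[OF s] *]])
       (simp only: x y', simp only: right_diff_distrib)
qed

text \<open>By \<open>shape_rate_diff\<close> the offset solves a homogeneous linear equation with
  continuous coefficient. It therefore stays positive, negative or zero, and the cone over the
  separatrix is invariant.\<close>

lemma offset_sign:
  assumes s: "s \<in> {0..<T}"
  shows "offset 0 > 0 \<Longrightarrow> offset s > 0" "offset 0 < 0 \<Longrightarrow> offset s < 0" "offset 0 = 0 \<Longrightarrow> offset s = 0"
proof -
  have s': "0 \<le> s" "s < T" using s by auto
  define th where "th t = threshold (b t) (c t)" for t
  define g where "g t = offset_rate t * shape_slope (a t / b t) (th t) (c t / b t)" for t
  define D where "D t = offset_rate t * (shape_rate (a t / b t) (c t / b t) - shape_rate (th t) (c t / b t))" for t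
  have p: "a t > 0" "c t > 0" "b t - c t \<noteq> 0" "b t > 0" "c t / (b t - c t) \<noteq> 0" "c t < b t"
    "1 + a t / b t + c t / b t \<noteq> 0" "1 + th t + c t / b t \<noteq> 0" if "t \<in> {0..s}" for t
  proof -
    have t: "t \<in> {0..<T}" using that s by auto
    note q = in_Q[OF t] threshold_pos[of "b t" "c t"]
    then show "a t > 0" "c t > 0" "b t - c t \<noteq> 0" "b t > 0" "c t / (b t - c t) \<noteq> 0" "c t < b t" by auto
    have "a t / b t > 0" "c t / b t > 0" "th t > 0" using q by (auto simp: th_def)
    then show "1 + a t / b t + c t / b t \<noteq> 0" "1 + th t + c t / b t \<noteq> 0" by linarith+
  qed
  have sep: "continuous_on UNIV separatrix"
    using separatrix(3) DERIV_isCont continuous_at_imp_continuous_on by blast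
  note c' = cont[OF order_refl s'(2)]
  have "continuous_on {0..s} (\<lambda>t. ln (c t / (b t - c t)))"
    by (intro continuous_intros c') (use p in auto)
  from continuous_on_compose2[OF sep this] have "continuous_on {0..s} th"
    by (simp add: th_def[abs_def] threshold_def)
  moreover have "\<forall>t\<in>{0..s}. (1 + a t / b t + c t / b t) * (1 + th t + c t / b t) \<noteq> 0"
  proof
    fix t assume "t \<in> {0..s}"
    from p(7,8)[OF this] show "(1 + a t / b t + c t / b t) * (1 + th t + c t / b t) \<noteq> 0"
      by (rule no_zero_divisors)
  qed
  moreover have "\<forall>t\<in>{0..s}. b t \<noteq> 0" by (rule ballI, drule p(4), simp)
  ultimately have cg: "continuous_on {0..s} g"
    unfolding g_def offset_rate_def shape_slope_def by (intro continuous_intros c')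
  have d: "DERIV offset t :> D t" "D t = g t * offset t" if t: "t \<in> {0..s}" for t
  proof -
    have "t \<in> {0..<T}" using t s by auto
    from offset_deriv[OF this] show "DERIV offset t :> D t" by (simp add: D_def th_def)
    show "D t = g t * offset t"
      unfolding D_def g_def shape_rate_diff[OF p(7,8)[OF t]] by (simp add: offset_def th_def)
  qed
  have up: "offset 0 \<ge> 0 \<Longrightarrow> offset s \<ge> 0" "offset 0 > 0 \<Longrightarrow> offset s > 0"
    using linear_inequality_sign[OF s'(1) cg d(1)] d(2) by auto
  have dm: "DERIV (\<lambda>t. - offset t) t :> - D t" if "t \<in> {0..s}" for t by (rule DERIV_minus[OF d(1)[OF that]])
  have down: "- offset 0 \<ge> 0 \<Longrightarrow> - offset s \<ge> 0" "- offset 0 > 0 \<Longrightarrow> - offset s > 0"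
    using linear_inequality_sign[OF s'(1) cg dm] d(2) by auto
  show "offset 0 > 0 \<Longrightarrow> offset s > 0" "offset 0 < 0 \<Longrightarrow> offset s < 0" "offset 0 = 0 \<Longrightarrow> offset s = 0"
    using up down by linarith+
qed

lemma wedge_iff:
  assumes s: "s \<in> {0..<T}"
  shows "b s \<le> a s + c s \<longleftrightarrow> 1 - c s / b s \<le> a s / b s" "a s \<le> b s \<longleftrightarrow> a s / b s \<le> 1"
proof -
  have b: "b s > 0" by (rule in_Q[OF s])
  then have "1 - c s / b s = (b s - c s) / b s" by (simp add: diff_divide_distrib)
  then have "1 - c s / b s \<le> a s / b s \<longleftrightarrow> b s - c s \<le> a s"
    using b by (simp add: divide_le_cancel)
  then show "b s \<le> a s + c s \<longleftrightarrow> 1 - c s / b s \<le> a s / b s" by linarith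
  show "a s \<le> b s \<longleftrightarrow> a s / b s \<le> 1" using b by simp
qed

end

context blowup_flow
begin

text \<open>Here the closing of the wedge at (1, 0) enters: \<open>a / b\<close> and the threshold
  are both squeezed to 1.\<close>

lemma wedge_offset_tendsto_0:
  assumes wedge: "\<And>s. s \<in> {0..<T} \<Longrightarrow> a s \<le> b s \<and> b s \<le> a s + c s"
  shows "(offset \<longlongrightarrow> 0) (at_left T)"
proof -
  note lim = wedge_ratio_limits[OF wedge]
  have "((\<lambda>s. threshold (b s) (c s)) \<longlongrightarrow> 1) (at_left T)"
  proof (rule tendsto_sandwich[OF _ _ _ tendsto_const])
    from tendsto_diff[OF tendsto_const[of 1] lim(4)] show "((\<lambda>s. 1 - c s / b s) \<longlongrightarrow> 1) (at_left T)" by simp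
    show "\<forall>\<^sub>F s in at_left T. 1 - c s / b s \<le> threshold (b s) (c s)"
      by (rule eventually_at_leftI_ge[OF T_pos], rule threshold_bounds) (use in_Q in auto)
    show "\<forall>\<^sub>F s in at_left T. threshold (b s) (c s) \<le> 1"
      by (rule eventually_at_leftI_ge[OF T_pos], rule threshold_bounds) (use in_Q in auto)
  qed
  from tendsto_diff[OF lim(5) this] show ?thesis by (simp add: offset_def[abs_def])
qed

text \<open>An orbit above the separatrix is above the lower edge, so staying below
  \<open>x = 1\<close> would keep both in the wedge. There \<open>shape_rate\<close> is monotone,
  hence the offset could not decrease from its positive initial value, although it would have to
  tend to 0.\<close>

lemma positive_offset_leaves_wedge:
  assumes "offset 0 > 0"
  shows "\<exists>s\<in>{0..<T}. a s > b s"
proof (rule ccontr)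
  assume "\<not> ?thesis"
  then have le: "a s \<le> b s" if "s \<in> {0..<T}" for s using that by force
  have pos: "threshold (b s) (c s) < a s / b s" if "s \<in> {0..<T}" for s
    using offset_sign(1)[OF that assms] by (simp add: offset_def)
  have th: "1 - c s / b s \<le> threshold (b s) (c s)" if "s \<in> {0..<T}" for s
    using threshold_bounds(1) in_Q[OF that] by simp
  have wedge: "a s \<le> b s \<and> b s \<le> a s + c s" if s: "s \<in> {0..<T}" for s
    using le[OF s] wedge_iff(1)[OF s] pos[OF s] th[OF s] by linarith
  have ge: "offset 0 \<le> offset s" if s: "s \<in> {0..<T}" for s
  proof (rule deriv_nonneg_imp_le[where f = offset])
    fix t assume "t \<in> {0..s}"
    then have t: "t \<in> {0..<T}" using s by auto
    show "DERIV offset t :> offset_rate t *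
      (shape_rate (a t / b t) (c t / b t) - shape_rate (threshold (b t) (c t)) (c t / b t))"
      by (rule offset_deriv[OF t])
    have "shape_rate (threshold (b t) (c t)) (c t / b t) \<le> shape_rate (a t / b t) (c t / b t)"
      using in_Q[OF t] th[OF t] pos[OF t] by (intro shape_rate_mono) auto
    then show "0 \<le> offset_rate t *
      (shape_rate (a t / b t) (c t / b t) - shape_rate (threshold (b t) (c t)) (c t / b t))"
      using offset_rate_pos[OF t] by simp
  qed (use s in auto)
  have "offset 0 \<le> 0"
    by (rule tendsto_lowerbound[OF wedge_offset_tendsto_0[OF wedge]])
       (use ge in \<open>auto intro!: eventually_at_leftI_ge[OF T_pos]\<close>)
  with assms show False by simp
qed

lemma negative_offset_leaves_wedge:
  assumes "offset 0 < 0"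
  shows "\<exists>s\<in>{0..<T}. b s > a s + c s"
proof (rule ccontr)
  assume "\<not> ?thesis"
  then have le: "b s \<le> a s + c s" if "s \<in> {0..<T}" for s using that by force
  have neg: "a s / b s < threshold (b s) (c s)" if "s \<in> {0..<T}" for s
    using offset_sign(2)[OF that assms] by (simp add: offset_def)
  have th: "threshold (b s) (c s) \<le> 1" if "s \<in> {0..<T}" for s
    using threshold_bounds(2) in_Q[OF that] by simp
  have wedge: "a s \<le> b s \<and> b s \<le> a s + c s" if s: "s \<in> {0..<T}" for s
    using le[OF s] wedge_iff(2)[OF s] neg[OF s] th[OF s] by linarith
  have ge: "offset s \<le> offset 0" if s: "s \<in> {0..<T}" for s
  proof (rule deriv_nonpos_imp_ge[where f = offset])
    fix t assume "t \<in> {0..s}"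
    then have t: "t \<in> {0..<T}" using s by auto
    show "DERIV offset t :> offset_rate t *
      (shape_rate (a t / b t) (c t / b t) - shape_rate (threshold (b t) (c t)) (c t / b t))"
      by (rule offset_deriv[OF t])
    have "shape_rate (a t / b t) (c t / b t) \<le> shape_rate (threshold (b t) (c t)) (c t / b t)"
      using in_Q[OF t] wedge[OF t] wedge_iff(1)[OF t] neg[OF t] by (intro shape_rate_mono) auto
    then show "offset_rate t *
      (shape_rate (a t / b t) (c t / b t) - shape_rate (threshold (b t) (c t)) (c t / b t)) \<le> 0"
      using offset_rate_pos[OF t] by (simp add: mult_nonneg_nonpos)
  qed (use s in auto)
  have "0 \<le> offset 0"
    by (rule tendsto_upperbound[OF wedge_offset_tendsto_0[OF wedge]])
       (use ge in \<open>auto intro!: eventually_at_leftI_ge[OF T_pos]\<close>)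
  with assms show False by simp
qed

lemma zero_offset_in_wedge:
  assumes "offset 0 = 0" and s: "s \<in> {0..<T}"
  shows "a s \<le> b s \<and> b s \<le> a s + c s"
  using offset_sign(3)[OF s assms(1)] threshold_bounds[of "c s" "b s"] in_Q[OF s] wedge_iff[OF s]
  by (simp add: offset_def)

end

section \<open>From maximal solutions to the backward flow\<close>

lemma maximal_solutionD:
  assumes "maximal_solution Tb Tf A B C"
  shows "0 < Tb" "0 < Tf" "flow_solution_on (time_interval Tb Tf) A B C"
    and "Tb \<le> Tb' \<Longrightarrow> Tf \<le> Tf' \<Longrightarrow> flow_solution_on (time_interval Tb' Tf') A' B' C' \<Longrightarrow>
      (\<And>t. t \<in> time_interval Tb Tf \<Longrightarrow> A' t = A t \<and> B' t = B t \<and> C' t = C t) \<Longrightarrow> Tb' = Tb \<and> Tf' = Tf"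
proof -
  note * = assms[unfolded maximal_solution_def]
  show "0 < Tb" by (rule conjunct1[OF *])
  show "0 < Tf" by (rule conjunct1[OF conjunct2[OF *]])
  show "flow_solution_on (time_interval Tb Tf) A B C" by (rule conjunct1[OF conjunct2[OF conjunct2[OF *]]])
  show "Tb' = Tb \<and> Tf' = Tf" if "Tb \<le> Tb'" "Tf \<le> Tf'" "flow_solution_on (time_interval Tb' Tf') A' B' C'"
    "\<And>t. t \<in> time_interval Tb Tf \<Longrightarrow> A' t = A t \<and> B' t = B t \<and> C' t = C t"
    by (rule conjunct2[OF conjunct2[OF conjunct2[OF *]], rule_format, of Tb' Tf' A' B' C'])
       (intro conjI ballI that)
qed

text \<open>An infinite \<open>Tb\<close> would allow backward flows of any length, against
  \<open>lifespan_bound\<close>. If \<open>a + b\<close> were bounded, \<open>0 < c < b\<close>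
  would bound the whole solution, and it would extend to the left with the same \<open>Tf\<close>,
  against maximality.\<close>

theorem maximal_solution_blowup:
  assumes max: "maximal_solution Tb Tf A B C" and inQ: "(A 0, B 0, C 0) \<in> Q"
  obtains T where "Tb = ereal T" "blowup_flow T (\<lambda>s. A (- s)) (\<lambda>s. B (- s)) (\<lambda>s. C (- s))"
proof -
  note Tb = maximal_solutionD(1)[OF max] and Tf = maximal_solutionD(2)[OF max]
    and sol = maximal_solutionD(3)[OF max]
  have neg: "- (2/3 * (- x + y)) = 2/3 * (x - y)" for x y :: real by (simp add: field_simps)
  have bflow: "backward_flow T (\<lambda>s. A (- s)) (\<lambda>s. B (- s)) (\<lambda>s. C (- s))" if T: "0 < T" "ereal T \<le> Tb" for T
  proof
    fix s assume s: "s \<in> {0..<T}"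
    have "- s \<in> time_interval Tb Tf"
      using s T Tf by (cases Tb; cases Tf) (auto simp: time_interval_iff)
    then have d: "DERIV A (- s) :> 2/3 * (- ((A (- s))^2 * (2 * A (- s) + B (- s) + C (- s))) + A (- s) * (B (- s) - C (- s))^2)"
      "DERIV B (- s) :> 2/3 * (- ((B (- s))^2 * (2 * B (- s) + A (- s) - C (- s))) + B (- s) * (A (- s) + C (- s))^2)"
      "DERIV C (- s) :> 2/3 * (- ((C (- s))^2 * (2 * C (- s) + A (- s) - B (- s))) + C (- s) * (A (- s) + B (- s))^2)"
      using sol unfolding flow_solution_on_def by blast+
    show "DERIV (\<lambda>s. A (- s)) s :> 2/3 * ((A (- s))^2 * (2 * A (- s) + B (- s) + C (- s)) - A (- s) * (B (- s) - C (- s))^2)"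
      by (rule DERIV_cong[OF iffD1[OF DERIV_mirror d(1)] neg])
    show "DERIV (\<lambda>s. B (- s)) s :> 2/3 * ((B (- s))^2 * (2 * B (- s) + A (- s) - C (- s)) - B (- s) * (A (- s) + C (- s))^2)"
      by (rule DERIV_cong[OF iffD1[OF DERIV_mirror d(2)] neg])
    show "DERIV (\<lambda>s. C (- s)) s :> 2/3 * ((C (- s))^2 * (2 * C (- s) + A (- s) - B (- s)) - C (- s) * (A (- s) + B (- s))^2)"
      by (rule DERIV_cong[OF iffD1[OF DERIV_mirror d(3)] neg])
  qed (use T inQ in auto)
  have "Tb \<noteq> \<infinity>"
  proof
    assume "Tb = \<infinity>"
    \<comment> \<open>One more than the largest possible lifespan.\<close>
    define N where "N = 3/2 / (A 0 + B 0 - C 0) ^ 2 + 1"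
    have "N > 0" unfolding N_def by (intro add_nonneg_pos) auto
    then have "N \<le> 3/2 / (A 0 + B 0 - C 0) ^ 2"
      using backward_flow.lifespan_bound[OF bflow[of N]] \<open>Tb = \<infinity>\<close> by simp
    then show False by (simp add: N_def)
  qed
  with Tb obtain T where T: "Tb = ereal T" by (cases Tb) auto
  then have "T > 0" using Tb by simp
  interpret backward_flow T "\<lambda>s. A (- s)" "\<lambda>s. B (- s)" "\<lambda>s. C (- s)"
    by (rule bflow) (use T \<open>T > 0\<close> in auto)
  have "\<exists>s\<in>{0..<T}. A (- s) + B (- s) > R" for R
  proof (rule ccontr)
    assume "\<not> ?thesis"
    then have R: "A (- s) + B (- s) \<le> R" if "s \<in> {0..<T}" for s using that by force
    have bd: "norm (A t, B t, C t) \<le> 2 * R" if "t \<in> {-T<..0}" for t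
    proof -
      have s: "- t \<in> {0..<T}" using that by auto
      have "norm (A t, B t, C t) \<le> norm (A t) + (norm (B t) + norm (C t))"
        by (intro order_trans[OF norm_Pair_le] add_left_mono norm_Pair_le)
      then show ?thesis using in_Q[OF s] R[OF s] by simp
    qed
    have "ode_solution flow_field (ereal T) Tf (\<lambda>t. (A t, B t, C t))"
      using sol unfolding T flow_solution_on_iff_ode_solution .
    from bounded_ode_solution_extends[OF lipschitz_on_balls_flow_field this \<open>T > 0\<close> Tf bd]
    obtain T' v where v: "T' > T" "ode_solution flow_field (ereal T') Tf v"
      "\<And>t. t \<in> time_interval (ereal T) Tf \<Longrightarrow> v t = (A t, B t, C t)" by blast
    have "flow_solution_on (time_interval (ereal T') Tf) (\<lambda>t. fst (v t)) (\<lambda>t. fst (snd (v t))) (\<lambda>t. snd (snd (v t)))"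
      using v(2) by (simp add: flow_solution_on_iff_ode_solution)
    from maximal_solutionD(4)[OF max _ order_refl this] have "ereal T' = ereal T"
      using v(1,3) by (simp add: T)
    with v(1) show False by simp
  qed
  then have "blowup_flow T (\<lambda>s. A (- s)) (\<lambda>s. B (- s)) (\<lambda>s. C (- s))"
    by unfold_locales
  with T show ?thesis by (rule that)
qed

section \<open>Asymptotic equivalence at the left endpoint\<close>

lemma tendsto_at_right_minus:
  "((\<lambda>t. f (- t)) \<longlongrightarrow> l) (at_right (- T)) \<longleftrightarrow> (f \<longlongrightarrow> l) (at_left T)" for T :: real
  by (subst at_right_minus) (simp add: filterlim_filtermap)

lemma eventually_shift_pos: "\<forall>\<^sub>F t in at_right (- T). t + T > 0" for T :: real
  using eventually_at_right_less[of "- T"] by eventually_elim simp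

lemma asymp_equiv_shift_powr_iff:
  fixes T k p :: real
  assumes "k > 0"
  shows "f \<sim>[at_right (- T)] (\<lambda>t. k * (t + T) powr p) \<longleftrightarrow>
    ((\<lambda>t. f t / (t + T) powr p) \<longlongrightarrow> k) (at_right (- T))"
proof
  assume "f \<sim>[at_right (- T)] (\<lambda>t. k * (t + T) powr p)"
  then have "((\<lambda>t. f t / (k * (t + T) powr p)) \<longlongrightarrow> 1) (at_right (- T))"
    by (rule asymp_equivD_strong) (rule eventually_mono[OF eventually_shift_pos], use assms in auto)
  from tendsto_mult[OF tendsto_const[of k] this] assms
  show "((\<lambda>t. f t / (t + T) powr p) \<longlongrightarrow> k) (at_right (- T))" by simp
next
  assume "((\<lambda>t. f t / (t + T) powr p) \<longlongrightarrow> k) (at_right (- T))"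
  then show "f \<sim>[at_right (- T)] (\<lambda>t. k * (t + T) powr p)"
    by (rule asymp_equivI'_const) (use assms in simp)
qed

text \<open>The exponents differ by 3/4, so the smaller rate would make the quotient by the larger
  one tend to 0 instead of \<open>k\<close>. This separates the three behaviours.\<close>

lemma rates_incompatible:
  fixes T k m :: real
  assumes "f \<sim>[at_right (- T)] (\<lambda>t. k * (t + T) powr (- 1/2))" "k > 0"
    and "f \<sim>[at_right (- T)] (\<lambda>t. m * (t + T) powr (1/4))" "m > 0"
  shows False
proof -
  have f1: "((\<lambda>t. f t / (t + T) powr (- 1/2)) \<longlongrightarrow> k) (at_right (- T))"
    and f2: "((\<lambda>t. f t / (t + T) powr (1/4)) \<longlongrightarrow> m) (at_right (- T))"
    using asymp_equiv_shift_powr_iff[of k f T "- 1/2"] asymp_equiv_shift_powr_iff[of m f T "1/4"] assms by auto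
  have "((\<lambda>t. t + T) \<longlongrightarrow> - T + T) (at_right (- T))" by (intro tendsto_intros)
  then have "((\<lambda>t. (t + T) powr (3/4)) \<longlongrightarrow> 0) (at_right (- T))"
    by (intro tendsto_zero_powrI tendsto_const eventually_mono[OF eventually_shift_pos]) auto
  from tendsto_mult[OF f2 this]
  have "((\<lambda>t. f t / (t + T) powr (1/4) * (t + T) powr (3/4)) \<longlongrightarrow> 0) (at_right (- T))" by simp
  moreover have "\<forall>\<^sub>F t in at_right (- T). f t / (t + T) powr (1/4) * (t + T) powr (3/4) = f t / (t + T) powr (- 1/2)"
    using eventually_shift_pos
  proof eventually_elim
    case (elim t)
    then have *: "(t + T) powr (3/4) / (t + T) powr (1/4) = 1 / (t + T) powr (- 1/2)"
      by (simp add: powr_diff[symmetric] powr_minus_divide)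
    have "f t / (t + T) powr (1/4) * (t + T) powr (3/4) = f t * ((t + T) powr (3/4) / (t + T) powr (1/4))"
      by simp
    also have "\<dots> = f t / (t + T) powr (- 1/2)" unfolding * by simp
    finally show ?case .
  qed
  ultimately have "((\<lambda>t. f t / (t + T) powr (- 1/2)) \<longlongrightarrow> 0) (at_right (- T))"
    by (rule Lim_transform_eventually)
  from tendsto_unique[OF _ f1 this] assms(2) show False by simp
qed

lemma asymp_half:
  fixes T k :: real
  assumes "((\<lambda>s. A (- s) * sqrt (T - s)) \<longlongrightarrow> k) (at_left T)" "k > 0"
  shows "A \<sim>[at_right (- T)] (\<lambda>t. k * (t + T) powr (- 1/2))"
proof -
  have "((\<lambda>t. A (- (- t)) * sqrt (T - (- t))) \<longlongrightarrow> k) (at_right (- T))"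
    using assms(1) tendsto_at_right_minus[of "\<lambda>s. A (- s) * sqrt (T - s)" k T] by blast
  then have 1: "((\<lambda>t. A t * sqrt (t + T)) \<longlongrightarrow> k) (at_right (- T))" by (simp add: add.commute)
  have 2: "\<forall>\<^sub>F t in at_right (- T). A t * sqrt (t + T) = A t / (t + T) powr (- 1/2)"
    using eventually_shift_pos by eventually_elim (simp add: powr_minus_divide powr_half_sqrt)
  from Lim_transform_eventually[OF 1 2] asymp_equiv_shift_powr_iff[OF assms(2)] show ?thesis by blast
qed

lemma asymp_power:
  fixes T k p :: real
  assumes "((\<lambda>s. A (- s) / (T - s) powr p) \<longlongrightarrow> k) (at_left T)" "k > 0"
  shows "A \<sim>[at_right (- T)] (\<lambda>t. k * (t + T) powr p)"
proof -
  have "((\<lambda>t. A (- (- t)) / (T - (- t)) powr p) \<longlongrightarrow> k) (at_right (- T))"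
    using assms(1) tendsto_at_right_minus[of "\<lambda>s. A (- s) / (T - s) powr p" k T] by blast
  then have "((\<lambda>t. A t / (t + T) powr p) \<longlongrightarrow> k) (at_right (- T))" by (simp add: add.commute)
  with asymp_equiv_shift_powr_iff[OF assms(2)] show ?thesis by blast
qed

text \<open>The factor \<open>b\<close> preserves the sign of the offset and makes it affine in
  \<open>a\<close> with slope 1, so that straightening its zero set is a shear.\<close>

definition surface_offset :: "real \<times> real \<times> real \<Rightarrow> real" where
  "surface_offset = (\<lambda>(a, b, c). a - b * threshold b c)"

definition separating_surface :: "(real \<times> real \<times> real) set" where
  "separating_surface = {x \<in> Q. surface_offset x = 0}"

definition edge_behavior :: "real \<Rightarrow> (real \<Rightarrow> real) \<Rightarrow> (real \<Rightarrow> real) \<Rightarrow> (real \<Rightarrow> real) \<Rightarrow> bool" where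
  "edge_behavior T A B C \<longleftrightarrow>
     A \<sim>[at_right (- T)] B \<and>
     B \<sim>[at_right (- T)] (\<lambda>t. sqrt 6 / 4 * (t + T) powr (- 1/2)) \<and>
     (A 0 * B 0 * C 0 = 4 \<longrightarrow> C \<sim>[at_right (- T)] (\<lambda>t. 32/3 * (t + T)))"

theorem maximal_solution_trichotomy:
  assumes max: "maximal_solution Tb Tf A B C" and inQ: "(A 0, B 0, C 0) \<in> Q"
  obtains T where "Tb = ereal T"
    "surface_offset (A 0, B 0, C 0) > 0 \<Longrightarrow> behavior1 T A B C"
    "surface_offset (A 0, B 0, C 0) < 0 \<Longrightarrow> behavior2 T A B C"
    "surface_offset (A 0, B 0, C 0) = 0 \<Longrightarrow> edge_behavior T A B C"
proof -
  obtain T where T: "Tb = ereal T" and bf: "blowup_flow T (\<lambda>s. A (- s)) (\<lambda>s. B (- s)) (\<lambda>s. C (- s))"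
    by (rule maximal_solution_blowup[OF max inQ])
  interpret blowup_flow T "\<lambda>s. A (- s)" "\<lambda>s. B (- s)" "\<lambda>s. C (- s)" by (rule bf)
  have k: "sqrt 6 / 4 > (0::real)" by simp
  have B0: "B 0 > 0" using inQ by (simp add: Q_def)
  have "surface_offset (A 0, B 0, C 0) = B 0 * offset 0"
    using B0 by (simp add: surface_offset_def offset_def field_simps)
  then have off: "surface_offset (A 0, B 0, C 0) > 0 \<longleftrightarrow> offset 0 > 0"
    "surface_offset (A 0, B 0, C 0) < 0 \<longleftrightarrow> offset 0 < 0" "surface_offset (A 0, B 0, C 0) = 0 \<longleftrightarrow> offset 0 = 0"
    using B0 by (auto simp: zero_less_mult_iff mult_less_0_iff)
  have 1: "behavior1 T A B C" if pos: "surface_offset (A 0, B 0, C 0) > 0"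
  proof -
    obtain s1 where s1: "s1 \<in> {0..<T}" "A (- s1) > B (- s1)"
      using positive_offset_leaves_wedge off(1) pos by blast
    note asym = a_dominates[OF s1]
    show ?thesis unfolding behavior1_def
      using asymp_half[OF asym(1) k] asym(2,3) asymp_power by blast
  qed
  have 2: "behavior2 T A B C" if neg: "surface_offset (A 0, B 0, C 0) < 0"
  proof -
    obtain s1 where s1: "s1 \<in> {0..<T}" "B (- s1) > A (- s1) + C (- s1)"
      using negative_offset_leaves_wedge off(2) neg by blast
    note asym = b_dominates[OF s1]
    show ?thesis unfolding behavior2_def
      using asymp_half[OF asym(1) k] asym(2,3) asymp_power by blast
  qed
  have 3: "edge_behavior T A B C" if "surface_offset (A 0, B 0, C 0) = 0"
  proof -
    have wedge: "A (- s) \<le> B (- s) \<and> B (- s) \<le> A (- s) + C (- s)" if "s \<in> {0..<T}" for s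
      using zero_offset_in_wedge[OF _ that] off(3) \<open>surface_offset (A 0, B 0, C 0) = 0\<close> by blast
    note asym = wedge_asymptotics[OF wedge]
    have B: "B \<sim>[at_right (- T)] (\<lambda>t. sqrt 6 / 4 * (t + T) powr (- 1/2))" by (rule asymp_half[OF asym(2) k])
    have A: "A \<sim>[at_right (- T)] (\<lambda>t. sqrt 6 / 4 * (t + T) powr (- 1/2))" by (rule asymp_half[OF asym(1) k])
    have "A \<sim>[at_right (- T)] B" using asymp_equiv_trans[OF A asymp_equiv_symI[OF B]] .
    moreover have "C \<sim>[at_right (- T)] (\<lambda>t. 32/3 * (t + T))" if K: "A 0 * B 0 * C 0 = 4"
    proof (rule asymp_equivI'_const)
      have "8/3 * (A (- 0) * B (- 0) * C (- 0)) = 32/3" using K by simp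
      with asym(3) have "((\<lambda>s. C (- s) / (T - s)) \<longlongrightarrow> 32/3) (at_left T)" by metis
      then have "((\<lambda>t. C (- (- t)) / (T - (- t))) \<longlongrightarrow> 32/3) (at_right (- T))"
        using tendsto_at_right_minus[of "\<lambda>s. C (- s) / (T - s)" "32/3" T] by blast
      then show "((\<lambda>t. C t / (t + T)) \<longlongrightarrow> 32/3) (at_right (- T))" by (simp add: add.commute)
    qed simp
    ultimately show ?thesis using B unfolding edge_behavior_def by blast
  qed
  from T 1 2 3 show ?thesis by (rule that)
qed

text \<open>In each pair some coefficient would both blow up and vanish: \<open>A\<close> in the
  first and third, \<open>B\<close> in the second.\<close>

lemma behaviors_incompatible:
  "behavior1 T A B C \<Longrightarrow> behavior2 T A B C \<Longrightarrow> False"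
  "behavior1 T A B C \<Longrightarrow> edge_behavior T A B C \<Longrightarrow> False"
  "behavior2 T A B C \<Longrightarrow> edge_behavior T A B C \<Longrightarrow> False"
proof -
  have k: "sqrt 6 / 4 > (0::real)" by simp
  show False if "behavior1 T A B C" "behavior2 T A B C"
    using that rates_incompatible[of A T "sqrt 6 / 4"] k unfolding behavior1_def behavior2_def by blast
  show False if "behavior1 T A B C" "edge_behavior T A B C"
    using that rates_incompatible[of B T "sqrt 6 / 4"] k unfolding behavior1_def edge_behavior_def by blast
  show False if "behavior2 T A B C" "edge_behavior T A B C"
    using that rates_incompatible[of A T "sqrt 6 / 4"] k asymp_equiv_trans[of A "at_right (- T)" B]
    unfolding behavior2_def edge_behavior_def by blast
qed

text \<open>\<open>Q1\<close> and \<open>Q2\<close> ask for some maximal solution with the given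
  behaviour. Existence of a maximal solution and the trichotomy give one inclusion; for the other,
  the wrong sign would force an incompatible behaviour on the same solution.\<close>

theorem Q1_eq: "Q1 = {x \<in> Q. surface_offset x > 0}" and Q2_eq: "Q2 = {x \<in> Q. surface_offset x < 0}"
proof -
  have sol: "behavior1 T A B C \<longleftrightarrow> surface_offset x > 0" "behavior2 T A B C \<longleftrightarrow> surface_offset x < 0"
    if m: "maximal_solution (ereal T) Tf A B C" "(A 0, B 0, C 0) = x" "x \<in> Q" for T Tf A B C x
  proof -
    obtain T' where "ereal T = ereal T'"
      "surface_offset x > 0 \<Longrightarrow> behavior1 T' A B C" "surface_offset x < 0 \<Longrightarrow> behavior2 T' A B C"
      "surface_offset x = 0 \<Longrightarrow> edge_behavior T' A B C"
      by (rule maximal_solution_trichotomy[OF m(1), unfolded m(2), OF m(3)]) (rule that)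
    then have *: "surface_offset x > 0 \<Longrightarrow> behavior1 T A B C" "surface_offset x < 0 \<Longrightarrow> behavior2 T A B C"
      "surface_offset x = 0 \<Longrightarrow> edge_behavior T A B C" by auto
    note no = behaviors_incompatible[of T A B C]
    have "\<not> behavior1 T A B C \<and> \<not> behavior2 T A B C" if "surface_offset x = 0" using *(3)[OF that] no(2,3) by blast
    moreover have "\<not> behavior2 T A B C" if "surface_offset x > 0" using *(1)[OF that] no(1) by blast
    moreover have "\<not> behavior1 T A B C" if "surface_offset x < 0" using *(2)[OF that] no(1) by blast
    ultimately show "behavior1 T A B C \<longleftrightarrow> surface_offset x > 0" "behavior2 T A B C \<longleftrightarrow> surface_offset x < 0"
      using *(1,2) by (metis linorder_cases)+
  qed
  have ex: "\<exists>T Tf A B C. maximal_solution (ereal T) Tf A B C \<and> (A 0, B 0, C 0) = x" if x: "x \<in> Q" for x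
  proof -
    obtain Tb Tf A B C where m: "maximal_solution Tb Tf A B C" "(A 0, B 0, C 0) = x"
      by (rule maximal_solution_exists)
    have "(A 0, B 0, C 0) \<in> Q" using m x by simp
    then obtain T where "Tb = ereal T" by (rule maximal_solution_blowup[OF m(1)]) (rule that)
    with m show ?thesis by blast
  qed
  show "Q1 = {x \<in> Q. surface_offset x > 0}" unfolding Q1_def using sol(1) ex by fast
  show "Q2 = {x \<in> Q. surface_offset x < 0}" unfolding Q2_def using sol(2) ex by fast
qed

section \<open>The separating surface\<close>

text \<open>Higher derivatives are iterated through \<open>frechet_derivative\<close>; on an open
  set this operator only sees values in the set, so explicit formulas valid there may replace it at
  every level.\<close>

lemma C_k_on_cong:
  assumes "open S" "\<And>x. x \<in> S \<Longrightarrow> f x = g x" "C_k_on k S f"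
  shows "C_k_on k S g"
  using assms(2,3)
proof (induction k arbitrary: f g)
  case 0
  then have "continuous_on S f" by simp
  then have "continuous_on S g" by (rule continuous_on_eq) (rule 0)
  then show ?case by simp
next
  case (Suc k)
  have f: "\<And>x. x \<in> S \<Longrightarrow> f differentiable (at x)" "\<And>v. C_k_on k S (\<lambda>x. frechet_derivative f (at x) v)"
    using Suc.prems(2) by simp_all
  have "g differentiable (at x)" if x: "x \<in> S" for x
  proof -
    obtain f' where "(f has_derivative f') (at x)" using f(1)[OF x] unfolding differentiable_def by blast
    from has_derivative_transform_within_open[OF this assms(1) x Suc.prems(1)]
    show ?thesis unfolding differentiable_def by blast
  qed
  moreover have "C_k_on k S (\<lambda>x. frechet_derivative g (at x) v)" for v
  proof (rule Suc.IH[OF _ f(2)[of v]])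
    fix x assume x: "x \<in> S"
    show "frechet_derivative f (at x) v = frechet_derivative g (at x) v"
      using frechet_derivative_transform_within_open[OF f(1)[OF x] assms(1) x Suc.prems(1)] by simp
  qed
  ultimately show ?case by simp
qed

text \<open>A family closed under directional derivatives can be differentiated forever, so a single
  induction on the order settles all its members at once.\<close>

lemma smooth_on_family:
  assumes "open S" and F: "\<And>f. f \<in> F \<Longrightarrow> \<exists>f'. (\<forall>x\<in>S. (f has_derivative f' x) (at x)) \<and> (\<forall>v. (\<lambda>x. f' x v) \<in> F)"
    and "f \<in> F"
  shows "smooth_on S f"
proof -
  have "C_k_on k S f" if "f \<in> F" for k f
    using that
  proof (induction k arbitrary: f)
    case 0
    obtain f' where "\<And>x. x \<in> S \<Longrightarrow> (f has_derivative f' x) (at x)" using F[OF 0] by blast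
    then have "continuous_on S f"
      by (intro continuous_at_imp_continuous_on ballI) (rule has_derivative_continuous)
    then show ?case by simp
  next
    case (Suc k)
    obtain f' where f': "\<And>x. x \<in> S \<Longrightarrow> (f has_derivative f' x) (at x)" "\<And>v. (\<lambda>x. f' x v) \<in> F"
      using F[OF Suc.prems] by blast
    have "C_k_on k S (\<lambda>x. frechet_derivative f (at x) v)" for v
      by (rule C_k_on_cong[OF \<open>open S\<close> _ Suc.IH[OF f'(2)[of v]]])
         (simp add: fun_cong[OF frechet_derivative_at[OF f'(1)]])
    moreover have "\<forall>x\<in>S. f differentiable (at x)" using f'(1) unfolding differentiable_def by blast
    ultimately show ?case by simp
  qed
  with \<open>f \<in> F\<close> show ?thesis by (simp add: smooth_on_def)
qed

text \<open>\<open>Q\<close> freed from the condition on \<open>a\<close>. A shear in the direction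
  of \<open>a\<close> maps this set onto itself, whereas it moves the face \<open>a = 0\<close> of
  \<open>Q\<close>.\<close>

definition slab :: "(real \<times> real \<times> real) set" where
  "slab = {(a, b, c). c < b \<and> 0 < c}"

lemma slab_iff: "x \<in> slab \<longleftrightarrow> snd (snd x) < fst (snd x) \<and> 0 < snd (snd x)"
  by (auto simp: slab_def)

lemma Q_iff: "x \<in> Q \<longleftrightarrow> 0 < fst x \<and> x \<in> slab"
  by (auto simp: slab_def Q_def)

lemma open_slab: "open slab"
proof -
  have eq: "slab = {x. snd (snd x) < fst (snd x)} \<inter> {x. 0 < snd (snd x)}" by (auto simp: slab_iff)
  show ?thesis unfolding eq by (intro open_Int open_Collect_less continuous_intros)
qed

lemma open_Q: "open Q"
proof -
  have eq: "Q = {x. 0 < fst x} \<inter> slab" by (auto simp: Q_iff)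
  show ?thesis unfolding eq by (intro open_Int open_slab open_Collect_less continuous_intros)
qed

text \<open>The separatrix solves a rational differential equation, so adjoining its values to the
  coordinate functions gives a ring that is closed under directional derivatives.\<close>

inductive_set chart_functions :: "(real \<times> real \<times> real \<Rightarrow> real) set" where
  const: "(\<lambda>_. r) \<in> chart_functions"
| coord_a: "(\<lambda>x. fst x) \<in> chart_functions"
| coord_b: "(\<lambda>x. fst (snd x)) \<in> chart_functions"
| coord_c: "(\<lambda>x. snd (snd x)) \<in> chart_functions"
| threshold: "(\<lambda>x. threshold (fst (snd x)) (snd (snd x))) \<in> chart_functions"
| add: "f \<in> chart_functions \<Longrightarrow> g \<in> chart_functions \<Longrightarrow> (\<lambda>x. f x + g x) \<in> chart_functions"
| mult: "f \<in> chart_functions \<Longrightarrow> g \<in> chart_functions \<Longrightarrow> (\<lambda>x. f x * g x) \<in> chart_functions"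
| inverse: "f \<in> chart_functions \<Longrightarrow> (\<And>x. x \<in> slab \<Longrightarrow> f x \<noteq> 0) \<Longrightarrow> (\<lambda>x. inverse (f x)) \<in> chart_functions"

lemma chart_functions_minus:
  assumes "f \<in> chart_functions"
  shows "(\<lambda>x. - f x) \<in> chart_functions"
proof -
  have "(\<lambda>x. - 1 * f x) \<in> chart_functions" by (intro chart_functions.intros assms)
  then show ?thesis by simp
qed

lemma chart_functions_diff:
  assumes "f \<in> chart_functions" "g \<in> chart_functions"
  shows "(\<lambda>x. f x - g x) \<in> chart_functions"
  using chart_functions.add[OF assms(1) chart_functions_minus[OF assms(2)]] by simp

text \<open>The logarithm of the quotient is differentiated as a difference of logarithms. The
  result is written with products and inverses only, to match the rules of
  \<open>chart_functions\<close>; the threshold itself is the only transcendental function in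
  it.\<close>

lemma threshold_has_derivative:
  assumes x: "x \<in> slab"
  defines "b \<equiv> fst (snd x)" and "c \<equiv> snd (snd x)"
  shows "((\<lambda>x. threshold (fst (snd x)) (snd (snd x))) has_derivative
    (\<lambda>v. - (threshold b c * (1 + threshold b c) * (threshold b c + c * inverse b - 1) *
            inverse (1 + threshold b c + c * inverse b)) *
         (snd (snd v) * inverse c - (fst (snd v) - snd (snd v)) * inverse (b - c)))) (at x)"
proof -
  have p: "0 < c" "c < b" "0 < b" using x by (auto simp: slab_iff b_def c_def)
  have eq: "ln (snd (snd y)) - ln (fst (snd y) - snd (snd y)) = ln (snd (snd y) / (fst (snd y) - snd (snd y)))"
    if "y \<in> slab" for y :: "real \<times> real \<times> real"
    using that by (simp add: slab_iff ln_div)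
  have "((\<lambda>x. ln (snd (snd x)) - ln (fst (snd x) - snd (snd x))) has_derivative
      (\<lambda>v. snd (snd v) * inverse c - (fst (snd v) - snd (snd v)) * inverse (b - c))) (at x)"
    using p unfolding b_def c_def
    by (auto intro!: derivative_eq_intros simp: divide_inverse)
  from has_derivative_transform_within_open[OF this open_slab x eq]
  have "((\<lambda>x. ln (snd (snd x) / (fst (snd x) - snd (snd x)))) has_derivative
      (\<lambda>v. snd (snd v) * inverse c - (fst (snd v) - snd (snd v)) * inverse (b - c))) (at x)" .
  from DERIV_compose_FDERIV[OF separatrix(3) this]
  show ?thesis
    unfolding threshold_def[symmetric] b_def[symmetric] c_def[symmetric] logistic_ln[OF p(1,2)]
    by (simp add: shape_rate_def threshold_def divide_inverse mult_ac)
qed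

lemma chart_functions_derivative:
  assumes "f \<in> chart_functions"
  shows "\<exists>f'. (\<forall>x\<in>slab. (f has_derivative f' x) (at x)) \<and> (\<forall>v. (\<lambda>x. f' x v) \<in> chart_functions)"
  using assms
proof induction
  case (const r)
  show ?case by (intro exI[of _ "\<lambda>_ _. 0"] conjI ballI allI chart_functions.const) simp
next
  case coord_a
  show ?case by (intro exI[of _ "\<lambda>_ v. fst v"] conjI ballI allI chart_functions.const)
      (auto intro!: derivative_eq_intros)
next
  case coord_b
  show ?case by (intro exI[of _ "\<lambda>_ v. fst (snd v)"] conjI ballI allI chart_functions.const)
      (auto intro!: derivative_eq_intros)
next
  case coord_c
  show ?case by (intro exI[of _ "\<lambda>_ v. snd (snd v)"] conjI ballI allI chart_functions.const)
      (auto intro!: derivative_eq_intros)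
next
  case threshold
  have nz: "x \<in> slab \<Longrightarrow> fst (snd x) \<noteq> 0" "x \<in> slab \<Longrightarrow> snd (snd x) \<noteq> 0"
    "x \<in> slab \<Longrightarrow> fst (snd x) - snd (snd x) \<noteq> 0" for x by (auto simp: slab_iff)
  have nz': "1 + threshold (fst (snd x)) (snd (snd x)) + snd (snd x) * inverse (fst (snd x)) \<noteq> 0"
    if "x \<in> slab" for x
  proof -
    have "0 < snd (snd x) * inverse (fst (snd x))" using that by (auto simp: slab_iff)
    then show ?thesis using threshold_pos[of "fst (snd x)" "snd (snd x)"] by linarith
  qed
  show ?case
    by (rule exI, rule conjI, rule ballI, erule threshold_has_derivative, rule allI)
       (intro chart_functions.intros chart_functions_minus chart_functions_diff nz nz')
next
  case (add f g)
  then obtain f' g' where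
    "\<forall>x\<in>slab. (f has_derivative f' x) (at x)" "\<forall>v. (\<lambda>x. f' x v) \<in> chart_functions"
    "\<forall>x\<in>slab. (g has_derivative g' x) (at x)" "\<forall>v. (\<lambda>x. g' x v) \<in> chart_functions" by blast
  then show ?case
    by (intro exI[of _ "\<lambda>x v. f' x v + g' x v"])
       (auto intro!: chart_functions.add has_derivative_add)
next
  case (mult f g)
  then obtain f' g' where
    "\<forall>x\<in>slab. (f has_derivative f' x) (at x)" "\<forall>v. (\<lambda>x. f' x v) \<in> chart_functions"
    "\<forall>x\<in>slab. (g has_derivative g' x) (at x)" "\<forall>v. (\<lambda>x. g' x v) \<in> chart_functions" by blast
  then show ?case using mult.hyps
    by (intro exI[of _ "\<lambda>x v. f x * g' x v + f' x v * g x"])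
       (auto intro!: chart_functions.add chart_functions.mult has_derivative_mult)
next
  case (inverse f)
  then obtain f' where
    f': "\<forall>x\<in>slab. (f has_derivative f' x) (at x)" "\<forall>v. (\<lambda>x. f' x v) \<in> chart_functions" by blast
  show ?case
  proof (intro exI[of _ "\<lambda>x v. - (inverse (f x) * f' x v * inverse (f x))"] conjI ballI allI)
    show "((\<lambda>x. inverse (f x)) has_derivative (\<lambda>v. - (inverse (f x) * f' x v * inverse (f x)))) (at x)"
      if "x \<in> slab" for x
      by (rule Deriv.has_derivative_inverse) (use f'(1) inverse.hyps that in auto)
    have "(\<lambda>x. f' x v) \<in> chart_functions" for v using f'(2) by blast
    then show "(\<lambda>x. - (inverse (f x) * f' x v * inverse (f x))) \<in> chart_functions" for v
      by (intro chart_functions_minus chart_functions.mult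
          chart_functions.inverse inverse.hyps)
  qed
qed

lemma smooth_on_chart_functions:
  assumes "f \<in> chart_functions" "g \<in> chart_functions" "h \<in> chart_functions"
  shows "smooth_on slab (\<lambda>x. (f x, g x, h x))"
proof (rule smooth_on_family[OF open_slab, where
      F = "{\<lambda>x. (f x, g x, h x) | f g h. f \<in> chart_functions \<and> g \<in> chart_functions \<and> h \<in> chart_functions}"])
  fix F assume "F \<in> {\<lambda>x. (f x, g x, h x) | f g h. f \<in> chart_functions \<and> g \<in> chart_functions \<and> h \<in> chart_functions}"
  then obtain f g h where F: "F = (\<lambda>x. (f x, g x, h x))"
    and fgh: "f \<in> chart_functions" "g \<in> chart_functions" "h \<in> chart_functions" by blast
  obtain f' where f': "\<forall>x\<in>slab. (f has_derivative f' x) (at x)" "\<forall>v. (\<lambda>x. f' x v) \<in> chart_functions"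
    using chart_functions_derivative[OF fgh(1)] by blast
  obtain g' where g': "\<forall>x\<in>slab. (g has_derivative g' x) (at x)" "\<forall>v. (\<lambda>x. g' x v) \<in> chart_functions"
    using chart_functions_derivative[OF fgh(2)] by blast
  obtain h' where h': "\<forall>x\<in>slab. (h has_derivative h' x) (at x)" "\<forall>v. (\<lambda>x. h' x v) \<in> chart_functions"
    using chart_functions_derivative[OF fgh(3)] by blast
  show "\<exists>F'. (\<forall>x\<in>slab. (F has_derivative F' x) (at x)) \<and>
      (\<forall>v. (\<lambda>x. F' x v) \<in> {\<lambda>x. (f x, g x, h x) | f g h. f \<in> chart_functions \<and> g \<in> chart_functions \<and> h \<in> chart_functions})"
  proof (intro exI[of _ "\<lambda>x v. (f' x v, g' x v, h' x v)"] conjI ballI allI)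
    show "(F has_derivative (\<lambda>v. (f' x v, g' x v, h' x v))) (at x)" if "x \<in> slab" for x
      unfolding F using f'(1) g'(1) h'(1) that by (intro has_derivative_Pair) blast+
    show "(\<lambda>x. (f' x v, g' x v, h' x v)) \<in>
        {\<lambda>x. (f x, g x, h x) | f g h. f \<in> chart_functions \<and> g \<in> chart_functions \<and> h \<in> chart_functions}" for v
      by (rule CollectI, rule exI[of _ "\<lambda>x. f' x v"], rule exI[of _ "\<lambda>x. g' x v"], rule exI[of _ "\<lambda>x. h' x v"])
         (use f'(2) g'(2) h'(2) in blast)
  qed
qed (use assms in blast)

text \<open>A shear along \<open>a\<close> whose first component is \<open>surface_offset\<close>.
  It straightens the surface into the plane where the first coordinate vanishes, so one chart serves
  all points.\<close>

definition flatten :: "real \<times> real \<times> real \<Rightarrow> real \<times> real \<times> real" where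
  "flatten x = (fst x - fst (snd x) * threshold (fst (snd x)) (snd (snd x)), fst (snd x), snd (snd x))"

definition unflatten :: "real \<times> real \<times> real \<Rightarrow> real \<times> real \<times> real" where
  "unflatten x = (fst x + fst (snd x) * threshold (fst (snd x)) (snd (snd x)), fst (snd x), snd (snd x))"

lemma surface_offset_eq: "surface_offset x = fst x - fst (snd x) * threshold (fst (snd x)) (snd (snd x))"
  by (simp add: surface_offset_def case_prod_beta)

lemma smooth_flatten: "smooth_on slab flatten" "smooth_on slab unflatten"
  unfolding flatten_def[abs_def] unflatten_def[abs_def]
  by (intro smooth_on_chart_functions chart_functions.intros chart_functions_diff)+

lemma smooth_imp_continuous: "smooth_on S f \<Longrightarrow> continuous_on S f"
  unfolding smooth_on_def by (drule spec[of _ 0]) simp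

lemma flatten_inverse: "flatten (unflatten x) = x" "unflatten (flatten x) = x"
  by (simp_all add: flatten_def unflatten_def)

lemma slab_flatten: "flatten x \<in> slab \<longleftrightarrow> x \<in> slab" "unflatten x \<in> slab \<longleftrightarrow> x \<in> slab"
  by (simp_all add: slab_iff flatten_def unflatten_def)

lemma smooth_embedded_separating_surface: "smooth_embedded_hypersurface separating_surface"
  unfolding smooth_embedded_hypersurface_def
proof
  fix p assume p: "p \<in> separating_surface"
  have hom: "homeomorphism slab slab flatten unflatten"
    by (intro homeomorphismI smooth_imp_continuous smooth_flatten) (auto simp: slab_flatten flatten_inverse)
  have img: "flatten ` (separating_surface \<inter> slab) = {y \<in> slab. y \<bullet> (1, 0, 0) = 0}"
  proof (intro equalityI subsetI)
    fix y assume "y \<in> flatten ` (separating_surface \<inter> slab)"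
    then show "y \<in> {y \<in> slab. y \<bullet> (1, 0, 0) = 0}"
      by (auto simp: separating_surface_def slab_flatten surface_offset_eq) (simp add: flatten_def)
  next
    fix y :: "real \<times> real \<times> real" assume "y \<in> {y \<in> slab. y \<bullet> (1, 0, 0) = 0}"
    then have y: "y \<in> slab" "fst y = 0" by (cases y; simp)+
    \<comment> \<open>Positivity of the threshold puts the preimage of a point of the plane at
      positive \<open>a\<close>, hence inside \<open>Q\<close>.\<close>
    have "0 < fst (snd y) * threshold (fst (snd y)) (snd (snd y))"
      using y(1) by (intro mult_pos_pos threshold_pos) (auto simp: slab_iff)
    then have "unflatten y \<in> separating_surface"
      using y by (simp add: separating_surface_def Q_iff slab_flatten surface_offset_eq) (simp add: unflatten_def)
    then show "y \<in> flatten ` (separating_surface \<inter> slab)"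
      using y(1) by (intro image_eqI[of _ _ "unflatten y"]) (auto simp: flatten_inverse slab_flatten)
  qed
  have p': "p \<in> slab" using p by (simp add: separating_surface_def Q_iff)
  have e: "(1, 0, 0) \<in> (Basis :: (real \<times> real \<times> real) set)" by (simp add: Basis_prod_def zero_prod_def)
  show "\<exists>U V \<phi> \<psi>. \<exists>e\<in>(Basis :: (real \<times> real \<times> real) set). open U \<and> p \<in> U \<and> open V \<and> homeomorphism U V \<phi> \<psi> \<and>
      smooth_on U \<phi> \<and> smooth_on V \<psi> \<and> \<phi> ` (separating_surface \<inter> U) = {y \<in> V. y \<bullet> e = 0}"
  proof (rule exI[of _ slab], rule exI[of _ slab], rule exI[of _ flatten], rule exI[of _ unflatten], rule bexI)
    show "open slab \<and> p \<in> slab \<and> open slab \<and> homeomorphism slab slab flatten unflatten \<and>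
      smooth_on slab flatten \<and> smooth_on slab unflatten \<and>
      flatten ` (separating_surface \<inter> slab) = {y \<in> slab. y \<bullet> (1, 0, 0) = 0}"
      using open_slab p' hom smooth_flatten img by blast
  qed (rule e)
qed

lemma continuous_on_surface_offset: "continuous_on slab surface_offset"
proof -
  have "continuous_on slab (\<lambda>x. fst (flatten x))"
    by (intro continuous_intros smooth_imp_continuous smooth_flatten)
  then show ?thesis by (simp add: flatten_def surface_offset_eq[abs_def])
qed

section \<open>Topology of the two regions\<close>

lemma open_Q1: "open Q1" and open_Q2: "open Q2"
proof -
  have c: "continuous_on Q surface_offset"
    by (rule continuous_on_subset[OF continuous_on_surface_offset]) (auto simp: Q_iff)
  have eq: "Q1 = Q \<inter> surface_offset -` {0<..}" "Q2 = Q \<inter> surface_offset -` {..<0}" by (auto simp: Q1_eq Q2_eq)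
  show "open Q1" unfolding eq by (rule continuous_open_preimage[OF c open_Q open_greaterThan])
  show "open Q2" unfolding eq by (rule continuous_open_preimage[OF c open_Q open_lessThan])
qed

lemma convex_Q: "convex Q"
proof -
  have eq: "Q = {x. (1, 0, 0) \<bullet> x > 0} \<inter> ({x. (0, 1, - 1) \<bullet> x > 0} \<inter> {x. (0, 0, 1) \<bullet> x > 0})"
    by (auto simp: Q_def)
  show ?thesis unfolding eq by (intro convex_Int convex_halfspace_gt)
qed

text \<open>The inverse shear moves the face \<open>a = 0\<close> of the convex set \<open>Q\<close>
  onto the surface, so \<open>Q1\<close> is a continuous image of \<open>Q\<close>.\<close>

lemma connected_Q1: "connected Q1"
proof -
  note convex_Q
  then have "connected (unflatten ` Q)"
    by (intro connected_continuous_image convex_connected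
        continuous_on_subset[OF smooth_imp_continuous[OF smooth_flatten(2)]]) (auto simp: Q_iff)
  moreover have "unflatten ` Q = Q1"
  proof (intro equalityI subsetI)
    fix y assume "y \<in> unflatten ` Q"
    then obtain x where x: "y = unflatten x" "0 < fst x" "x \<in> slab" by (auto simp: Q_iff)
    then have "0 < fst (snd x)" by (auto simp: slab_iff)
    with x have "fst y > 0" using threshold_pos[of "fst (snd x)" "snd (snd x)"]
      by (simp add: unflatten_def add_pos_pos)
    moreover have "surface_offset y = fst x" using x by (simp add: surface_offset_eq unflatten_def)
    ultimately show "y \<in> Q1" using x by (simp add: Q1_eq Q_iff slab_flatten)
  next
    fix y assume "y \<in> Q1"
    then have "flatten y \<in> Q" by (simp add: Q1_eq Q_iff slab_flatten) (simp add: flatten_def surface_offset_eq)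
    then show "y \<in> unflatten ` Q" by (metis flatten_inverse(2) imageI)
  qed
  ultimately show ?thesis by simp
qed

text \<open>Over each \<open>(b, c)\<close> the fibre of \<open>Q2\<close> is an interval from 0 to
  \<open>b * threshold b c\<close>, bounded on both sides. A shear cannot adjust its length, so the
  convex set with fibres (0, 1) is rescaled fibrewise instead.\<close>

lemma connected_Q2: "connected Q2"
proof -
  define W where "W = Q \<inter> {x. (1, 0, 0) \<bullet> x < 1}"
  define m where "m x = (fst x * (fst (snd x) * threshold (fst (snd x)) (snd (snd x))), fst (snd x), snd (snd x))"
    for x :: "real \<times> real \<times> real"
  have "convex W" unfolding W_def by (intro convex_Int convex_Q convex_halfspace_lt)
  moreover have "smooth_on slab m"
    unfolding m_def[abs_def] by (intro smooth_on_chart_functions chart_functions.intros)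
  ultimately have "connected (m ` W)"
    by (intro connected_continuous_image convex_connected
        continuous_on_subset[OF smooth_imp_continuous]) (auto simp: Q_iff W_def)
  moreover have "m ` W = Q2"
  proof (intro equalityI subsetI)
    fix y assume "y \<in> m ` W"
    then obtain x where x: "y = m x" "0 < fst x" "fst x < 1" "x \<in> slab" by (auto simp: Q_iff W_def)
    define t where "t = fst (snd x) * threshold (fst (snd x)) (snd (snd x))"
    have t: "t > 0" unfolding t_def using x(4) by (intro mult_pos_pos threshold_pos) (auto simp: slab_iff)
    then have "fst x * t > 0" "fst x * t < t" using x by auto
    then show "y \<in> Q2" using x(1,4) by (simp add: Q2_eq Q_iff slab_iff surface_offset_eq m_def t_def)
  next
    fix y assume y: "y \<in> Q2"
    define t where "t = fst (snd y) * threshold (fst (snd y)) (snd (snd y))"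
    have y': "0 < fst y" "y \<in> slab" "fst y < t" using y by (auto simp: Q2_eq Q_iff surface_offset_eq t_def)
    have t: "t > 0" using y' by linarith
    define x where "x = (fst y / t, snd y)"
    have "x \<in> W" using y' t by (simp add: W_def Q_iff slab_iff x_def inner_prod_def)
    moreover have "m x = y" using t by (simp add: m_def x_def t_def[symmetric] prod_eq_iff)
    ultimately show "y \<in> m ` W" by blast
  qed
  ultimately show ?thesis by simp
qed

lemma Q1_Q2_nonempty: "Q1 \<noteq> {}" "Q2 \<noteq> {}"
proof -
  define t where "t = 2 * threshold 2 (1::real)"
  have "t > 0" using threshold_pos[of 2 1] by (simp add: t_def)
  then have "(t + 1, 2, 1) \<in> Q1" "(t / 2, 2, 1) \<in> Q2"
    by (simp_all add: Q1_eq Q2_eq Q_def surface_offset_def t_def[symmetric])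
  then show "Q1 \<noteq> {}" "Q2 \<noteq> {}" by blast+
qed

lemma Q1_Un_Q2: "Q1 \<union> Q2 = Q - separating_surface" and Q1_Int_Q2: "Q1 \<inter> Q2 = {}"
  by (auto simp: Q1_eq Q2_eq separating_surface_def)

lemma components_Q_minus_surface: "components (Q - separating_surface) = {Q1, Q2}"
proof (rule components_open_unique)
  show "pairwise disjnt {Q1, Q2}" using Q1_Int_Q2 by (auto simp: pairwise_def disjnt_def)
  show "\<Union> {Q1, Q2} = Q - separating_surface" using Q1_Un_Q2 by simp
  show "open X \<and> connected X \<and> X \<noteq> {}" if "X \<in> {Q1, Q2}" for X
    using that open_Q1 open_Q2 connected_Q1 connected_Q2 Q1_Q2_nonempty by auto
qed

lemma Q_subset_closure: "Q \<subseteq> closure (Q1 \<union> Q2)"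
proof
  fix x assume x: "x \<in> Q"
  show "x \<in> closure (Q1 \<union> Q2)"
  proof (cases "surface_offset x = 0")
    case False
    then have "x \<in> Q1 \<union> Q2" using x by (auto simp: Q1_eq Q2_eq)
    then show ?thesis using closure_subset by blast
  next
    case True
    show ?thesis unfolding closure_approachable
    proof (intro allI impI)
      fix e :: real assume e: "e > 0"
      \<comment> \<open>Raising \<open>a\<close> by \<open>e / 2\<close> raises
        \<open>surface_offset\<close> by the same amount.\<close>
      define y where "y = (fst x + e / 2, snd x)"
      have "surface_offset y = e / 2" using True by (simp add: surface_offset_eq y_def)
      then have "y \<in> Q1" using x e by (simp add: Q1_eq Q_iff slab_iff y_def)
      moreover have "dist y x < e" using e by (cases x) (simp add: y_def dist_Pair_Pair dist_norm)
      ultimately show "\<exists>y\<in>Q1 \<union> Q2. dist y x < e" by blast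
    qed
  qed
qed

lemma generic_behavior:
  assumes "maximal_solution Tb Tf A B C" and x: "(A 0, B 0, C 0) \<in> Q1 \<union> Q2"
  shows "\<exists>T. Tb = ereal T \<and> (behavior1 T A B C \<or> behavior2 T A B C)"
proof -
  have Q: "(A 0, B 0, C 0) \<in> Q" using x unfolding Q1_Un_Q2 by blast
  obtain T where "Tb = ereal T"
    "surface_offset (A 0, B 0, C 0) > 0 \<Longrightarrow> behavior1 T A B C" "surface_offset (A 0, B 0, C 0) < 0 \<Longrightarrow> behavior2 T A B C"
    by (rule maximal_solution_trichotomy[OF assms(1) Q]) (rule that)
  moreover have "surface_offset (A 0, B 0, C 0) > 0 \<or> surface_offset (A 0, B 0, C 0) < 0"
    using x by (auto simp: Q1_eq Q2_eq)
  ultimately show ?thesis by blast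
qed

lemma surface_behavior:
  assumes "maximal_solution Tb Tf A B C" and x: "(A 0, B 0, C 0) \<in> separating_surface"
  shows "\<exists>T. Tb = ereal T \<and> A \<sim>[at_right (- T)] B \<and>
      B \<sim>[at_right (- T)] (\<lambda>t. sqrt 6 / 4 * (t + T) powr (- 1/2)) \<and>
      (A 0 * B 0 * C 0 = 4 \<longrightarrow> C \<sim>[at_right (- T)] (\<lambda>t. 32/3 * (t + T)))"
proof -
  have Q: "(A 0, B 0, C 0) \<in> Q" and z: "surface_offset (A 0, B 0, C 0) = 0"
    using x by (simp_all add: separating_surface_def)
  obtain T where "Tb = ereal T" "surface_offset (A 0, B 0, C 0) = 0 \<Longrightarrow> edge_behavior T A B C"
    by (rule maximal_solution_trichotomy[OF assms(1) Q]) (rule that)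
  with z show ?thesis unfolding edge_behavior_def by blast
qed

theorem theorem2p3:
  shows
    "(\<exists>Q0. open Q0 \<and> Q0 \<subseteq> Q \<and> Q \<subseteq> closure Q0 \<and>
        (\<forall>Tb Tf A B C. maximal_solution Tb Tf A B C \<and> (A 0, B 0, C 0) \<in> Q0 \<longrightarrow>
           (\<exists>T. Tb = ereal T \<and> (behavior1 T A B C \<or> behavior2 T A B C)))) \<and>
     (\<exists>S0. S0 \<subseteq> Q \<and> smooth_embedded_hypersurface S0 \<and>
        components (Q - S0) = {Q1, Q2} \<and> Q1 \<noteq> Q2 \<and>
        (\<forall>Tb Tf A B C. maximal_solution Tb Tf A B C \<and> (A 0, B 0, C 0) \<in> S0 \<longrightarrow>
           (\<exists>T. Tb = ereal T \<and>
              A \<sim>[at_right (- T)] B \<and>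
              B \<sim>[at_right (- T)] (\<lambda>t. sqrt 6 / 4 * (t + T) powr (- 1/2)) \<and>
              (A 0 * B 0 * C 0 = 4 \<longrightarrow>
                 C \<sim>[at_right (- T)] (\<lambda>t. 32/3 * (t + T))))))"
proof (rule conjI, rule exI[of _ "Q1 \<union> Q2"], goal_cases)
  case 1
  show ?case
  proof (intro conjI allI impI)
    show "Q1 \<union> Q2 \<subseteq> Q" by (auto simp: Q1_Un_Q2)
  qed (rule open_Un[OF open_Q1 open_Q2], rule Q_subset_closure, elim conjE, rule generic_behavior, assumption+)
next
  case 2
  show ?case
  proof (rule exI[of _ separating_surface], intro conjI allI impI)
    show "separating_surface \<subseteq> Q" by (auto simp: separating_surface_def)
    show "Q1 \<noteq> Q2" using Q1_Int_Q2 Q1_Q2_nonempty by blast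
  qed (rule smooth_embedded_separating_surface, rule components_Q_minus_surface,
      elim conjE, rule surface_behavior, assumption+)
qed

end
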